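(* Let $s,t\ge0$, $0<\theta<\mu$ and $0\le\xi<\theta$. Let $\Psi_0=\Gamma'/\Gamma$ and $\Psi_1=\Psi_0'$. (a) The (almost sure) limit $p^{(\theta),\mathrm{hor}}(s,t)=\lim_{n\to\infty}n^{-1}\log Z^{(\theta),\mathrm{hor}}_{\lfloor ns\rfloor,\lfloor nt\rfloor}$ exists and is given by $$p^{(\theta),\mathrm{hor}}(s,t)=\begin{cases}-s\Psi_0(\theta)-t\Psi_0(\mu-\theta), & \text{if } s\Psi_1(\theta)\ge t\Psi_1(\mu-\theta),\\ p(s,t), & \text{if } s\Psi_1(\theta)<t\Psi_1(\mu-\theta).\end{cases}$$ (b) The limit $\Lambda^{\mathrm{hor}}_{\theta,(s,t)}(\xi)=\lim_{n\to\infty}n^{-1}\log\mathbb E\,e^{\xi\log Z^{(\theta),\mathrm{hor}}_{\lfloor ns\rfloor,\lfloor nt\rfloor}}$ exists and is given by $$\Lambda^{\mathrm{hor}}_{\theta,(s,t)}(\xi)=\begin{cases}s\,M_\theta(\xi)-t\,M_{\mu-\theta}(-\xi), & \text{if } s\big(\Psi_0(\theta)-\Psi_0(\theta-\xi)\big)\ge t\big(\Psi_0(\mu-\theta+\xi)-\Psi_0(\mu-\theta)\big),\\ \Lambda_{s,t}(\xi), & \text{otherwise.}\end{cases}$$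
   Context: $\mathrm{Gamma}(\nu)$ is the distribution on $(0,\infty)$ with density $\Gamma(\nu)^{-1}x^{\nu-1}e^{-x}$. For $\nu>0$, $M_\nu(\xi)=\log\Gamma(\nu-\xi)-\log\Gamma(\nu)$ for $\xi<\nu$ and $M_\nu(\xi)=\infty$ for $\xi\ge\nu$. Stationary log-gamma model with parameters $(\mu,\theta)$, $0<\theta<\mu<\infty$: $\{U_{i,0},V_{0,j},Y_{i,j}:i,j\in\mathbb N\}$ ($\mathbb N=\{1,2,\dots\}$) are independent random variables with $U_{i,0}^{-1}\sim\mathrm{Gamma}(\theta)$, $V_{0,j}^{-1}\sim\mathrm{Gamma}(\mu-\theta)$ and $Y_{i,j}^{-1}\sim\mathrm{Gamma}(\mu)$; the weights on $\mathbb Z_+^2$ are $1$ at the origin, $U_{i,0}$ at $(i,0)$, $V_{0,j}$ at $(0,j)$ and $Y_{i,j}$ at $(i,j)$ for $i,j\in\mathbb N$. The stationary partition function $Z^{(\theta)}_{m,n}$ is the sum, over all paths from $(0,0)$ to $(m,n)$ with steps in $\{(1,0),(0,1)\}$, of the product of the weights along the path. For $\mathbf v\le\mathbf u$ (coordinatewise) let $Z^\square_{\mathbf v,\mathbf u}=\sum_{x_\cdot}\prod_{j=0}^{m}Y_{x_j}$, where $m=|\mathbf u-\mathbf v|_1$ and the sum is over all paths $x_0=\mathbf v,x_1,\dots,x_m=\mathbf u$ with steps in $\{(1,0),(0,1)\}$ (the weight at the starting point is included). The horizontal partition function is the part of $Z^{(\theta)}_{\lfloor ns\rfloor,\lfloor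 nt\rfloor}$ that corresponds to paths whose first step is horizontal: $$Z^{(\theta),\mathrm{hor}}_{\lfloor ns\rfloor,\lfloor nt\rfloor}=\sum_{k=1}^{\lfloor ns\rfloor}\Big(\prod_{i=1}^kU_{i,0}\Big)Z^\square_{(k,1),(\lfloor ns\rfloor,\lfloor nt\rfloor)}.$$ The functions $p$ and $\Lambda_{s,t}$ are $p(s,t)=\inf_{0<\rho<\mu}\{-s\Psi_0(\rho)-t\Psi_0(\mu-\rho)\}$ and, for $0\le\xi<\mu$, $\Lambda_{s,t}(\xi)=\inf_{\rho\in(\xi,\mu)}\{t\,M_\rho(\xi)-s\,M_{\mu-\rho}(-\xi)\}$. (They are respectively the limiting free energy and the limiting logarithmic moment generating function of the model in which all weights are i.i.d. with $\mathrm{Gamma}(\mu)$ reciprocals.)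
   Formalization: The case s=0 is excluded (s>0 is required), since there Z^hor is an empty sum equal to 0 and the claimed finite limits fail; when ⌊nt⌋=0, Z^hor is read as the part of Z from paths with horizontal first step, because the displayed sum would be empty. *)

theory Defs
  imports "HOL-Probability.Probability"
begin

section \<open>Gamma distribution and the limit functions\<close>

definition gamma_density :: "real \<Rightarrow> real \<Rightarrow> real" where
  "gamma_density \<nu> x = (if x > 0 then x powr (\<nu> - 1) * exp (- x) / Gamma \<nu> else 0)"

definition log_mgf :: "real \<Rightarrow> real \<Rightarrow> ereal" where
  "log_mgf \<nu> \<xi> = (if \<xi> < \<nu> then ereal (ln (Gamma (\<nu> - \<xi>)) - ln (Gamma \<nu>)) else \<infinity>)"

text \<open>\<open>Polygamma 0\<close> (abbreviated \<open>Digamma\<close>) and \<open>Polygamma 1\<close> are the functions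
  $\Psi_0 = \Gamma'/\Gamma$ and $\Psi_1 = \Psi_0'$. For $s, t \ge 0$ the infimum below is over a
  nonempty set that is bounded below, since $\Psi_0$ is increasing on $(0,\infty)$.\<close>

definition free_energy :: "real \<Rightarrow> real \<Rightarrow> real \<Rightarrow> real" where
  "free_energy \<mu> s t = (INF \<rho>\<in>{0<..<\<mu>}. - s * Digamma \<rho> - t * Digamma (\<mu> - \<rho>))"

definition limit_log_mgf :: "real \<Rightarrow> real \<Rightarrow> real \<Rightarrow> real \<Rightarrow> ereal" where
  "limit_log_mgf \<mu> s t \<xi> =
     (INF \<rho>\<in>{\<xi><..<\<mu>}. ereal t * log_mgf \<rho> \<xi> - ereal s * log_mgf (\<mu> - \<rho>) (- \<xi>))"


section \<open>Up-right lattice paths and partition functions\<close>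

type_synonym site = "nat \<times> nat"

definition lattice_step :: "site \<Rightarrow> site \<Rightarrow> bool" where
  "lattice_step x y \<longleftrightarrow> y = (fst x + 1, snd x) \<or> y = (fst x, snd x + 1)"

definition lattice_paths :: "site \<Rightarrow> site \<Rightarrow> site list set" where
  "lattice_paths v u = {xs. xs \<noteq> [] \<and> hd xs = v \<and> last xs = u \<and> successively lattice_step xs}"

definition path_sum :: "(site \<Rightarrow> real) \<Rightarrow> site list set \<Rightarrow> real" where
  "path_sum w A = (\<Sum>xs\<in>A. prod_list (map w xs))"

abbreviation Z_square :: "(site \<Rightarrow> real) \<Rightarrow> site \<Rightarrow> site \<Rightarrow> real" where
  "Z_square w v u \<equiv> path_sum w (lattice_paths v u)"

text \<open>The part of the partition function from the origin to \<open>u\<close> carried by the paths whose first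
  step is horizontal. For endpoints off the horizontal axis, lemma \<open>Z_hor_eq\<close> below
  gives the decomposition by the exit point from the axis; when \<open>u = (m, 0)\<close> with \<open>m > 0\<close>
  the only path is the one along the axis.\<close>

definition Z_hor :: "(site \<Rightarrow> real) \<Rightarrow> site \<Rightarrow> real" where
  "Z_hor w u = path_sum w {xs \<in> lattice_paths (0, 0) u. length xs \<ge> 2 \<and> xs ! 1 = (1, 0)}"


section \<open>The stationary log-gamma model\<close>

text \<open>\<open>U i\<close>, \<open>V j\<close> and \<open>Y i j\<close> are used for \<open>i, j \<ge> 1\<close> only.\<close>

definition stationary_weight ::
    "(nat \<Rightarrow> 'a \<Rightarrow> real) \<Rightarrow> (nat \<Rightarrow> 'a \<Rightarrow> real) \<Rightarrow> (nat \<Rightarrow> nat \<Rightarrow> 'a \<Rightarrow> real) \<Rightarrow> 'a \<Rightarrow> site \<Rightarrow> real" where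
  "stationary_weight U V Y \<omega> x =
     (case x of (i, j) \<Rightarrow>
        if i = 0 \<and> j = 0 then 1
        else if j = 0 then U i \<omega>
        else if i = 0 then V j \<omega>
        else Y i j \<omega>)"

text \<open>Independence of the whole family is expressed through the sites of the lattice other than the
  origin, each of which carries exactly one of the variables.\<close>

definition stationary_log_gamma ::
    "'a measure \<Rightarrow> real \<Rightarrow> real \<Rightarrow> (nat \<Rightarrow> 'a \<Rightarrow> real) \<Rightarrow> (nat \<Rightarrow> 'a \<Rightarrow> real) \<Rightarrow>
      (nat \<Rightarrow> nat \<Rightarrow> 'a \<Rightarrow> real) \<Rightarrow> bool" where
  "stationary_log_gamma P \<mu> \<theta> U V Y \<longleftrightarrow>
     prob_space P \<and>
     prob_space.indep_vars P (\<lambda>_. borel) (\<lambda>x \<omega>. stationary_weight U V Y \<omega> x) (UNIV - {(0, 0)}) \<and>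
     (\<forall>i\<ge>1. distributed P lborel (\<lambda>\<omega>. inverse (U i \<omega>)) (\<lambda>x. ennreal (gamma_density \<theta> x))) \<and>
     (\<forall>j\<ge>1. distributed P lborel (\<lambda>\<omega>. inverse (V j \<omega>)) (\<lambda>x. ennreal (gamma_density (\<mu> - \<theta>) x))) \<and>
     (\<forall>i\<ge>1. \<forall>j\<ge>1. distributed P lborel (\<lambda>\<omega>. inverse (Y i j \<omega>)) (\<lambda>x. ennreal (gamma_density \<mu> x)))"


section \<open>Basic facts about the path sums\<close>

lemma lattice_paths_mono:
  assumes "successively lattice_step xs" "x \<in> set xs"
  shows "fst (hd xs) \<le> fst x \<and> snd (hd xs) \<le> snd x"
  using assms
proof (induction xs)
  case (Cons a xs)
  then show ?case
    by (cases xs) (auto simp: lattice_step_def)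
qed auto

lemma lattice_paths_rec:
  "lattice_paths v u = (if v = u then {[u]} else
     (#) v ` (lattice_paths (fst v + 1, snd v) u \<union> lattice_paths (fst v, snd v + 1) u))"
proof (intro set_eqI iffI)
  fix xs assume xs: "xs \<in> lattice_paths v u"
  then obtain ys where ys: "xs = v # ys"
    by (cases xs) (auto simp: lattice_paths_def)
  show "xs \<in> (if v = u then {[u]} else
     (#) v ` (lattice_paths (fst v + 1, snd v) u \<union> lattice_paths (fst v, snd v + 1) u))"
  proof (cases ys)
    case Nil
    then show ?thesis using xs ys by (auto simp: lattice_paths_def)
  next
    case (Cons y zs)
    have s: "lattice_step v y" "successively lattice_step ys" "last ys = u"
      using xs ys Cons by (auto simp: lattice_paths_def)
    have "u \<in> set ys" using s(3) Cons by (metis last_in_set list.distinct(1))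
    then have "fst y \<le> fst u \<and> snd y \<le> snd u"
      using lattice_paths_mono[OF s(2)] Cons by auto
    then have "v \<noteq> u" using s(1) by (auto simp: lattice_step_def)
    moreover have "ys \<in> lattice_paths y u"
      using s Cons by (auto simp: lattice_paths_def)
    ultimately show ?thesis using s(1) ys by (auto simp: lattice_step_def)
  qed
next
  fix xs assume "xs \<in> (if v = u then {[u]} else
     (#) v ` (lattice_paths (fst v + 1, snd v) u \<union> lattice_paths (fst v, snd v + 1) u))"
  then show "xs \<in> lattice_paths v u"
    by (auto simp: lattice_paths_def successively_Cons lattice_step_def split: if_splits)
qed

lemma lattice_paths_empty:
  assumes "\<not> (fst v \<le> fst u \<and> snd v \<le> snd u)"
  shows "lattice_paths v u = {}"
proof -
  have False if "xs \<in> lattice_paths v u" for xs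
    using that lattice_paths_mono[of xs u] assms
    by (auto simp: lattice_paths_def last_in_set)
  then show ?thesis by auto
qed

lemma finite_lattice_paths: "finite (lattice_paths v u)"
proof (induction "(fst u + snd u + 1) - (fst v + snd v)" arbitrary: v rule: less_induct)
  case less
  show ?case
  proof (cases "fst v \<le> fst u \<and> snd v \<le> snd u")
    case False
    then show ?thesis by (simp add: lattice_paths_empty)
  next
    case True
    have "finite (lattice_paths (fst v + 1, snd v) u)" "finite (lattice_paths (fst v, snd v + 1) u)"
      using True by (auto intro!: less)
    then show ?thesis by (subst lattice_paths_rec) auto
  qed
qed

lemma lattice_paths_disjoint: "a \<noteq> b \<Longrightarrow> lattice_paths a u \<inter> lattice_paths b u = {}"
  by (auto simp: lattice_paths_def)

lemma path_sum_Cons: "path_sum w ((#) v ` A) = w v * path_sum w A"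
  unfolding path_sum_def sum_distrib_left by (subst sum.reindex) auto

lemma Z_square_rec:
  assumes "v \<noteq> u"
  shows "Z_square w v u =
     w v * (Z_square w (fst v + 1, snd v) u + Z_square w (fst v, snd v + 1) u)"
proof -
  have "Z_square w v u = w v * path_sum w
      (lattice_paths (fst v + 1, snd v) u \<union> lattice_paths (fst v, snd v + 1) u)"
    using assms path_sum_Cons by (subst lattice_paths_rec) auto
  also have "path_sum w
      (lattice_paths (fst v + 1, snd v) u \<union> lattice_paths (fst v, snd v + 1) u) =
      Z_square w (fst v + 1, snd v) u + Z_square w (fst v, snd v + 1) u"
    unfolding path_sum_def
    by (rule sum.union_disjoint) (auto simp: finite_lattice_paths lattice_paths_disjoint)
  finally show ?thesis .
qed

lemma Z_square_exit:
  assumes "n \<ge> 1"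
  shows "Z_square w (a, 0) (m, n) =
     (\<Sum>k=a..m. (\<Prod>i=a..k. w (i, 0)) * Z_square w (k, 1) (m, n))"
proof (induction "Suc m - a" arbitrary: a)
  case 0
  then show ?case by (simp add: lattice_paths_empty path_sum_def)
next
  case (Suc d)
  then have am: "a \<le> m" by simp
  have IH: "Z_square w (Suc a, 0) (m, n) =
     (\<Sum>k=Suc a..m. (\<Prod>i=Suc a..k. w (i, 0)) * Z_square w (k, 1) (m, n))"
    using Suc by auto
  have "Z_square w (a, 0) (m, n) =
      w (a, 0) * Z_square w (a, 1) (m, n) + w (a, 0) * Z_square w (Suc a, 0) (m, n)"
    using assms by (subst Z_square_rec) (auto simp: algebra_simps)
  also have "w (a, 0) * Z_square w (Suc a, 0) (m, n) =
      (\<Sum>k=Suc a..m. (\<Prod>i=a..k. w (i, 0)) * Z_square w (k, 1) (m, n))"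
    unfolding IH sum_distrib_left
    by (intro sum.cong refl) (auto simp: prod.atLeast_Suc_atMost mult.assoc)
  also have "w (a, 0) * Z_square w (a, 1) (m, n) +
      (\<Sum>k=Suc a..m. (\<Prod>i=a..k. w (i, 0)) * Z_square w (k, 1) (m, n)) =
      (\<Sum>k=a..m. (\<Prod>i=a..k. w (i, 0)) * Z_square w (k, 1) (m, n))"
    using am by (simp add: sum.atLeast_Suc_atMost)
  finally show ?case .
qed

lemma Z_hor_rec: "Z_hor w u = w (0, 0) * Z_square w (1, 0) u"
proof -
  have "{xs \<in> lattice_paths (0, 0) u. length xs \<ge> 2 \<and> xs ! 1 = (1, 0)} =
      (#) (0, 0) ` lattice_paths (1, 0) u" (is "?A = ?B")
  proof (intro set_eqI iffI)
    fix xs assume xs: "xs \<in> ?A"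
    then obtain x y zs where "xs = x # y # zs"
      by (cases xs; cases "tl xs") auto
    then show "xs \<in> ?B" using xs by (auto simp: lattice_paths_def)
  next
    fix xs assume "xs \<in> ?B"
    then obtain ys where ys: "xs = (0, 0) # ys" "ys \<in> lattice_paths (1, 0) u" by auto
    then obtain zs where "ys = (1, 0) # zs"
      by (cases ys) (auto simp: lattice_paths_def)
    then show "xs \<in> ?A" using ys by (auto simp: lattice_paths_def lattice_step_def)
  qed
  then show ?thesis unfolding Z_hor_def by (simp add: path_sum_Cons)
qed

lemma Z_hor_eq:
  assumes "n \<ge> 1"
  shows "Z_hor (stationary_weight U V Y \<omega>) (m, n) =
     (\<Sum>k=1..m. (\<Prod>i=1..k. U i \<omega>) * Z_square (\<lambda>(i, j). Y i j \<omega>) (k, 1) (m, n))"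
proof -
  let ?w = "stationary_weight U V Y \<omega>"
  have Y: "Z_square ?w (k, 1) (m, n) = Z_square (\<lambda>(i, j). Y i j \<omega>) (k, 1) (m, n)"
    if "k \<ge> 1" for k
    unfolding path_sum_def
  proof (rule sum.cong[OF refl])
    fix xs assume xs: "xs \<in> lattice_paths (k, 1) (m, n)"
    have "?w x = (case x of (i, j) \<Rightarrow> Y i j \<omega>)" if "x \<in> set xs" for x
      using lattice_paths_mono[of xs x] xs that \<open>k \<ge> 1\<close>
      by (cases x) (auto simp: lattice_paths_def stationary_weight_def)
    then show "prod_list (map ?w xs) = prod_list (map (\<lambda>(i, j). Y i j \<omega>) xs)"
      by (metis (no_types, lifting) map_cong)
  qed
  have "Z_hor ?w (m, n) = (\<Sum>k=1..m. (\<Prod>i=1..k. ?w (i, 0)) * Z_square ?w (k, 1) (m, n))"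
    using Z_square_exit[OF assms, of ?w 1 m] by (simp add: Z_hor_rec stationary_weight_def)
  also have "\<dots> = (\<Sum>k=1..m. (\<Prod>i=1..k. U i \<omega>) * Z_square (\<lambda>(i, j). Y i j \<omega>) (k, 1) (m, n))"
  proof (rule sum.cong[OF refl])
    fix k assume k: "k \<in> {1..m}"
    have "(\<Prod>i=1..k. ?w (i, 0)) = (\<Prod>i=1..k. U i \<omega>)"
      by (intro prod.cong refl) (auto simp: stationary_weight_def)
    then show "(\<Prod>i=1..k. ?w (i, 0)) * Z_square ?w (k, 1) (m, n) =
        (\<Prod>i=1..k. U i \<omega>) * Z_square (\<lambda>(i, j). Y i j \<omega>) (k, 1) (m, n)"
      using Y k by simp
  qed
  finally show ?thesis .
qed

end

theory Submission
  imports Defs "HOL-Real_Asymp.Real_Asymp"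
begin

text \<open>
  By the Burke property (a consequence of the beta-gamma identity) the full partition function divided
  by the product of the vertical boundary weights has the law of a product of \<open>m\<close> independent
  reciprocal Gamma variables. Decomposing the paths by their exit point from the axes writes this quotient as a sum
  of terms $U_1 \cdots U_k\, Z^\square_{(k,1),(m,n)} / (V_1 \cdots V_n)$ and
  $Z^\square_{(1,l),(m,n)} / (V_{l+1} \cdots V_n)$, in which all factors are independent. Since the bulk
  factors do not depend on \<open>\<theta>\<close>, each term can be bounded by the identity for any other parameter. This gives the
  upper bounds. At the parameter that minimises the exponent for \<open>(s, t)\<close>, a slight change of the parameter shows that the terms
  leaving the axes at a macroscopic distance are exponentially negligible, so the remaining ones carry the whole
  sum, and these are comparable with the bulk partition function from the corner: this is the lower
  bound for the bulk. The horizontal partition function is then bounded below by its term with the optimal exit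
  point. The same decomposition, applied to moments of small order together with Markov's inequality, gives
  exponential tail bounds and, by Borel--Cantelli, the almost sure limit.
\<close>

section \<open>Gamma distributions and the beta-gamma identity\<close>

text \<open>Upper bounds come cheaply, since a single exit term is at most the whole sum. The
  obstacle is the lower bound for the bulk: its moment must be solved for out of an inequality which
  it enters through the exits near the corner, and this works only if \<theta> is the stationary
  point of the exponent in direction (s, t). The given \<theta> is usually another one. Hence the
  bulk is described by objects without \<theta> (\<open>bulk_law\<close>,
  \<open>bulk_moment\<close>), and lemmas on them build a model with the parameter they want
  (\<open>log_gamma_model_exists\<close>). In the horizontal sum the exit point is free: leaving the
  axis near a N leaves the direction (s - a, t), and for t > 0 some a in [0, s) makes \<theta>
  stationary for it exactly under the inequality that separates the two cases; otherwise the
  minimiser lies left of \<theta> and a = 0 is taken. Positive moments control only upper tails.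
  Lower tails use negative moments of the Burke ratio, which are exact, and a union bound carries
  them over to the bulk. The constants in (a) appear as the order \<eta> of the moment tends to 0:
  M_\<nu>(\<eta>) / \<eta> tends to -\<Psi>_0(\<nu>).\<close>

definition gamma_dist :: "real \<Rightarrow> real measure" where
  "gamma_dist \<nu> = density lborel (\<lambda>x. ennreal (gamma_density \<nu> x))"

lemma gamma_density_measurable [measurable]: "gamma_density \<nu> \<in> borel_measurable borel"
  unfolding gamma_density_def[abs_def] by measurable

lemma gamma_density_nonneg: "\<nu> > 0 \<Longrightarrow> 0 \<le> gamma_density \<nu> x"
  by (auto simp: gamma_density_def intro!: divide_nonneg_pos)

lemma sets_gamma_dist [measurable_cong, simp]: "sets (gamma_dist \<nu>) = sets borel"
  by (simp add: gamma_dist_def)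

lemma space_gamma_dist [simp]: "space (gamma_dist \<nu>) = UNIV"
  by (simp add: gamma_dist_def)

lemma nn_integral_powr_exp:
  assumes "\<nu> > 0"
  shows "(\<integral>\<^sup>+x. ennreal (if x > 0 then x powr (\<nu> - 1) * exp (- x) else 0) \<partial>lborel) = ennreal (Gamma \<nu>)"
proof -
  have "(\<integral>\<^sup>+x. ennreal (if x > 0 then x powr (\<nu> - 1) * exp (- x) else 0) \<partial>lborel)
      = (\<integral>\<^sup>+t. ennreal (indicator {0..} t * t powr (\<nu> - 1) / exp t) \<partial>lborel)"
    by (intro nn_integral_cong) (auto simp: exp_minus field_simps indicator_def)
  then show ?thesis using Gamma_conv_nn_integral_real[OF assms] by simp
qed

lemma nn_integral_gamma_dist:
  assumes [measurable]: "f \<in> borel_measurable borel"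
  shows "(\<integral>\<^sup>+x. f x \<partial>gamma_dist \<nu>) = (\<integral>\<^sup>+x. ennreal (gamma_density \<nu> x) * f x \<partial>lborel)"
  unfolding gamma_dist_def by (subst nn_integral_density) auto

text \<open>The factor \<open>x powr (- \<xi>)\<close> merely lowers the shape in the Gamma kernel
  from \<nu> to \<nu> - \<xi>. The exponent carries a minus sign because the weights of the model
  are reciprocals of Gamma variables.\<close>

lemma gamma_dist_moment:
  assumes "0 < \<nu>" "\<xi> < \<nu>"
  shows "(\<integral>\<^sup>+x. ennreal (x powr (- \<xi>)) \<partial>gamma_dist \<nu>) = ennreal (Gamma (\<nu> - \<xi>) / Gamma \<nu>)"
proof -
  have "(\<integral>\<^sup>+x. ennreal (x powr (- \<xi>)) \<partial>gamma_dist \<nu>)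
     = (\<integral>\<^sup>+x. ennreal (1 / Gamma \<nu>) * ennreal (if x > 0 then x powr ((\<nu> - \<xi>) - 1) * exp (- x) else 0) \<partial>lborel)"
  proof (subst nn_integral_gamma_dist, simp, rule nn_integral_cong)
    fix x :: real
    have "x powr (\<nu> - 1) * x powr (- \<xi>) = x powr (\<nu> - \<xi> - 1)" if "x > 0"
      using that by (simp add: powr_add[symmetric] algebra_simps)
    then show "ennreal (gamma_density \<nu> x) * ennreal (x powr (- \<xi>)) =
        ennreal (1 / Gamma \<nu>) * ennreal (if x > 0 then x powr ((\<nu> - \<xi>) - 1) * exp (- x) else 0)"
      using assms Gamma_real_pos[of \<nu>] by (simp add: gamma_density_def ennreal_mult'[symmetric])
  qed
  also have "\<dots> = ennreal (1 / Gamma \<nu>) * ennreal (Gamma (\<nu> - \<xi>))"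
    using assms by (subst nn_integral_cmult, simp, subst nn_integral_powr_exp) auto
  finally show ?thesis using assms by (simp add: ennreal_mult[symmetric] Gamma_real_pos)
qed

lemma prob_space_gamma_dist:
  assumes "0 < \<nu>"
  shows "prob_space (gamma_dist \<nu>)"
proof
  have "emeasure (gamma_dist \<nu>) (space (gamma_dist \<nu>)) = (\<integral>\<^sup>+x. 1 \<partial>gamma_dist \<nu>)"
    by simp
  also have "\<dots> = (\<integral>\<^sup>+x. ennreal (gamma_density \<nu> x) \<partial>lborel)"
    by (subst nn_integral_gamma_dist) auto
  \<comment> \<open>The inserted power equals 1 except at x = 0, where \<open>0 powr 0 = 0\<close>;
    the density vanishes there anyway.\<close>
  also have "\<dots> = (\<integral>\<^sup>+x. ennreal (gamma_density \<nu> x) * ennreal (x powr (- 0)) \<partial>lborel)"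
    by (intro nn_integral_cong) (auto simp: gamma_density_def)
  also have "\<dots> = (\<integral>\<^sup>+x. ennreal (x powr (- 0)) \<partial>gamma_dist \<nu>)"
    by (subst nn_integral_gamma_dist) auto
  also have "\<dots> = ennreal (Gamma (\<nu> - 0) / Gamma \<nu>)"
    using assms by (intro gamma_dist_moment)
  finally show "emeasure (gamma_dist \<nu>) (space (gamma_dist \<nu>)) = 1"
    using Gamma_real_pos[OF assms] by simp
qed

lemma AE_gamma_dist_pos: "0 < \<nu> \<Longrightarrow> AE x in gamma_dist \<nu>. 0 < x"
  unfolding gamma_dist_def by (subst AE_density) (auto simp: gamma_density_def)

section \<open>Polar coordinates for a pair of Gamma variables\<close>

lemma nn_integral_lborel_scale:
  fixes s :: real
  assumes [measurable]: "f \<in> borel_measurable borel" and s: "s > 0"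
  shows "(\<integral>\<^sup>+x. f x \<partial>lborel) = (\<integral>\<^sup>+x. ennreal s * f (s * x) \<partial>lborel)"
  using nn_integral_real_affine[of f s 0] s by (simp add: nn_integral_cmult)

text \<open>Density of the Beta(\<theta>, \<kappa>) law, the law of u / (u + v) for independent u ~
  Gamma(\<theta>) and v ~ Gamma(\<kappa>).\<close>

definition beta_kernel :: "real \<Rightarrow> real \<Rightarrow> real \<Rightarrow> real" where
  "beta_kernel \<theta> \<kappa> b = (if 0 < b \<and> b < 1
     then b powr (\<theta> - 1) * (1 - b) powr (\<kappa> - 1) * Gamma (\<theta> + \<kappa>) / (Gamma \<theta> * Gamma \<kappa>) else 0)"

lemma beta_kernel_measurable [measurable]: "beta_kernel \<theta> \<kappa> \<in> borel_measurable borel"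
  unfolding beta_kernel_def[abs_def] by measurable

text \<open>Substitution u = s b, v = s (1 - b) with Jacobian s. The joint density splits into a
  function of s and a function of b: the sum of two independent Gamma variables is independent of
  their relative shares.\<close>

lemma gamma_density_polar:
  assumes "0 < \<theta>" "0 < \<kappa>" "0 < s"
  shows "s * (gamma_density \<theta> (s * b) * gamma_density \<kappa> (s - s * b))
       = gamma_density (\<theta> + \<kappa>) s * beta_kernel \<theta> \<kappa> b"
proof (cases "0 < b \<and> b < 1")
  case True
  have pos: "0 < s * b" "0 < s - s * b" using True assms by (auto simp: algebra_simps)
  have G: "Gamma \<theta> \<noteq> 0" "Gamma \<kappa> \<noteq> 0" "Gamma (\<theta> + \<kappa>) \<noteq> 0"
    using Gamma_real_pos[of \<theta>] Gamma_real_pos[of \<kappa>] Gamma_real_pos[of "\<theta> + \<kappa>"] assms by linarith+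
  have "s * ((s * b) powr (\<theta> - 1) * (s * (1 - b)) powr (\<kappa> - 1))
      = s powr (\<theta> + \<kappa> - 1) * (b powr (\<theta> - 1) * (1 - b) powr (\<kappa> - 1))"
  proof -
    have "s * (s powr (\<theta> - 1) * s powr (\<kappa> - 1)) = s powr (\<theta> + \<kappa> - 1)"
      using assms by (simp add: powr_add[symmetric] powr_mult_base)
    then have "s powr (\<theta> + \<kappa> - 1) * (b powr (\<theta> - 1) * (1 - b) powr (\<kappa> - 1)) =
        s * (s powr (\<theta> - 1) * s powr (\<kappa> - 1)) * (b powr (\<theta> - 1) * (1 - b) powr (\<kappa> - 1))"
      by simp
    also have "\<dots> = s * ((s * b) powr (\<theta> - 1) * (s * (1 - b)) powr (\<kappa> - 1))"
      using True assms by (simp add: powr_mult)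
    finally show ?thesis by simp
  qed
  moreover have "exp (- (s * b)) * exp (- (s - s * b)) = exp (- s)"
    by (simp add: exp_add[symmetric])
  moreover have "s * (gamma_density \<theta> (s * b) * gamma_density \<kappa> (s - s * b)) =
      s * ((s * b) powr (\<theta> - 1) * (s * (1 - b)) powr (\<kappa> - 1)) *
        (exp (- (s * b)) * exp (- (s - s * b))) / (Gamma \<theta> * Gamma \<kappa>)"
    using pos by (simp add: gamma_density_def right_diff_distrib)
  ultimately show ?thesis
    using True assms pos G unfolding gamma_density_def beta_kernel_def by simp
next
  case False
  then have "\<not> (s * b > 0 \<and> s - s * b > 0)" using assms
    by (auto simp: zero_less_mult_iff)
  then show ?thesis using False assms by (auto simp: gamma_density_def beta_kernel_def)
qed

lemma gamma_polar:
  assumes [measurable]: "case_prod h \<in> borel_measurable (borel \<Otimes>\<^sub>M borel)"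
    and pos: "0 < \<theta>" "0 < \<kappa>"
  shows "(\<integral>\<^sup>+u. \<integral>\<^sup>+v. h u v \<partial>gamma_dist \<kappa> \<partial>gamma_dist \<theta>) =
    (\<integral>\<^sup>+s. \<integral>\<^sup>+b. ennreal (beta_kernel \<theta> \<kappa> b) * h (s * b) (s * (1 - b)) \<partial>lborel \<partial>gamma_dist (\<theta> + \<kappa>))"
proof -
  have m[measurable]: "(\<lambda>x. h (f x) (g x)) \<in> borel_measurable N"
    if [measurable]: "f \<in> borel_measurable N" "g \<in> borel_measurable N" for f g and N :: "'z measure"
    using measurable_compose[OF measurable_Pair[OF that] assms(1)] by simp
  have "(\<integral>\<^sup>+u. \<integral>\<^sup>+v. h u v \<partial>gamma_dist \<kappa> \<partial>gamma_dist \<theta>) =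
     (\<integral>\<^sup>+u. (\<integral>\<^sup>+v. ennreal (gamma_density \<theta> u) * (ennreal (gamma_density \<kappa> v) * h u v) \<partial>lborel) \<partial>lborel)"
    by (simp add: nn_integral_gamma_dist nn_integral_cmult)
  also have "\<dots> = (\<integral>\<^sup>+u. (\<integral>\<^sup>+s. ennreal (gamma_density \<theta> u) * (ennreal (gamma_density \<kappa> (s - u)) * h u (s - u)) \<partial>lborel) \<partial>lborel)"
  proof (rule nn_integral_cong)
    fix u :: real
    show "(\<integral>\<^sup>+v. ennreal (gamma_density \<theta> u) * (ennreal (gamma_density \<kappa> v) * h u v) \<partial>lborel) =
      (\<integral>\<^sup>+s. ennreal (gamma_density \<theta> u) * (ennreal (gamma_density \<kappa> (s - u)) * h u (s - u)) \<partial>lborel)"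
      by (subst nn_integral_real_affine[where c=1 and t="-u"]) auto
  qed
  also have "\<dots> = (\<integral>\<^sup>+s. (\<integral>\<^sup>+u. ennreal (gamma_density \<theta> u) * (ennreal (gamma_density \<kappa> (s - u)) * h u (s - u)) \<partial>lborel) \<partial>lborel)"
    by (rule lborel_pair.Fubini') measurable
  also have "\<dots> = (\<integral>\<^sup>+s. ennreal (gamma_density (\<theta> + \<kappa>) s) * (\<integral>\<^sup>+b. ennreal (beta_kernel \<theta> \<kappa> b) * h (s * b) (s * (1 - b)) \<partial>lborel) \<partial>lborel)"
  proof (rule nn_integral_cong)
    fix s :: real
    show "(\<integral>\<^sup>+u. ennreal (gamma_density \<theta> u) * (ennreal (gamma_density \<kappa> (s - u)) * h u (s - u)) \<partial>lborel) =
      ennreal (gamma_density (\<theta> + \<kappa>) s) * (\<integral>\<^sup>+b. ennreal (beta_kernel \<theta> \<kappa> b) * h (s * b) (s * (1 - b)) \<partial>lborel)"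
    proof (cases "s > 0")
      case True
      have "(\<integral>\<^sup>+u. ennreal (gamma_density \<theta> u) * (ennreal (gamma_density \<kappa> (s - u)) * h u (s - u)) \<partial>lborel)
        = (\<integral>\<^sup>+b. ennreal s * (ennreal (gamma_density \<theta> (s * b)) * (ennreal (gamma_density \<kappa> (s - s * b)) * h (s * b) (s - s * b))) \<partial>lborel)"
        using True by (subst nn_integral_lborel_scale) auto
      also have "\<dots> = (\<integral>\<^sup>+b. ennreal (gamma_density (\<theta> + \<kappa>) s) * (ennreal (beta_kernel \<theta> \<kappa> b) * h (s * b) (s * (1 - b))) \<partial>lborel)"
      proof (rule nn_integral_cong)
        fix b
        have "ennreal s * (ennreal (gamma_density \<theta> (s * b)) * ennreal (gamma_density \<kappa> (s - s * b)))
          = ennreal (gamma_density (\<theta> + \<kappa>) s) * ennreal (beta_kernel \<theta> \<kappa> b)"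
          using gamma_density_polar[OF pos True, of b] True pos
          by (simp add: ennreal_mult'[symmetric] gamma_density_nonneg)
        then show "ennreal s * (ennreal (gamma_density \<theta> (s * b)) * (ennreal (gamma_density \<kappa> (s - s * b)) * h (s * b) (s - s * b)))
          = ennreal (gamma_density (\<theta> + \<kappa>) s) * (ennreal (beta_kernel \<theta> \<kappa> b) * h (s * b) (s * (1 - b)))"
          by (simp add: mult.assoc[symmetric] right_diff_distrib)
      qed
      finally show ?thesis by (simp add: nn_integral_cmult)
    next
      case False
      \<comment> \<open>For s <= 0 the numbers u and s - u cannot both be positive.\<close>
      then have "gamma_density \<theta> u = 0 \<or> gamma_density \<kappa> (s - u) = 0" for u
        by (auto simp: gamma_density_def)
      then have "ennreal (gamma_density \<theta> u) * (ennreal (gamma_density \<kappa> (s - u)) * h u (s - u)) = 0" for u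
        by (metis ennreal_0 mult_zero_left mult_zero_right)
      then show ?thesis using False by (simp only: nn_integral_const) (simp add: gamma_density_def)
    qed
  qed
  finally show ?thesis by (simp add: nn_integral_gamma_dist)
qed

text \<open>In polar coordinates (u, v) = (s b, s (1 - b)) the map sends (s, b, y) to (y, b, s). It
  only exchanges s and y, which are independent with the same law Gamma(\<theta> +
  \<kappa>).\<close>

lemma gamma_triple_invariant:
  assumes f[measurable]: "(\<lambda>(u, v, y). f u v y) \<in> borel_measurable (borel \<Otimes>\<^sub>M borel \<Otimes>\<^sub>M borel)"
    and pos: "0 < \<theta>" "0 < \<kappa>"
  shows "(\<integral>\<^sup>+u. \<integral>\<^sup>+v. \<integral>\<^sup>+y. f (y * u / (u + v)) (y * v / (u + v)) (u + v)
           \<partial>gamma_dist (\<theta> + \<kappa>) \<partial>gamma_dist \<kappa> \<partial>gamma_dist \<theta>) =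
         (\<integral>\<^sup>+u. \<integral>\<^sup>+v. \<integral>\<^sup>+y. f u v y \<partial>gamma_dist (\<theta> + \<kappa>) \<partial>gamma_dist \<kappa> \<partial>gamma_dist \<theta>)"
proof -
  let ?G = "gamma_dist (\<theta> + \<kappa>)" and ?B = "\<lambda>b. ennreal (beta_kernel \<theta> \<kappa> b)"
  interpret G: prob_space ?G using pos by (intro prob_space_gamma_dist) simp
  interpret GG: pair_sigma_finite ?G ?G ..
  interpret LG: pair_sigma_finite lborel ?G ..
  have m[measurable]: "(\<lambda>x. f (a x) (b x) (c x)) \<in> borel_measurable N"
    if [measurable]: "a \<in> borel_measurable N" "b \<in> borel_measurable N" "c \<in> borel_measurable N"
    for a b c and N :: "'z measure"
    using measurable_compose[OF measurable_Pair[OF that(1) measurable_Pair[OF that(2,3)]] f] by simp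
  have "(\<integral>\<^sup>+u. \<integral>\<^sup>+v. \<integral>\<^sup>+y. f (y * u / (u + v)) (y * v / (u + v)) (u + v) \<partial>?G \<partial>gamma_dist \<kappa> \<partial>gamma_dist \<theta>)
     = (\<integral>\<^sup>+s. \<integral>\<^sup>+b. ?B b * (\<integral>\<^sup>+y. f (y * (s * b) / (s * b + s * (1 - b))) (y * (s * (1 - b)) / (s * b + s * (1 - b))) (s * b + s * (1 - b)) \<partial>?G) \<partial>lborel \<partial>?G)"
    using pos by (subst gamma_polar) simp_all
  also have "\<dots> = (\<integral>\<^sup>+s. \<integral>\<^sup>+b. ?B b * (\<integral>\<^sup>+y. f (y * b) (y * (1 - b)) s \<partial>?G) \<partial>lborel \<partial>?G)"
  proof (rule nn_integral_cong_AE)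
    show "AE s in ?G. (\<integral>\<^sup>+b. ?B b * (\<integral>\<^sup>+y. f (y * (s * b) / (s * b + s * (1 - b))) (y * (s * (1 - b)) / (s * b + s * (1 - b))) (s * b + s * (1 - b)) \<partial>?G) \<partial>lborel)
       = (\<integral>\<^sup>+b. ?B b * (\<integral>\<^sup>+y. f (y * b) (y * (1 - b)) s \<partial>?G) \<partial>lborel)"
      using AE_gamma_dist_pos[OF add_pos_pos[OF pos]]
    proof eventually_elim
      case (elim s)
      then have "s * b + s * (1 - b) = s" for b by (simp add: algebra_simps)
      with elim show ?case by simp
    qed
  qed
  also have "\<dots> = (\<integral>\<^sup>+s. \<integral>\<^sup>+b. \<integral>\<^sup>+y. ?B b * f (y * b) (y * (1 - b)) s \<partial>?G \<partial>lborel \<partial>?G)"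
    by (simp add: nn_integral_cmult)
  also have "\<dots> = (\<integral>\<^sup>+s. \<integral>\<^sup>+y. \<integral>\<^sup>+b. ?B b * f (y * b) (y * (1 - b)) s \<partial>lborel \<partial>?G \<partial>?G)"
    by (rule nn_integral_cong, rule LG.Fubini'[symmetric]) measurable
  \<comment> \<open>The exchange itself: since s and y have the same law \<open>?G\<close>, y can
    take over the role of the radius, and \<open>gamma_polar\<close> is then read backwards.\<close>
  also have "\<dots> = (\<integral>\<^sup>+y. \<integral>\<^sup>+s. \<integral>\<^sup>+b. ?B b * f (y * b) (y * (1 - b)) s \<partial>lborel \<partial>?G \<partial>?G)"
    by (intro GG.Fubini') measurable
  also have "\<dots> = (\<integral>\<^sup>+y. \<integral>\<^sup>+b. \<integral>\<^sup>+s. ?B b * f (y * b) (y * (1 - b)) s \<partial>?G \<partial>lborel \<partial>?G)"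
    by (rule nn_integral_cong, rule LG.Fubini') measurable
  also have "\<dots> = (\<integral>\<^sup>+y. \<integral>\<^sup>+b. ?B b * (\<integral>\<^sup>+s. f (y * b) (y * (1 - b)) s \<partial>?G) \<partial>lborel \<partial>?G)"
    by (simp add: nn_integral_cmult)
  also have "\<dots> = (\<integral>\<^sup>+u. \<integral>\<^sup>+v. \<integral>\<^sup>+s. f u v s \<partial>?G \<partial>gamma_dist \<kappa> \<partial>gamma_dist \<theta>)"
    using pos by (subst gamma_polar) simp_all
  finally show ?thesis .
qed

section \<open>Lattice path sums and the Burke property\<close>

lemma Z_square_empty: "\<not> (fst v \<le> fst u \<and> snd v \<le> snd u) \<Longrightarrow> Z_square w v u = 0"
  by (simp add: lattice_paths_empty path_sum_def)

lemma Z_square_refl [simp]: "Z_square w v v = w v"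
  by (subst lattice_paths_rec) (simp add: path_sum_def)

lemma Z_square_horizontal:
  "i \<le> k \<Longrightarrow> Z_square w (i, j) (k, j) = (\<Prod>l=i..k. w (l, j))"
proof (induction "k - i" arbitrary: i)
  case (Suc d)
  then have "Z_square w (i, j) (k, j) = w (i, j) * Z_square w (Suc i, j) (k, j)"
    by (subst Z_square_rec) (auto simp: Z_square_empty)
  also have "Z_square w (Suc i, j) (k, j) = (\<Prod>l=Suc i..k. w (l, j))"
    using Suc by (intro Suc) auto
  also have "w (i, j) * \<dots> = (\<Prod>l=i..k. w (l, j))"
    using Suc.prems by (simp add: prod.atLeast_Suc_atMost)
  finally show ?case .
qed simp

lemma Z_square_swap:
  "Z_square (\<lambda>p. w (snd p, fst p)) (a, b) (i, j) = Z_square w (b, a) (j, i)"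
proof (induction "(i + j + 1) - (a + b)" arbitrary: a b rule: less_induct)
  case less
  consider "(a, b) = (i, j)" | "\<not> (a \<le> i \<and> b \<le> j)" | "(a, b) \<noteq> (i, j)" "a \<le> i" "b \<le> j"
    by blast
  then show ?case
  proof cases
    case 3
    then show ?thesis
      using less.hyps[of "Suc a" b] less.hyps[of a "Suc b"]
      by (subst (1 2) Z_square_rec) (auto simp: add.commute)
  qed (auto simp: Z_square_empty)
qed

lemma Z_square_vertical:
  "j \<le> k \<Longrightarrow> Z_square w (i, j) (i, k) = (\<Prod>l=j..k. w (i, l))"
  using Z_square_horizontal[of j k "\<lambda>p. w (snd p, fst p)" i] by (simp add: Z_square_swap[of w])

text \<open>The decomposition by the last step instead of the first. It is what relates the
  partition functions at the four corners of a cell, and so drives the flips below.\<close>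

lemma Z_square_rec_end:
  assumes "v \<noteq> (Suc a, Suc b)"
  shows "Z_square w v (Suc a, Suc b) =
    w (Suc a, Suc b) * (Z_square w v (a, Suc b) + Z_square w v (Suc a, b))"
  using assms
proof (induction "(a + b + 3) - (fst v + snd v)" arbitrary: v rule: less_induct)
  case less
  obtain i j where v: "v = (i, j)" by (cases v)
  \<comment> \<open>A start at one of the two predecessors of the end is treated directly, because
    the recursion by the first step fails for a trivial path.\<close>
  consider "\<not> (i \<le> Suc a \<and> j \<le> Suc b)" | "i = a" "j = Suc b" | "i = Suc a" "j = b"
    | "i \<le> Suc a" "j \<le> Suc b" "v \<noteq> (a, Suc b)" "v \<noteq> (Suc a, b)"
    using v by auto
  then show ?case
  proof cases
    case 1
    then show ?thesis using v by (auto simp: Z_square_empty)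
  next
    case 2
    then show ?thesis using v by (subst Z_square_rec) (auto simp: Z_square_empty)
  next
    case 3
    then show ?thesis using v by (subst Z_square_rec) (auto simp: Z_square_empty)
  next
    case 4
    have IH: "Z_square w v' (Suc a, Suc b) =
        w (Suc a, Suc b) * (Z_square w v' (a, Suc b) + Z_square w v' (Suc a, b))"
      if "v' = (Suc i, j) \<or> v' = (i, Suc j)" for v'
      using that 4 less.prems v by (intro less.hyps) auto
    have "Z_square w v (Suc a, Suc b) =
        w v * (Z_square w (Suc i, j) (Suc a, Suc b) + Z_square w (i, Suc j) (Suc a, Suc b))"
      using less.prems v by (subst Z_square_rec) auto
    also have "\<dots> = w (Suc a, Suc b) *
       (w v * (Z_square w (Suc i, j) (a, Suc b) + Z_square w (i, Suc j) (a, Suc b)) +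
        w v * (Z_square w (Suc i, j) (Suc a, b) + Z_square w (i, Suc j) (Suc a, b)))"
      by (simp add: IH algebra_simps)
    also have "w v * (Z_square w (Suc i, j) (a, Suc b) + Z_square w (i, Suc j) (a, Suc b)) = Z_square w v (a, Suc b)"
      using 4 v by (subst Z_square_rec[of v]) auto
    also have "w v * (Z_square w (Suc i, j) (Suc a, b) + Z_square w (i, Suc j) (Suc a, b)) = Z_square w v (Suc a, b)"
      using 4 v by (subst Z_square_rec[of v]) auto
    finally show ?thesis .
  qed
qed

lemma lattice_paths_bounds:
  assumes "xs \<in> lattice_paths v u" "x \<in> set xs"
  shows "fst v \<le> fst x \<and> fst x \<le> fst u \<and> snd v \<le> snd x \<and> snd x \<le> snd u"
  using assms
proof (induction xs arbitrary: v)
  case (Cons a xs)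
  note IH = Cons.IH
  have av: "a = v" and s: "successively lattice_step (a # xs)" and l: "last (a # xs) = u"
    using Cons.prems by (auto simp: lattice_paths_def)
  have vu: "fst v \<le> fst u \<and> snd v \<le> snd u"
    using lattice_paths_empty[of v u] Cons.prems by auto
  show ?case
  proof (cases xs)
    case Nil
    then show ?thesis using Cons.prems av l by auto
  next
    case (Cons b ys)
    then have "xs \<in> lattice_paths b u" and ab: "lattice_step a b"
      using s l by (auto simp: lattice_paths_def)
    then have "x \<in> set xs \<Longrightarrow> fst b \<le> fst x \<and> fst x \<le> fst u \<and> snd b \<le> snd x \<and> snd x \<le> snd u"
      using IH[of b] by simp
    then show ?thesis using ab av vu Cons.prems by (auto simp: lattice_step_def)
  qed
qed simp

definition site_box :: "site \<Rightarrow> site \<Rightarrow> site set" where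
  "site_box v u = {fst v..fst u} \<times> {snd v..snd u}"

lemma finite_site_box [simp]: "finite (site_box v u)"
  by (simp add: site_box_def)

lemma Z_square_cong:
  assumes "\<And>x. x \<in> site_box v u \<Longrightarrow> w x = w' x"
  shows "Z_square w v u = Z_square w' v u"
  unfolding path_sum_def
proof (intro sum.cong refl arg_cong[where f=prod_list] map_cong)
  fix xs x assume "xs \<in> lattice_paths v u" "x \<in> set xs"
  then show "w x = w' x"
    using lattice_paths_bounds by (intro assms) (fastforce simp: site_box_def mem_Times_iff)
qed

lemma Z_square_nonneg:
  assumes "\<And>x. x \<in> site_box v u \<Longrightarrow> w x \<ge> 0"
  shows "Z_square w v u \<ge> 0"
proof -
  \<comment> \<open>Only weights in the box enter, so all weights may be made nonnegative without
    changing the sum.\<close>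
  have "Z_square w v u = Z_square (\<lambda>x. \<bar>w x\<bar>) v u"
    using assms by (intro Z_square_cong) auto
  moreover have "\<dots> \<ge> 0"
    unfolding path_sum_def by (intro sum_nonneg prod_list_nonneg) auto
  ultimately show ?thesis by simp
qed

lemma Z_square_pos:
  assumes "fst v \<le> fst u" "snd v \<le> snd u" "\<And>x. x \<in> site_box v u \<Longrightarrow> w x > 0"
  shows "Z_square w v u > 0"
  using assms
proof (induction "(fst u + snd u) - (fst v + snd v)" arbitrary: v rule: less_induct)
  case less
  show ?case
  proof (cases "v = u")
    case True
    then show ?thesis using less.prems by (simp add: site_box_def mem_Times_iff)
  next
    case False
    let ?a = "(fst v + 1, snd v)" and ?b = "(fst v, snd v + 1)"
    have wv: "w v > 0" using less.prems by (auto simp: site_box_def mem_Times_iff)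
    have nn: "Z_square w ?a u \<ge> 0" "Z_square w ?b u \<ge> 0"
      by (rule Z_square_nonneg, rule less_imp_le, rule less.prems(3), simp add: site_box_def mem_Times_iff)+
    have "Z_square w ?a u > 0 \<or> Z_square w ?b u > 0"
    proof (cases "fst v < fst u")
      case True
      then have "Z_square w ?a u > 0"
        using less.prems by (intro less.hyps) (auto simp: site_box_def mem_Times_iff)
      then show ?thesis ..
    next
      case F: False
      then have "snd v < snd u" using False less.prems by (auto simp: prod_eq_iff)
      then have "Z_square w ?b u > 0"
        using less.prems by (intro less.hyps) (auto simp: site_box_def mem_Times_iff)
      then show ?thesis ..
    qed
    then show ?thesis using nn wv by (subst Z_square_rec[OF False]) (auto intro: mult_pos_pos)
  qed
qed

lemma Z_square_measurable:
  assumes "\<And>x. x \<in> site_box v u \<Longrightarrow> (\<lambda>\<omega>. w \<omega> x) \<in> borel_measurable N"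
  shows "(\<lambda>\<omega>. Z_square (w \<omega>) v u) \<in> borel_measurable N"
proof -
  have "(\<lambda>\<omega>. prod_list (map (w \<omega>) xs)) \<in> borel_measurable N" if "set xs \<subseteq> site_box v u" for xs
    using that by (induction xs) (auto intro!: borel_measurable_times assms)
  moreover have "set xs \<subseteq> site_box v u" if "xs \<in> lattice_paths v u" for xs
    using lattice_paths_bounds[OF that] by (auto simp: site_box_def)
  ultimately show ?thesis
    unfolding path_sum_def by (intro borel_measurable_sum) auto
qed

section \<open>The product law of the reciprocal weights and its invariance under flips\<close>

definition site_shape :: "real \<Rightarrow> real \<Rightarrow> site \<Rightarrow> real" where
  "site_shape \<mu> \<theta> x = (if snd x = 0 then \<theta> else if fst x = 0 then \<mu> - \<theta> else \<mu>)"

abbreviation site_dist :: "real \<Rightarrow> real \<Rightarrow> site \<Rightarrow> real measure" where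
  "site_dist \<mu> \<theta> x \<equiv> gamma_dist (site_shape \<mu> \<theta> x)"

text \<open>The three coordinates are reciprocal weights. After the cells of a rectangle have been processed,
  the axis coordinates hold the ratios of neighbouring partition functions along its far sides; the
  coordinate of the cell itself receives \<open>u + v\<close>, which makes the map preserve the full product law.\<close>

definition corner_flip :: "nat \<Rightarrow> nat \<Rightarrow> (site \<Rightarrow> real) \<Rightarrow> site \<Rightarrow> real" where
  "corner_flip i j x = x
     ((i, 0) := x (i, j) * x (i, 0) / (x (i, 0) + x (0, j)),
      (0, j) := x (i, j) * x (0, j) / (x (i, 0) + x (0, j)),
      (i, j) := x (i, 0) + x (0, j))"

context
  fixes \<mu> \<theta> :: real
  assumes pos: "0 < \<theta>" "\<theta> < \<mu>"
begin

lemma prob_space_site_dist: "prob_space (site_dist \<mu> \<theta> x)"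
  using pos by (intro prob_space_gamma_dist) (auto simp: site_shape_def)

lemma product_sigma_finite_site_dist: "product_sigma_finite (site_dist \<mu> \<theta>)"
  unfolding product_sigma_finite_def
  using prob_space_site_dist prob_space_imp_sigma_finite by blast

lemma corner_flip_measurable:
  assumes "(i, 0) \<in> I" "(0, j) \<in> I" "(i, j) \<in> I"
  shows "corner_flip i j \<in> Pi\<^sub>M I (site_dist \<mu> \<theta>) \<rightarrow>\<^sub>M Pi\<^sub>M I (site_dist \<mu> \<theta>)"
proof -
  have [measurable]: "(\<lambda>x. x a) \<in> borel_measurable (Pi\<^sub>M I (site_dist \<mu> \<theta>))" if "a \<in> I" for a
    using measurable_component_singleton[OF that, of "site_dist \<mu> \<theta>"]
    by (simp cong: measurable_cong_sets)
  note [measurable] = assms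
  show ?thesis
    unfolding corner_flip_def[abs_def] using assms
    by (intro measurable_fun_upd[where J=I]) (auto cong: measurable_cong_sets)
qed

text \<open>Only three coordinates change, so they are split off the product measure and integrated
  innermost. There the claim is \<open>gamma_triple_invariant\<close> with
  \<open>\<kappa> = \<mu> - \<theta>\<close>, which is where the shapes of the boundary and of the
  bulk have to add up.\<close>

lemma nn_integral_corner_flip:
  assumes "finite I" "(i, 0) \<in> I" "(0, j) \<in> I" "(i, j) \<in> I" "i > 0" "j > 0"
    and f: "f \<in> borel_measurable (Pi\<^sub>M I (site_dist \<mu> \<theta>))"
  shows "(\<integral>\<^sup>+x. f (corner_flip i j x) \<partial>Pi\<^sub>M I (site_dist \<mu> \<theta>)) = (\<integral>\<^sup>+x. f x \<partial>Pi\<^sub>M I (site_dist \<mu> \<theta>))"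
proof -
  interpret product_sigma_finite "site_dist \<mu> \<theta>" by (rule product_sigma_finite_site_dist)
  let ?M = "\<lambda>I. Pi\<^sub>M I (site_dist \<mu> \<theta>)"
  define J where "J = I - {(i, 0), (0, j), (i, j)}"
  have I: "I = insert (i, j) (insert (0, j) (insert (i, 0) J))" and "finite J"
    using assms by (auto simp: J_def)
  have three: "(\<integral>\<^sup>+x. g x \<partial>?M I) = (\<integral>\<^sup>+x. \<integral>\<^sup>+u. \<integral>\<^sup>+v. \<integral>\<^sup>+y. g (x((i, 0) := u, (0, j) := v, (i, j) := y))
       \<partial>gamma_dist \<mu> \<partial>gamma_dist (\<mu> - \<theta>) \<partial>gamma_dist \<theta> \<partial>?M J)"
    if g: "g \<in> borel_measurable (?M I)" for g
  proof -
    have shp: "site_dist \<mu> \<theta> (i, j) = gamma_dist \<mu>" "site_dist \<mu> \<theta> (0, j) = gamma_dist (\<mu> - \<theta>)"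
      "site_dist \<mu> \<theta> (i, 0) = gamma_dist \<theta>"
      using assms by (auto simp: site_shape_def)
    interpret y: sigma_finite_measure "gamma_dist \<mu>" using sigma_finite_measures[of "(i, j)"] shp by simp
    interpret v: sigma_finite_measure "gamma_dist (\<mu> - \<theta>)" using sigma_finite_measures[of "(0, j)"] shp by simp
    have g': "g \<in> borel_measurable (?M (insert (i, j) (insert (0, j) (insert (i, 0) J))))"
      using g I by simp
    have m1: "(\<lambda>x. \<integral>\<^sup>+y. g (x((i, j) := y)) \<partial>gamma_dist \<mu>) \<in> borel_measurable (?M (insert (0, j) (insert (i, 0) J)))"
    proof (rule y.borel_measurable_nn_integral)
      have "(\<lambda>p. (fst p)((i, j) := snd p)) \<in> ?M (insert (0, j) (insert (i, 0) J)) \<Otimes>\<^sub>M gamma_dist \<mu>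
         \<rightarrow>\<^sub>M ?M (insert (i, j) (insert (0, j) (insert (i, 0) J)))"
        by (rule measurable_fun_upd[where J="insert (0, j) (insert (i, 0) J)"]) (auto simp: shp)
      from measurable_compose[OF this g'] show "(\<lambda>(x, y). g (x((i, j) := y))) \<in> borel_measurable (?M (insert (0, j) (insert (i, 0) J)) \<Otimes>\<^sub>M gamma_dist \<mu>)"
        by (simp add: case_prod_beta')
    qed
    have m2: "(\<lambda>x. \<integral>\<^sup>+v. \<integral>\<^sup>+y. g (x((0, j) := v, (i, j) := y)) \<partial>gamma_dist \<mu> \<partial>gamma_dist (\<mu> - \<theta>))
       \<in> borel_measurable (?M (insert (i, 0) J))"
    proof (rule v.borel_measurable_nn_integral)
      have "(\<lambda>p. (fst p)((0, j) := snd p)) \<in> ?M (insert (i, 0) J) \<Otimes>\<^sub>M gamma_dist (\<mu> - \<theta>)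
         \<rightarrow>\<^sub>M ?M (insert (0, j) (insert (i, 0) J))"
        by (rule measurable_fun_upd[where J="insert (i, 0) J"]) (auto simp: shp)
      from measurable_compose[OF this m1] show "(\<lambda>(x, v). \<integral>\<^sup>+y. g (x((0, j) := v, (i, j) := y)) \<partial>gamma_dist \<mu>) \<in> borel_measurable (?M (insert (i, 0) J) \<Otimes>\<^sub>M gamma_dist (\<mu> - \<theta>))"
        by (simp add: case_prod_beta')
    qed
    have "(\<integral>\<^sup>+x. g x \<partial>?M I) = (\<integral>\<^sup>+x. \<integral>\<^sup>+y. g (x((i, j) := y)) \<partial>gamma_dist \<mu> \<partial>?M (insert (0, j) (insert (i, 0) J)))"
      unfolding I using \<open>finite J\<close> assms g'
      by (subst product_nn_integral_insert) (auto simp: J_def shp)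
    also have "\<dots> = (\<integral>\<^sup>+x. \<integral>\<^sup>+v. \<integral>\<^sup>+y. g (x((0, j) := v, (i, j) := y)) \<partial>gamma_dist \<mu> \<partial>gamma_dist (\<mu> - \<theta>) \<partial>?M (insert (i, 0) J))"
      using \<open>finite J\<close> assms m1
      by (subst product_nn_integral_insert) (auto simp: J_def shp)
    also have "\<dots> = (\<integral>\<^sup>+x. \<integral>\<^sup>+u. \<integral>\<^sup>+v. \<integral>\<^sup>+y. g (x((i, 0) := u, (0, j) := v, (i, j) := y))
       \<partial>gamma_dist \<mu> \<partial>gamma_dist (\<mu> - \<theta>) \<partial>gamma_dist \<theta> \<partial>?M J)"
      using \<open>finite J\<close> assms m2
      by (subst product_nn_integral_insert) (auto simp: J_def shp)
    finally show ?thesis .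
  qed
  have flip: "corner_flip i j (x((i, 0) := u, (0, j) := v, (i, j) := y)) =
      x((i, 0) := y * u / (u + v), (0, j) := y * v / (u + v), (i, j) := u + v)" for x u v y
    using assms by (auto simp: corner_flip_def fun_eq_iff)
  have "(\<integral>\<^sup>+x. f (corner_flip i j x) \<partial>?M I) =
    (\<integral>\<^sup>+x. \<integral>\<^sup>+u. \<integral>\<^sup>+v. \<integral>\<^sup>+y. f (x((i, 0) := y * u / (u + v), (0, j) := y * v / (u + v), (i, j) := u + v))
       \<partial>gamma_dist \<mu> \<partial>gamma_dist (\<mu> - \<theta>) \<partial>gamma_dist \<theta> \<partial>?M J)"
    using measurable_compose[OF corner_flip_measurable f] assms by (subst three) (simp_all add: flip)
  also have "\<dots> = (\<integral>\<^sup>+x. \<integral>\<^sup>+u. \<integral>\<^sup>+v. \<integral>\<^sup>+y. f (x((i, 0) := u, (0, j) := v, (i, j) := y))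
       \<partial>gamma_dist \<mu> \<partial>gamma_dist (\<mu> - \<theta>) \<partial>gamma_dist \<theta> \<partial>?M J)"
  proof (rule nn_integral_cong)
    fix x assume x: "x \<in> space (?M J)"
    have "(\<lambda>p. x((i, 0) := fst p, (0, j) := fst (snd p), (i, j) := snd (snd p)))
       \<in> borel \<Otimes>\<^sub>M borel \<Otimes>\<^sub>M borel \<rightarrow>\<^sub>M ?M I"
      unfolding I using x
      by (intro measurable_fun_upd[where J="insert (0, j) (insert (i, 0) J)"]
          measurable_fun_upd[where J="insert (i, 0) J"] measurable_fun_upd[where J=J])
        (auto cong: measurable_cong_sets)
    from measurable_compose[OF this f]
    have "(\<lambda>(u, v, y). f (x((i, 0) := u, (0, j) := v, (i, j) := y)))
        \<in> borel_measurable (borel \<Otimes>\<^sub>M borel \<Otimes>\<^sub>M borel)"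
      by (simp add: case_prod_beta')
    from gamma_triple_invariant[OF this, of \<theta> "\<mu> - \<theta>"] pos
    show "(\<integral>\<^sup>+u. \<integral>\<^sup>+v. \<integral>\<^sup>+y. f (x((i, 0) := y * u / (u + v), (0, j) := y * v / (u + v), (i, j) := u + v))
       \<partial>gamma_dist \<mu> \<partial>gamma_dist (\<mu> - \<theta>) \<partial>gamma_dist \<theta>) =
      (\<integral>\<^sup>+u. \<integral>\<^sup>+v. \<integral>\<^sup>+y. f (x((i, 0) := u, (0, j) := v, (i, j) := y))
       \<partial>gamma_dist \<mu> \<partial>gamma_dist (\<mu> - \<theta>) \<partial>gamma_dist \<theta>)"
      by simp
  qed
  also have "\<dots> = (\<integral>\<^sup>+x. f x \<partial>?M I)"
    using f by (subst three) simp_all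
  finally show ?thesis .
qed

end

section \<open>Ratios of partition functions along the far side of a rectangle\<close>

primrec row_flip :: "nat \<Rightarrow> nat \<Rightarrow> (site \<Rightarrow> real) \<Rightarrow> site \<Rightarrow> real" where
  "row_flip j 0 x = x"
| "row_flip j (Suc i) x = corner_flip (Suc i) j (row_flip j i x)"

text \<open>Rows are processed from bottom to top and each row from left to right. Cell (i, j) then
  finds in coordinate (i, 0) the ratio left by the row below, and in (0, j) the ratio left by cell
  (i - 1, j).\<close>

primrec box_flip :: "nat \<Rightarrow> nat \<Rightarrow> (site \<Rightarrow> real) \<Rightarrow> site \<Rightarrow> real" where
  "box_flip m 0 x = x"
| "box_flip m (Suc j) x = row_flip (Suc j) m (box_flip m j x)"

definition inv_weight :: "(site \<Rightarrow> real) \<Rightarrow> site \<Rightarrow> real" where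
  "inv_weight x p = (if p = (0, 0) then 1 else inverse (x p))"

lemma eq_divide_of_eq_mult_inverse:
  fixes a x z :: real
  shows "z = a * inverse x \<Longrightarrow> z > 0 \<Longrightarrow> x = a / z"
  by (cases "x = 0") (auto simp: field_simps)

text \<open>Here a, b, c, Z stand for the partition functions at the lower left, upper left, lower
  right and upper right corner of a cell, and y is the reciprocal weight of the cell. The recursion
  for Z is exactly what makes a flip move the horizontal ratio a / c up to b / Z and the vertical
  ratio a / b right to c / Z.\<close>

lemma corner_flip_ratio:
  fixes Z y :: real
  assumes "a > 0" "b > 0" "c > 0" "y > 0" "Z = inverse y * (b + c)"
  shows "y * (a / c) / (a / c + a / b) = b / Z" "y * (a / b) / (a / c + a / b) = c / Z"
proof -
  have s: "a / c + a / b = a * (b + c) / (b * c)" using assms by (simp add: field_simps)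
  have bc: "b + c > 0" and Z: "Z = (b + c) / y" using assms by (auto simp: field_simps)
  show "y * (a / c) / (a / c + a / b) = b / Z" "y * (a / b) / (a / c + a / b) = c / Z"
    unfolding s Z using assms(1-4) bc by simp_all
qed

context
  fixes m n :: nat and x :: "site \<Rightarrow> real"
  assumes xpos: "\<And>p. p \<in> site_box (0, 0) (m, n) - {(0, 0)} \<Longrightarrow> x p > 0"
begin

abbreviation "Zx i j \<equiv> Z_square (inv_weight x) (0, 0) (i, j)"

lemma Zx_pos: "i \<le> m \<Longrightarrow> j \<le> n \<Longrightarrow> Zx i j > 0"
proof (rule Z_square_pos)
  fix p assume "i \<le> m" "j \<le> n" "p \<in> site_box (0, 0) (i, j)"
  then show "inv_weight x p > 0"
    using xpos[of p] by (cases "p = (0, 0)") (auto simp: site_box_def inv_weight_def)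
qed simp_all

text \<open>The conjunction is the invariant of the walk along row \<open>Suc j\<close>: columns up
  to i already show the ratios of the new row, later ones still those of row j, and coordinate
  \<open>(0, Suc j)\<close> carries the vertical ratio at column i. The sites still to be used are
  untouched.\<close>

lemma row_flip_ratio:
  assumes j: "Suc j \<le> n" and i: "i \<le> m"
    and X: "\<forall>k\<in>{1..m}. X (k, 0) = Zx (k - 1) j / Zx k j" "\<forall>k l. j < l \<and> l \<le> n \<and> k \<le> m \<longrightarrow> X (k, l) = x (k, l)"
  shows "(\<forall>k\<in>{1..i}. row_flip (Suc j) i X (k, 0) = Zx (k - 1) (Suc j) / Zx k (Suc j)) \<and>
    (\<forall>k\<in>{i<..m}. row_flip (Suc j) i X (k, 0) = Zx (k - 1) j / Zx k j) \<and>
    row_flip (Suc j) i X (0, Suc j) = Zx i j / Zx i (Suc j) \<and>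
    (\<forall>k l. Suc j < l \<and> l \<le> n \<and> k \<le> m \<longrightarrow> row_flip (Suc j) i X (k, l) = x (k, l)) \<and>
    (\<forall>k. i < k \<and> k \<le> m \<longrightarrow> row_flip (Suc j) i X (k, Suc j) = x (k, Suc j))"
  using i
proof (induction i)
  case 0
  have "Zx 0 (Suc j) = Zx 0 j * inverse (x (0, Suc j))"
    by (simp add: Z_square_vertical inv_weight_def)
  then have "x (0, Suc j) = Zx 0 j / Zx 0 (Suc j)"
    using Zx_pos[of 0 "Suc j"] j by (intro eq_divide_of_eq_mult_inverse) auto
  then show ?case using X j by auto
next
  case (Suc i)
  let ?X = "row_flip (Suc j) i X" and ?X' = "row_flip (Suc j) (Suc i) X"
  note IH = Suc.IH[OF Suc_leD[OF Suc.prems]]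
  have i: "Suc i \<le> m" using Suc by simp
  have u: "?X (Suc i, 0) = Zx i j / Zx (Suc i) j"
    and v: "?X (0, Suc j) = Zx i j / Zx i (Suc j)"
    and y: "?X (Suc i, Suc j) = x (Suc i, Suc j)"
    using IH i by auto
  have xp: "x (Suc i, Suc j) > 0" using i j by (intro xpos) (auto simp: site_box_def)
  have Z: "Zx (Suc i) (Suc j) = inverse (x (Suc i, Suc j)) * (Zx i (Suc j) + Zx (Suc i) j)"
    by (subst Z_square_rec_end) (simp_all add: inv_weight_def)
  have p: "Zx i j > 0" "Zx i (Suc j) > 0" "Zx (Suc i) j > 0"
    using i j by (auto intro: Zx_pos)
  note r = corner_flip_ratio[OF p xp Z]
  have u': "?X' (Suc i, 0) = Zx i (Suc j) / Zx (Suc i) (Suc j)"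
    using r(1) by (simp add: corner_flip_def u v y)
  have v': "?X' (0, Suc j) = Zx (Suc i) j / Zx (Suc i) (Suc j)"
    using r(2) by (simp add: corner_flip_def u v y)
  have o: "?X' p = ?X p" if "p \<noteq> (Suc i, 0)" "p \<noteq> (0, Suc j)" "p \<noteq> (Suc i, Suc j)" for p
    using that by (simp add: corner_flip_def)
  show ?case
  proof (intro conjI)
    show "\<forall>k\<in>{1..Suc i}. ?X' (k, 0) = Zx (k - 1) (Suc j) / Zx k (Suc j)"
    proof
      fix k assume "k \<in> {1..Suc i}"
      then show "?X' (k, 0) = Zx (k - 1) (Suc j) / Zx k (Suc j)"
        using u' IH o[of "(k, 0)"] by (cases "k = Suc i") auto
    qed
  qed (use v' IH o in auto)
qed

lemma box_flip_ratio:
  assumes "j \<le> n"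
  shows "(\<forall>k\<in>{1..m}. box_flip m j x (k, 0) = Zx (k - 1) j / Zx k j) \<and>
    (\<forall>k l. j < l \<and> l \<le> n \<and> k \<le> m \<longrightarrow> box_flip m j x (k, l) = x (k, l))"
  using assms
proof (induction j)
  case 0
  have "x (k, 0) = Zx (k - 1) 0 / Zx k 0" if k: "k \<in> {1..m}" for k
  proof -
    obtain k' where k': "k = Suc k'" using k by (cases k) auto
    have "Zx k 0 = Zx k' 0 * inverse (x (k, 0))"
      by (simp add: k' Z_square_horizontal inv_weight_def)
    then show ?thesis
      using k k' Zx_pos[of k 0] by (intro eq_divide_of_eq_mult_inverse) auto
  qed
  then show ?case by simp
next
  case (Suc j)
  then have IH: "\<forall>k\<in>{1..m}. box_flip m j x (k, 0) = Zx (k - 1) j / Zx k j"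
    "\<forall>k l. j < l \<and> l \<le> n \<and> k \<le> m \<longrightarrow> box_flip m j x (k, l) = x (k, l)" by auto
  show ?case using row_flip_ratio[OF Suc.prems order_refl IH] by simp
qed

text \<open>After all flips the axis coordinates are the ratios along the top side, so their product
  telescopes.\<close>

lemma box_flip_prod: "(\<Prod>k=1..m. box_flip m n x (k, 0)) = Zx 0 n / Zx m n"
proof -
  have "(\<Prod>k=1..m. box_flip m n x (k, 0)) = (\<Prod>k=1..m. Zx (k - 1) n / Zx k n)"
    using box_flip_ratio[of n] by (intro prod.cong) auto
  also have "\<dots> = Zx 0 n / Zx m n"
  proof -
    have "i \<le> m \<Longrightarrow> (\<Prod>k=1..i. Zx (k - 1) n / Zx k n) = Zx 0 n / Zx i n" for i
    proof (induction i)
      case 0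
      then show ?case using Zx_pos[of 0 n] by simp
    next
      case (Suc i)
      then show ?case using Zx_pos[of i n] by simp
    qed
    then show ?thesis by blast
  qed
  finally show ?thesis .
qed

end

text \<open>Measurability is part of the conclusion because the induction step applies the
  hypothesis to f composed with one flip.\<close>

lemma nn_integral_row_flip:
  assumes "0 < \<theta>" "\<theta> < \<mu>" "finite I" "i \<le> m" "j > 0"
    and I: "{0..m} \<times> {0, j} - {(0, 0)} \<subseteq> I"
    and f: "f \<in> borel_measurable (Pi\<^sub>M I (site_dist \<mu> \<theta>))"
  shows "(\<lambda>x. f (row_flip j i x)) \<in> borel_measurable (Pi\<^sub>M I (site_dist \<mu> \<theta>)) \<and>
    (\<integral>\<^sup>+x. f (row_flip j i x) \<partial>Pi\<^sub>M I (site_dist \<mu> \<theta>)) = (\<integral>\<^sup>+x. f x \<partial>Pi\<^sub>M I (site_dist \<mu> \<theta>))"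
  using assms(4) f
proof (induction i arbitrary: f)
  case (Suc i)
  have mem: "(Suc i, 0) \<in> I" "(0, j) \<in> I" "(Suc i, j) \<in> I"
    using I Suc.prems assms(5) by auto
  have m: "(\<lambda>x. f (corner_flip (Suc i) j x)) \<in> borel_measurable (Pi\<^sub>M I (site_dist \<mu> \<theta>))"
    by (rule measurable_compose[OF corner_flip_measurable[OF assms(1,2) mem] Suc.prems(2)])
  show ?case
    using Suc.IH[OF _ m] Suc.prems
      nn_integral_corner_flip[OF assms(1,2,3) mem _ assms(5) Suc.prems(2)] by simp
qed simp

lemma nn_integral_box_flip:
  assumes "0 < \<theta>" "\<theta> < \<mu>" "finite I" "j \<le> n"
    and I: "{0..m} \<times> {0..n} - {(0, 0)} \<subseteq> I"
    and f: "f \<in> borel_measurable (Pi\<^sub>M I (site_dist \<mu> \<theta>))"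
  shows "(\<lambda>x. f (box_flip m j x)) \<in> borel_measurable (Pi\<^sub>M I (site_dist \<mu> \<theta>)) \<and>
    (\<integral>\<^sup>+x. f (box_flip m j x) \<partial>Pi\<^sub>M I (site_dist \<mu> \<theta>)) = (\<integral>\<^sup>+x. f x \<partial>Pi\<^sub>M I (site_dist \<mu> \<theta>))"
  using assms(4) f
proof (induction j arbitrary: f)
  case (Suc j)
  have "{0..m} \<times> {0, Suc j} - {(0, 0)} \<subseteq> {0..m} \<times> {0..n} - {(0, 0)}"
    using Suc.prems by auto
  then have sub: "{0..m} \<times> {0, Suc j} - {(0, 0)} \<subseteq> I" using I by (rule order_trans)
  note r = nn_integral_row_flip[OF assms(1,2,3) order_refl _ sub Suc.prems(2)]
  show ?case using Suc.IH[of "\<lambda>x. f (row_flip (Suc j) m x)"] Suc.prems r by simp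
qed simp

text \<open>The left-hand ratio is, point by point, the product of the flipped axis coordinates, and
  flips preserve the law; hence it is distributed like the product of the unflipped ones. The ratio
  is upside down because the coordinates are reciprocal weights.\<close>

lemma burke_ratio:
  fixes m n :: nat
  assumes pos: "0 < \<theta>" "\<theta> < \<mu>"
    and f[measurable]: "f \<in> borel_measurable borel"
  defines "I \<equiv> site_box (0, 0) (m, n) - {(0, 0)}"
  shows "(\<integral>\<^sup>+x. f (Z_square (inv_weight x) (0, 0) (0, n) / Z_square (inv_weight x) (0, 0) (m, n))
      \<partial>Pi\<^sub>M I (site_dist \<mu> \<theta>)) = (\<integral>\<^sup>+x. f (\<Prod>k=1..m. x (k, 0)) \<partial>Pi\<^sub>M I (site_dist \<mu> \<theta>))"
proof -
  let ?M = "Pi\<^sub>M I (site_dist \<mu> \<theta>)"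
  have fin: "finite I" by (simp add: I_def)
  have "AE x in ?M. \<forall>p\<in>I. x p > 0"
  proof (rule AE_finite_allI[OF fin])
    fix p assume p: "p \<in> I"
    show "AE x in ?M. x p > 0"
      using p pos prob_space_site_dist[OF pos] AE_gamma_dist_pos[of "site_shape \<mu> \<theta> p"]
      by (intro AE_PiM_component[where P="\<lambda>x. 0 < x"]) (auto simp: site_shape_def)
  qed
  then have "(\<integral>\<^sup>+x. f (Z_square (inv_weight x) (0, 0) (0, n) / Z_square (inv_weight x) (0, 0) (m, n)) \<partial>?M)
    = (\<integral>\<^sup>+x. f (\<Prod>k=1..m. box_flip m n x (k, 0)) \<partial>?M)"
  proof (intro nn_integral_cong_AE, eventually_elim)
    case (elim x)
    show ?case by (subst box_flip_prod) (use elim in \<open>auto simp: I_def\<close>)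
  qed
  also have "\<dots> = (\<integral>\<^sup>+x. f (\<Prod>k=1..m. x (k, 0)) \<partial>?M)"
  proof -
    have [measurable]: "(\<lambda>x. x a) \<in> borel_measurable ?M" if "a \<in> I" for a
      using measurable_component_singleton[OF that, of "site_dist \<mu> \<theta>"]
      by (simp cong: measurable_cong_sets)
    have "(k, 0) \<in> I" if "k \<in> {1..m}" for k using that by (auto simp: I_def site_box_def)
    then have "(\<lambda>x. f (\<Prod>k=1..m. x (k, 0))) \<in> borel_measurable ?M"
      by (intro measurable_compose[OF borel_measurable_prod f]) measurable
    then show ?thesis
      using nn_integral_box_flip[OF pos fin order_refl, of m n "\<lambda>x. f (\<Prod>k=1..m. x (k, 0))"]
      by (simp add: I_def site_box_def)
  qed
  finally show ?thesis .
qed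

section \<open>The stationary model and the law of the bulk\<close>

lemma Z_square_shift:
  "Z_square w (a + i0, b + j0) (a + i, b + j) = Z_square (\<lambda>p. w (a + fst p, b + snd p)) (i0, j0) (i, j)"
proof (induction "(i + j + 1) - (i0 + j0)" arbitrary: i0 j0 rule: less_induct)
  case less
  consider "(i0, j0) = (i, j)" | "\<not> (i0 \<le> i \<and> j0 \<le> j)" | "(i0, j0) \<noteq> (i, j)" "i0 \<le> i" "j0 \<le> j"
    by blast
  then show ?case
  proof cases
    case 3
    have "Z_square w (a + Suc i0, b + j0) (a + i, b + j) =
        Z_square (\<lambda>p. w (a + fst p, b + snd p)) (Suc i0, j0) (i, j)"
      "Z_square w (a + i0, b + Suc j0) (a + i, b + j) =
        Z_square (\<lambda>p. w (a + fst p, b + snd p)) (i0, Suc j0) (i, j)"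
      using 3 less.hyps[of "Suc i0" j0] less.hyps[of i0 "Suc j0"] by auto
    then show ?thesis
      using 3(1) by (subst (1 2) Z_square_rec) auto
  qed (auto simp: Z_square_empty)
qed

text \<open>No \<theta> occurs here, which is what makes a change of parameter possible. The
  arguments i and j are displacements: the rectangle has i + 1 columns and j + 1 rows.\<close>

definition bulk_law :: "real \<Rightarrow> nat \<Rightarrow> nat \<Rightarrow> real measure" where
  "bulk_law \<mu> i j = distr (Pi\<^sub>M (site_box (0, 0) (i, j)) (\<lambda>_. gamma_dist \<mu>)) borel
     (\<lambda>x. Z_square (\<lambda>p. inverse (x p)) (0, 0) (i, j))"

locale log_gamma_model = prob_space P for P :: "'a measure" +
  fixes \<mu> \<theta> :: real and U V :: "nat \<Rightarrow> 'a \<Rightarrow> real" and Y :: "nat \<Rightarrow> nat \<Rightarrow> 'a \<Rightarrow> real"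
  assumes model: "stationary_log_gamma P \<mu> \<theta> U V Y"
    and theta: "0 < \<theta>" "\<theta> < \<mu>"
begin

abbreviation W :: "'a \<Rightarrow> site \<Rightarrow> real" where "W \<equiv> stationary_weight U V Y"

lemma W_indep: "indep_vars (\<lambda>_. borel) (\<lambda>x \<omega>. W \<omega> x) (UNIV - {(0, 0)})"
  using model by (simp add: stationary_log_gamma_def)

lemma W_measurable [measurable]: "(\<lambda>\<omega>. W \<omega> x) \<in> borel_measurable P"
proof (cases "x = (0, 0)")
  case True
  then show ?thesis by (simp add: stationary_weight_def)
next
  case False
  then show ?thesis using W_indep by (auto simp: indep_vars_def)
qed

lemma distr_inverse_W:
  assumes "x \<noteq> (0, 0)"
  shows "distr P borel (\<lambda>\<omega>. inverse (W \<omega> x)) = site_dist \<mu> \<theta> x"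
proof -
  have "distributed P lborel (\<lambda>\<omega>. inverse (W \<omega> x)) (\<lambda>z. ennreal (gamma_density (site_shape \<mu> \<theta> x) z))"
    using model assms
    by (cases x) (auto simp: stationary_log_gamma_def stationary_weight_def site_shape_def)
  then have "distr P lborel (\<lambda>\<omega>. inverse (W \<omega> x)) = site_dist \<mu> \<theta> x"
    by (simp add: distributed_def gamma_dist_def)
  then show ?thesis by (simp cong: distr_cong)
qed

lemma AE_W_pos: "AE \<omega> in P. \<forall>x. 0 < W \<omega> x"
proof -
  have "AE \<omega> in P. 0 < W \<omega> x" for x
  proof (cases "x = (0, 0)")
    case True
    then show ?thesis by (simp add: stationary_weight_def)
  next
    case False
    have "AE z in distr P borel (\<lambda>\<omega>. inverse (W \<omega> x)). 0 < z"
      unfolding distr_inverse_W[OF False] using theta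
      by (intro AE_gamma_dist_pos) (auto simp: site_shape_def)
    then show ?thesis by (subst (asm) AE_distr_iff) auto
  qed
  then show ?thesis by (simp add: AE_all_countable)
qed

lemma distr_inverse_W_joint:
  assumes "(0, 0) \<notin> I"
  shows "distr P (Pi\<^sub>M I (\<lambda>_. borel)) (\<lambda>\<omega>. \<lambda>x\<in>I. inverse (W \<omega> x)) = Pi\<^sub>M I (site_dist \<mu> \<theta>)"
proof (cases "I = {}")
  case True
  \<comment> \<open>The characterisation of independence by a product law asks for a nonempty index
    set, so the empty product is checked by hand.\<close>
  have "distr P (Pi\<^sub>M {} (\<lambda>_. borel)) (\<lambda>\<omega>. \<lambda>x\<in>{}. inverse (W \<omega> x)) = Pi\<^sub>M {} (site_dist \<mu> \<theta>)"
  proof (rule measure_eqI)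
    fix A assume "A \<in> sets (distr P (Pi\<^sub>M {} (\<lambda>_. borel)) (\<lambda>\<omega>. \<lambda>x\<in>{}. inverse (W \<omega> x)))"
    then have "A = {} \<or> A = {\<lambda>_. undefined}" by (auto simp: sets_PiM_empty)
    then show "emeasure (distr P (Pi\<^sub>M {} (\<lambda>_. borel)) (\<lambda>\<omega>. \<lambda>x\<in>{}. inverse (W \<omega> x))) A =
       emeasure (Pi\<^sub>M {} (site_dist \<mu> \<theta>)) A"
      by (auto simp: emeasure_distr sets_PiM_empty emeasure_space_1 emeasure_PiM_empty
          restrict_def vimage_def)
  qed (simp add: sets_PiM_empty)
  then show ?thesis using True by simp
next
  case False
  have "indep_vars (\<lambda>_. borel) (\<lambda>x \<omega>. inverse (W \<omega> x)) (UNIV - {(0, 0)})"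
    by (rule indep_vars_compose2[OF W_indep]) simp
  then have ind: "indep_vars (\<lambda>_. borel) (\<lambda>x \<omega>. inverse (W \<omega> x)) I"
    by (rule indep_vars_subset) (use assms in auto)
  have "distr P (Pi\<^sub>M I (\<lambda>_. borel)) (\<lambda>\<omega>. \<lambda>x\<in>I. inverse (W \<omega> x)) =
      Pi\<^sub>M I (\<lambda>x. distr P borel (\<lambda>\<omega>. inverse (W \<omega> x)))"
    using ind by (subst (asm) indep_vars_iff_distr_eq_PiM'[OF False]) simp_all
  also have "\<dots> = Pi\<^sub>M I (site_dist \<mu> \<theta>)"
    using assms by (intro PiM_cong distr_inverse_W) auto
  finally show ?thesis .
qed

lemma nn_integral_inverse_W:
  assumes "(0, 0) \<notin> I" and f: "f \<in> borel_measurable (Pi\<^sub>M I (\<lambda>_. borel))"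
  shows "(\<integral>\<^sup>+\<omega>. f (\<lambda>x\<in>I. inverse (W \<omega> x)) \<partial>P) = (\<integral>\<^sup>+x. f x \<partial>Pi\<^sub>M I (site_dist \<mu> \<theta>))"
  unfolding distr_inverse_W_joint[OF assms(1), symmetric]
  by (subst nn_integral_distr) (use f in \<open>auto intro!: measurable_restrict\<close>)

lemma Z_measurable [measurable]: "(\<lambda>\<omega>. Z_square (W \<omega>) v u) \<in> borel_measurable P"
  by (intro Z_square_measurable) simp

lemma burke:
  assumes f[measurable]: "f \<in> borel_measurable borel"
  shows "(\<integral>\<^sup>+\<omega>. f (Z_square (W \<omega>) (0, 0) (0, n) / Z_square (W \<omega>) (0, 0) (m, n)) \<partial>P) =
    (\<integral>\<^sup>+\<omega>. f (\<Prod>k=1..m. inverse (W \<omega> (k, 0))) \<partial>P)"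
proof -
  define I where "I = site_box (0, 0) (m, n) - {(0, 0)}"
  let ?r = "\<lambda>w. Z_square w (0, 0) (0, n) / Z_square w (0, 0) (m, n)"
  have comp[measurable]: "(\<lambda>x. x a) \<in> borel_measurable (Pi\<^sub>M I (\<lambda>_. borel :: real measure))"
    if "a \<in> I" for a
    using measurable_component_singleton[OF that, of "\<lambda>_. borel :: real measure"] by simp
  have "(\<lambda>x. inv_weight x a) \<in> borel_measurable (Pi\<^sub>M I (\<lambda>_. borel))"
    if "a \<in> site_box (0, 0) (m, n)" for a
    using that comp[of a] by (cases "a = (0, 0)") (auto simp: inv_weight_def I_def)
  then have zm: "(\<lambda>x. ?r (inv_weight x)) \<in> borel_measurable (Pi\<^sub>M I (\<lambda>_. borel))"
    by (intro borel_measurable_divide Z_square_measurable) (auto simp: site_box_def)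
  have "(\<integral>\<^sup>+\<omega>. f (?r (W \<omega>)) \<partial>P) = (\<integral>\<^sup>+\<omega>. f (?r (inv_weight (\<lambda>x\<in>I. inverse (W \<omega> x)))) \<partial>P)"
  proof (rule nn_integral_cong)
    fix \<omega>
    have w: "inv_weight (\<lambda>x\<in>I. inverse (W \<omega> x)) p = W \<omega> p" if "p \<in> site_box (0, 0) (m, n)" for p
      using that by (auto simp: I_def inv_weight_def stationary_weight_def)
    have "Z_square (W \<omega>) (0, 0) (0, n) = Z_square (inv_weight (\<lambda>x\<in>I. inverse (W \<omega> x))) (0, 0) (0, n)"
      by (intro Z_square_cong w[symmetric]) (auto simp: site_box_def)
    moreover have "Z_square (W \<omega>) (0, 0) (m, n) = Z_square (inv_weight (\<lambda>x\<in>I. inverse (W \<omega> x))) (0, 0) (m, n)"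
      by (intro Z_square_cong w[symmetric]) (auto simp: site_box_def)
    ultimately show "f (?r (W \<omega>)) = f (?r (inv_weight (\<lambda>x\<in>I. inverse (W \<omega> x))))" by simp
  qed
  also have "\<dots> = (\<integral>\<^sup>+x. f (?r (inv_weight x)) \<partial>Pi\<^sub>M I (site_dist \<mu> \<theta>))"
    using measurable_compose[OF zm f] by (intro nn_integral_inverse_W) (auto simp: I_def)
  also have "\<dots> = (\<integral>\<^sup>+x. f (\<Prod>k=1..m. x (k, 0)) \<partial>Pi\<^sub>M I (site_dist \<mu> \<theta>))"
    unfolding I_def by (rule burke_ratio[OF theta f])
  also have "\<dots> = (\<integral>\<^sup>+\<omega>. f (\<Prod>k=1..m. (\<lambda>x\<in>I. inverse (W \<omega> x)) (k, 0)) \<partial>P)"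
  proof (rule nn_integral_inverse_W[symmetric])
    have "(k, 0) \<in> I" if "k \<in> {1..m}" for k using that by (auto simp: I_def site_box_def)
    then show "(\<lambda>x. f (\<Prod>k=1..m. x (k, 0))) \<in> borel_measurable (Pi\<^sub>M I (\<lambda>_. borel))"
      by (intro measurable_compose[OF borel_measurable_prod f]) measurable
  qed (simp add: I_def)
  also have "\<dots> = (\<integral>\<^sup>+\<omega>. f (\<Prod>k=1..m. inverse (W \<omega> (k, 0))) \<partial>P)"
    by (intro nn_integral_cong arg_cong[where f=f] prod.cong) (auto simp: I_def site_box_def)
  finally show ?thesis .
qed

lemma W_moment:
  assumes "x \<noteq> (0, 0)" "\<xi> < site_shape \<mu> \<theta> x"
  shows "(\<integral>\<^sup>+\<omega>. ennreal (W \<omega> x powr \<xi>) \<partial>P) =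
    ennreal (Gamma (site_shape \<mu> \<theta> x - \<xi>) / Gamma (site_shape \<mu> \<theta> x))"
proof -
  have "(\<integral>\<^sup>+\<omega>. ennreal (W \<omega> x powr \<xi>) \<partial>P) = (\<integral>\<^sup>+\<omega>. ennreal (inverse (W \<omega> x) powr (- \<xi>)) \<partial>P)"
    using AE_W_pos by (intro nn_integral_cong_AE, eventually_elim)
      (metis inverse_powr less_imp_le powr_minus inverse_inverse_eq)
  also have "\<dots> = (\<integral>\<^sup>+z. ennreal (z powr (- \<xi>)) \<partial>site_dist \<mu> \<theta> x)"
    unfolding distr_inverse_W[OF assms(1), symmetric] by (subst nn_integral_distr) auto
  also have "\<dots> = ennreal (Gamma (site_shape \<mu> \<theta> x - \<xi>) / Gamma (site_shape \<mu> \<theta> x))"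
    using assms theta by (intro gamma_dist_moment) (auto simp: site_shape_def)
  finally show ?thesis .
qed

lemma nn_integral_prod_W:
  assumes "finite A" "(0, 0) \<notin> A" and f[measurable]: "\<And>x. x \<in> A \<Longrightarrow> f x \<in> borel_measurable borel"
  shows "(\<integral>\<^sup>+\<omega>. (\<Prod>x\<in>A. f x (W \<omega> x)) \<partial>P) = (\<Prod>x\<in>A. \<integral>\<^sup>+\<omega>. f x (W \<omega> x) \<partial>P)"
proof (rule indep_vars_nn_integral[OF assms(1)])
  have "indep_vars (\<lambda>_. borel) (\<lambda>x \<omega>. W \<omega> x) A"
    by (rule indep_vars_subset[OF W_indep]) (use assms in auto)
  then show "indep_vars (\<lambda>_. borel) (\<lambda>x \<omega>. f x (W \<omega> x)) A"
    by (rule indep_vars_compose2) simp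
qed simp

text \<open>The partition function of a box depends only on the weights in that box, so disjointness
  from A gives independence.\<close>

lemma nn_integral_prod_W_Z:
  assumes A: "finite A" "(0, 0) \<notin> A" and f: "\<And>x. x \<in> A \<Longrightarrow> f x \<in> borel_measurable borel"
    and B: "(0, 0) \<notin> site_box v u" "A \<inter> site_box v u = {}" and g: "g \<in> borel_measurable borel"
  shows "(\<integral>\<^sup>+\<omega>. (\<Prod>x\<in>A. f x (W \<omega> x)) * g (Z_square (W \<omega>) v u) \<partial>P) =
    (\<Prod>x\<in>A. \<integral>\<^sup>+\<omega>. f x (W \<omega> x) \<partial>P) * (\<integral>\<^sup>+\<omega>. g (Z_square (W \<omega>) v u) \<partial>P)"
proof -
  let ?B = "site_box v u"
  let ?F = "\<lambda>x. \<Prod>a\<in>A. f a (x a)" and ?G = "\<lambda>x. g (Z_square x v u)"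
  have cm: "(\<lambda>x. x a) \<in> borel_measurable (Pi\<^sub>M I (\<lambda>_. borel :: real measure))" if "a \<in> I" for a I
    using measurable_component_singleton[OF that, of "\<lambda>_. borel :: real measure"] by simp
  have F: "?F \<in> borel_measurable (Pi\<^sub>M A (\<lambda>_. borel))"
    by (intro borel_measurable_prod_ennreal measurable_compose[OF cm f]) auto
  have G: "?G \<in> borel_measurable (Pi\<^sub>M ?B (\<lambda>_. borel))"
    by (intro measurable_compose[OF Z_square_measurable g] cm)
  have ind: "indep_var (Pi\<^sub>M A (\<lambda>_. borel)) (\<lambda>\<omega>. \<lambda>x\<in>A. W \<omega> x) (Pi\<^sub>M ?B (\<lambda>_. borel)) (\<lambda>\<omega>. \<lambda>x\<in>?B. W \<omega> x)"
    using A B by (intro indep_var_restrict[OF W_indep]) auto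
  have ind': "indep_var borel (?F \<circ> (\<lambda>\<omega>. \<lambda>x\<in>A. W \<omega> x)) borel (?G \<circ> (\<lambda>\<omega>. \<lambda>x\<in>?B. W \<omega> x))"
    by (rule indep_var_compose[OF ind F G])
  have FG: "?F \<circ> (\<lambda>\<omega>. \<lambda>x\<in>A. W \<omega> x) = (\<lambda>\<omega>. \<Prod>x\<in>A. f x (W \<omega> x))"
    "?G \<circ> (\<lambda>\<omega>. \<lambda>x\<in>?B. W \<omega> x) = (\<lambda>\<omega>. g (Z_square (W \<omega>) v u))"
    by (auto simp: fun_eq_iff intro!: prod.cong arg_cong[where f=g] Z_square_cong)
  have "(\<integral>\<^sup>+\<omega>. (\<Prod>b\<in>UNIV. case_bool (?F \<circ> (\<lambda>\<omega>. \<lambda>x\<in>A. W \<omega> x)) (?G \<circ> (\<lambda>\<omega>. \<lambda>x\<in>?B. W \<omega> x)) b \<omega>) \<partial>P) =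
     (\<Prod>b\<in>UNIV. \<integral>\<^sup>+\<omega>. case_bool (?F \<circ> (\<lambda>\<omega>. \<lambda>x\<in>A. W \<omega> x)) (?G \<circ> (\<lambda>\<omega>. \<lambda>x\<in>?B. W \<omega> x)) b \<omega> \<partial>P)"
  proof (rule indep_vars_nn_integral)
    have "case_bool borel borel = (\<lambda>_. borel :: ennreal measure)" by (auto split: bool.split)
    then show "indep_vars (\<lambda>_. borel) (case_bool (?F \<circ> (\<lambda>\<omega>. \<lambda>x\<in>A. W \<omega> x)) (?G \<circ> (\<lambda>\<omega>. \<lambda>x\<in>?B. W \<omega> x))) UNIV"
      using ind' by (simp add: indep_var_def)
  qed auto
  then have "(\<integral>\<^sup>+\<omega>. (\<Prod>x\<in>A. f x (W \<omega> x)) * g (Z_square (W \<omega>) v u) \<partial>P) =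
     (\<integral>\<^sup>+\<omega>. (\<Prod>x\<in>A. f x (W \<omega> x)) \<partial>P) * (\<integral>\<^sup>+\<omega>. g (Z_square (W \<omega>) v u) \<partial>P)"
    unfolding FG by (simp add: UNIV_bool mult.commute)
  then show ?thesis using nn_integral_prod_W[OF A f] by simp
qed

text \<open>All sites with both coordinates positive have shape \<mu>, so the law of the partition
  function is invariant under translations within the bulk.\<close>

lemma nn_integral_Z_bulk:
  assumes "a \<ge> 1" "b \<ge> 1" and g: "g \<in> borel_measurable borel"
  shows "(\<integral>\<^sup>+\<omega>. g (Z_square (W \<omega>) (a, b) (a + i, b + j)) \<partial>P) = (\<integral>\<^sup>+z. g z \<partial>bulk_law \<mu> i j)"
proof -
  let ?I = "site_box (a, b) (a + i, b + j)" and ?J = "site_box (0, 0) (i, j)"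
  let ?s = "\<lambda>p::site. (a + fst p, b + snd p)"
  let ?Z = "\<lambda>x. Z_square (\<lambda>p. inverse (x p)) (0, 0) (i, j)"
  have cm: "(\<lambda>x. x c) \<in> borel_measurable (Pi\<^sub>M I (\<lambda>_. borel :: real measure))" if "c \<in> I" for c I
    using measurable_component_singleton[OF that, of "\<lambda>_. borel :: real measure"] by simp
  have Zm: "?Z \<in> borel_measurable (Pi\<^sub>M ?J (\<lambda>_. borel))"
    by (intro Z_square_measurable borel_measurable_inverse cm)
  have s: "?s \<in> ?J \<rightarrow> ?I" by (auto simp: site_box_def)
  have sm: "(\<lambda>x. \<lambda>p\<in>?J. x (?s p)) \<in> Pi\<^sub>M ?I (\<lambda>_. borel) \<rightarrow>\<^sub>M Pi\<^sub>M ?J (\<lambda>_. borel :: real measure)"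
    using s by (intro measurable_restrict cm) auto
  have [measurable_cong]: "sets (Pi\<^sub>M ?J (\<lambda>_. gamma_dist \<mu>)) = sets (Pi\<^sub>M ?J (\<lambda>_. borel))"
    "sets (Pi\<^sub>M ?I (site_dist \<mu> \<theta>)) = sets (Pi\<^sub>M ?I (\<lambda>_. borel))"
    by (intro sets_PiM_cong; simp)+
  note [measurable] = g Zm sm
  have "(\<integral>\<^sup>+\<omega>. g (Z_square (W \<omega>) (a, b) (a + i, b + j)) \<partial>P) =
     (\<integral>\<^sup>+\<omega>. g (?Z (\<lambda>p\<in>?J. (\<lambda>x\<in>?I. inverse (W \<omega> x)) (?s p))) \<partial>P)"
  proof (rule nn_integral_cong, rule arg_cong[where f=g])
    fix \<omega>
    have "Z_square (W \<omega>) (a, b) (a + i, b + j) = Z_square (\<lambda>p. W \<omega> (?s p)) (0, 0) (i, j)"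
      using Z_square_shift[of "W \<omega>" a 0 b 0 i j] by simp
    also have "\<dots> = ?Z (\<lambda>p\<in>?J. (\<lambda>x\<in>?I. inverse (W \<omega> x)) (?s p))"
      by (intro Z_square_cong) (auto simp: site_box_def)
    finally show "Z_square (W \<omega>) (a, b) (a + i, b + j) = ?Z (\<lambda>p\<in>?J. (\<lambda>x\<in>?I. inverse (W \<omega> x)) (?s p))" .
  qed
  also have "\<dots> = (\<integral>\<^sup>+x. g (?Z (\<lambda>p\<in>?J. x (?s p))) \<partial>Pi\<^sub>M ?I (site_dist \<mu> \<theta>))"
    using assms measurable_compose[OF measurable_compose[OF sm Zm] g]
    by (intro nn_integral_inverse_W) (simp add: site_box_def, simp)
  also have "\<dots> = (\<integral>\<^sup>+x. g (?Z x) \<partial>distr (Pi\<^sub>M ?I (site_dist \<mu> \<theta>)) (Pi\<^sub>M ?J (\<lambda>p. site_dist \<mu> \<theta> (?s p))) (\<lambda>x. \<lambda>p\<in>?J. x (?s p)))"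
  proof -
    have [measurable_cong]: "sets (Pi\<^sub>M ?J (\<lambda>p. site_dist \<mu> \<theta> (?s p))) = sets (Pi\<^sub>M ?J (\<lambda>_. borel))"
      by (intro sets_PiM_cong) auto
    have T: "(\<lambda>x. \<lambda>p\<in>?J. x (?s p)) \<in> Pi\<^sub>M ?I (site_dist \<mu> \<theta>) \<rightarrow>\<^sub>M Pi\<^sub>M ?J (\<lambda>p. site_dist \<mu> \<theta> (?s p))"
      by (subst measurable_cong_sets[OF sets_PiM_cong[OF refl] sets_PiM_cong[OF refl]]) (rule sm | simp)+
    have "(\<lambda>x. g (?Z x)) \<in> borel_measurable (Pi\<^sub>M ?J (\<lambda>p. site_dist \<mu> \<theta> (?s p)))" by measurable
    from nn_integral_distr[OF T, of "\<lambda>x. g (?Z x)"] this show ?thesis by simp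
  qed
  also have "distr (Pi\<^sub>M ?I (site_dist \<mu> \<theta>)) (Pi\<^sub>M ?J (\<lambda>p. site_dist \<mu> \<theta> (?s p))) (\<lambda>x. \<lambda>p\<in>?J. x (?s p)) =
      Pi\<^sub>M ?J (\<lambda>p. site_dist \<mu> \<theta> (?s p))"
    using s by (intro distr_PiM_reindex prob_space_site_dist[OF theta]) (auto simp: inj_on_def site_box_def)
  also have "\<dots> = Pi\<^sub>M ?J (\<lambda>_. gamma_dist \<mu>)"
    using assms by (intro PiM_cong) (auto simp: site_shape_def)
  also have "(\<integral>\<^sup>+x. g (?Z x) \<partial>Pi\<^sub>M ?J (\<lambda>_. gamma_dist \<mu>)) = (\<integral>\<^sup>+z. g z \<partial>bulk_law \<mu> i j)"
    unfolding bulk_law_def by (subst nn_integral_distr) measurable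
  finally show ?thesis .
qed

end

text \<open>The canonical model on the product space. It serves the statements about the bulk alone,
  in whose proofs the parameter can thus be chosen at will.\<close>

lemma log_gamma_model_exists:
  assumes "0 < \<theta>" "\<theta> < \<mu>"
  shows "\<exists>P :: (site \<Rightarrow> real) measure. \<exists>U V Y. log_gamma_model P \<mu> \<theta> U V Y"
proof -
  let ?P = "Pi\<^sub>M UNIV (site_dist \<mu> \<theta>)"
  note ps = prob_space_site_dist[OF assms]
  interpret prob_space ?P by (intro prob_space_PiM ps)
  have cm[measurable]: "(\<lambda>x. x a) \<in> borel_measurable ?P" for a
    using measurable_component_singleton[of a UNIV "site_dist \<mu> \<theta>"] by (simp cong: measurable_cong_sets)
  have comp: "distr ?P borel (\<lambda>x. x a) = site_dist \<mu> \<theta> a" for a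
    using distr_PiM_component[of UNIV "site_dist \<mu> \<theta>" a] ps by (simp cong: distr_cong)
  let ?U = "\<lambda>i x. inverse (x (i, 0))" and ?V = "\<lambda>j x. inverse (x (0, j))"
    and ?Y = "\<lambda>i j x. inverse (x (i, j))"
  have "indep_vars (\<lambda>_. borel) (\<lambda>a x. x a) (UNIV :: site set)"
  proof (subst indep_vars_iff_distr_eq_PiM)
    have "distr ?P (Pi\<^sub>M UNIV (\<lambda>_. borel)) (\<lambda>x. \<lambda>i\<in>UNIV. x i) = distr ?P ?P (\<lambda>x. x)"
      by (intro distr_cong) (auto intro!: sets_PiM_cong)
    then show "distr ?P (Pi\<^sub>M UNIV (\<lambda>_. borel)) (\<lambda>x. \<lambda>i\<in>UNIV. x i) = Pi\<^sub>M UNIV (\<lambda>a. distr ?P borel (\<lambda>x. x a))"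
      by (simp add: comp)
  qed auto
  then have ind: "indep_vars (\<lambda>_. borel) (\<lambda>a x. inverse (x a)) (UNIV - {(0, 0)} :: site set)"
    by (intro indep_vars_compose2[where Y="\<lambda>_. inverse", OF indep_vars_subset]) auto
  then have ind': "indep_vars (\<lambda>_. borel) (\<lambda>a x. stationary_weight ?U ?V ?Y x a) (UNIV - {(0, 0)})"
  proof (rule indep_vars_cong[THEN iffD1, rotated -1])
    fix p :: site assume "p \<in> UNIV - {(0, 0)}"
    then show "(\<lambda>x. inverse (x p)) = (\<lambda>x. stationary_weight ?U ?V ?Y x p)"
      by (cases p; cases "fst p = 0"; cases "snd p = 0") (auto simp: stationary_weight_def)
  qed simp_all
  have d: "distributed ?P lborel (\<lambda>x. inverse (inverse (x a))) (\<lambda>x. ennreal (gamma_density (site_shape \<mu> \<theta> a) x))" for a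
    using comp[of a] by (simp add: distributed_def gamma_dist_def cong: distr_cong)
  have "stationary_log_gamma ?P \<mu> \<theta> ?U ?V ?Y"
    unfolding stationary_log_gamma_def
  proof (intro conjI allI impI)
    fix i j :: nat assume ij: "i \<ge> 1" "j \<ge> 1"
    show "distributed ?P lborel (\<lambda>\<omega>. inverse (?U i \<omega>)) (\<lambda>x. ennreal (gamma_density \<theta> x))"
      using d[of "(i, 0)"] by (simp add: site_shape_def)
    show "distributed ?P lborel (\<lambda>\<omega>. inverse (?V j \<omega>)) (\<lambda>x. ennreal (gamma_density (\<mu> - \<theta>) x))"
      using d[of "(0, j)"] ij by (simp add: site_shape_def)
    show "distributed ?P lborel (\<lambda>\<omega>. inverse (?Y i j \<omega>)) (\<lambda>x. ennreal (gamma_density \<mu> x))"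
      using d[of "(i, j)"] ij by (simp add: site_shape_def)
  qed (use ind' prob_space_axioms in simp_all)
  then have "log_gamma_model ?P \<mu> \<theta> ?U ?V ?Y"
    using assms prob_space_axioms by (simp add: log_gamma_model_def log_gamma_model_axioms_def)
  then show ?thesis by blast
qed

section \<open>Moments of the exit decomposition\<close>

text \<open>Bounding the sum by the number of terms times the largest one works for small and large
  exponents alike; the loss is polynomial and hence invisible on the exponential scale.\<close>

lemma sum_powr_le:
  fixes f :: "'i \<Rightarrow> real"
  assumes "finite I" "\<And>i. i \<in> I \<Longrightarrow> 0 \<le> f i" "0 \<le> \<xi>"
  shows "(\<Sum>i\<in>I. f i) powr \<xi> \<le> real (card I) powr \<xi> * (\<Sum>i\<in>I. f i powr \<xi>)"
proof (cases "I = {}")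
  case False
  define M where "M = Max (f ` I)"
  have "M \<in> f ` I" using assms False by (simp add: M_def)
  then obtain i where i: "i \<in> I" "M = f i" by auto
  have "f j \<le> M" if "j \<in> I" for j using that assms by (simp add: M_def)
  then have "(\<Sum>i\<in>I. f i) \<le> real (card I) * M" by (rule sum_bounded_above)
  then have "(\<Sum>i\<in>I. f i) powr \<xi> \<le> (real (card I) * M) powr \<xi>"
    using assms by (intro powr_mono2 sum_nonneg) auto
  also have "\<dots> = real (card I) powr \<xi> * f i powr \<xi>"
    using i assms by (simp add: powr_mult)
  also have "\<dots> \<le> real (card I) powr \<xi> * (\<Sum>i\<in>I. f i powr \<xi>)"
    using i assms by (intro mult_left_mono member_le_sum) auto
  finally show ?thesis .
qed simp

lemma Z_square_exit_vertical:
  assumes "m \<ge> 1"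
  shows "Z_square w (0, b) (m, n) =
     (\<Sum>l=b..n. (\<Prod>j=b..l. w (0, j)) * Z_square w (1, l) (m, n))"
  using Z_square_exit[OF assms, of "\<lambda>p. w (snd p, fst p)" b n] by (simp add: Z_square_swap[of w])

text \<open>The left-hand side is the contribution of the paths whose first k steps are
  horizontal.\<close>

lemma Z_square_ge_horizontal:
  assumes w: "\<And>x. w x > 0" and "k \<le> i"
  shows "(\<Prod>l\<in>{a..<a+k}. w (l, b)) * Z_square w (a + k, b) (a + i, j) \<le> Z_square w (a, b) (a + i, j)"
  using assms(2)
proof (induction k)
  case (Suc k)
  have "(\<Prod>l\<in>{a..<a+Suc k}. w (l, b)) * Z_square w (a + Suc k, b) (a + i, j) =
    (\<Prod>l\<in>{a..<a+k}. w (l, b)) * (w (a + k, b) * Z_square w (Suc (a + k), b) (a + i, j))"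
    by simp
  also have "\<dots> \<le> (\<Prod>l\<in>{a..<a+k}. w (l, b)) * Z_square w (a + k, b) (a + i, j)"
  proof (rule mult_left_mono)
    have "Z_square w (a + k, b) (a + i, j) =
      w (a + k, b) * (Z_square w (Suc (a + k), b) (a + i, j) + Z_square w (a + k, Suc b) (a + i, j))"
      using Suc.prems by (subst Z_square_rec) auto
    moreover have "Z_square w (a + k, Suc b) (a + i, j) \<ge> 0"
      using w by (intro Z_square_nonneg less_imp_le) auto
    ultimately show "w (a + k, b) * Z_square w (Suc (a + k), b) (a + i, j) \<le> Z_square w (a + k, b) (a + i, j)"
      using w[of "(a + k, b)"] by (simp add: algebra_simps)
    show "0 \<le> (\<Prod>l\<in>{a..<a+k}. w (l, b))" using w by (intro prod_nonneg) (auto intro: less_imp_le)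
  qed
  finally show ?case using Suc by simp
qed simp

lemma Z_square_ge_vertical:
  assumes w: "\<And>x. w x > 0" and "k \<le> j"
  shows "(\<Prod>l\<in>{b..<b+k}. w (a, l)) * Z_square w (a, b + k) (i, b + j) \<le> Z_square w (a, b) (i, b + j)"
  using Z_square_ge_horizontal[where w="\<lambda>p. w (snd p, fst p)" and a=b and b=a and i=j and j=i and k=k] assms
  by (simp add: Z_square_swap[of w])

text \<open>The moment of order \<xi> of a weight whose reciprocal is Gamma(\<nu>), that is, the
  exponential of M_\<nu>(\<xi>).\<close>

definition inv_gamma_moment :: "real \<Rightarrow> real \<Rightarrow> real" where
  "inv_gamma_moment \<nu> \<xi> = Gamma (\<nu> - \<xi>) / Gamma \<nu>"

lemma inv_gamma_moment_pos: "0 < \<nu> \<Longrightarrow> \<xi> < \<nu> \<Longrightarrow> 0 < inv_gamma_moment \<nu> \<xi>"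
  by (simp add: inv_gamma_moment_def)

text \<open>\<open>enn2real\<close> would turn an infinite moment into 0;
  \<open>nn_integral_bulk_moment\<close> shows that the moment is finite for 0 <= \<xi> <
  \<mu>.\<close>

definition bulk_moment :: "real \<Rightarrow> real \<Rightarrow> nat \<Rightarrow> nat \<Rightarrow> real" where
  "bulk_moment \<mu> \<xi> i j = enn2real (\<integral>\<^sup>+z. ennreal (z powr \<xi>) \<partial>bulk_law \<mu> i j)"

context log_gamma_model
begin

abbreviation "prodW A \<omega> \<equiv> \<Prod>x\<in>A. W \<omega> x"

text \<open>The common source of the exact moments of exit terms: such a term is a product of powers
  of weights from blocks of constant shape and of a bulk factor, all on disjoint sets of sites.
  Negative exponents are allowed, for blocks that stand in a denominator.\<close>

lemma moment_three_blocks: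
  assumes fin: "finite A" "finite B" "finite C"
    and disj: "A \<inter> B = {}" "A \<inter> C = {}" "B \<inter> C = {}" "(A \<union> B \<union> C) \<inter> site_box (a, b) (a + i, b + j) = {}"
    and zero: "(0, 0) \<notin> A \<union> B \<union> C" and ab: "a \<ge> 1" "b \<ge> 1"
    and shape: "\<And>x. x \<in> A \<Longrightarrow> site_shape \<mu> \<theta> x = \<alpha>" "\<And>x. x \<in> B \<Longrightarrow> site_shape \<mu> \<theta> x = \<beta>"
      "\<And>x. x \<in> C \<Longrightarrow> site_shape \<mu> \<theta> x = \<gamma>"
    and e: "e1 < \<alpha>" "e2 < \<beta>" "e3 < \<gamma>" "0 < \<alpha>" "0 < \<beta>" "0 < \<gamma>"
    and g: "g \<in> borel_measurable borel"
  shows "(\<integral>\<^sup>+\<omega>. ennreal (prodW A \<omega> powr e1 * prodW B \<omega> powr e2 * prodW C \<omega> powr e3) *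
       g (Z_square (W \<omega>) (a, b) (a + i, b + j)) \<partial>P) =
     ennreal (inv_gamma_moment \<alpha> e1 ^ card A * inv_gamma_moment \<beta> e2 ^ card B * inv_gamma_moment \<gamma> e3 ^ card C) *
       (\<integral>\<^sup>+z. g z \<partial>bulk_law \<mu> i j)"
proof -
  let ?e = "\<lambda>x. if x \<in> A then e1 else if x \<in> B then e2 else e3"
  let ?D = "A \<union> B \<union> C"
  let ?Z = "\<lambda>\<omega>. Z_square (W \<omega>) (a, b) (a + i, b + j)"
  have split: "(\<Prod>x\<in>?D. h x) = (\<Prod>x\<in>A. h x) * (\<Prod>x\<in>B. h x) * (\<Prod>x\<in>C. h x)" for h :: "site \<Rightarrow> real"
    using fin disj by (simp add: prod.union_disjoint Int_Un_distrib2)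
  have "(\<integral>\<^sup>+\<omega>. ennreal (prodW A \<omega> powr e1 * prodW B \<omega> powr e2 * prodW C \<omega> powr e3) * g (?Z \<omega>) \<partial>P) =
    (\<integral>\<^sup>+\<omega>. (\<Prod>x\<in>?D. ennreal (W \<omega> x powr ?e x)) * g (?Z \<omega>) \<partial>P)"
    using AE_W_pos
  proof (intro nn_integral_cong_AE, eventually_elim)
    case (elim \<omega>)
    have "(\<Prod>x\<in>?D. W \<omega> x powr ?e x) = (\<Prod>x\<in>A. W \<omega> x powr ?e x) * (\<Prod>x\<in>B. W \<omega> x powr ?e x) * (\<Prod>x\<in>C. W \<omega> x powr ?e x)"
      by (rule split)
    also have "(\<Prod>x\<in>A. W \<omega> x powr ?e x) = prodW A \<omega> powr e1"
      by (simp add: prod_powr_distrib)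
    also have "(\<Prod>x\<in>B. W \<omega> x powr ?e x) = (\<Prod>x\<in>B. W \<omega> x powr e2)"
      using disj by (intro prod.cong) auto
    also have "\<dots> = prodW B \<omega> powr e2"
      by (simp add: prod_powr_distrib)
    also have "(\<Prod>x\<in>C. W \<omega> x powr ?e x) = (\<Prod>x\<in>C. W \<omega> x powr e3)"
      using disj by (intro prod.cong) auto
    also have "\<dots> = prodW C \<omega> powr e3"
      by (simp add: prod_powr_distrib)
    finally show ?case by (simp add: prod_ennreal)
  qed
  also have "\<dots> = (\<Prod>x\<in>?D. \<integral>\<^sup>+\<omega>. ennreal (W \<omega> x powr ?e x) \<partial>P) * (\<integral>\<^sup>+\<omega>. g (?Z \<omega>) \<partial>P)"
    using fin disj zero ab g by (intro nn_integral_prod_W_Z) (auto simp: site_box_def)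
  also have "(\<Prod>x\<in>?D. \<integral>\<^sup>+\<omega>. ennreal (W \<omega> x powr ?e x) \<partial>P) =
    (\<Prod>x\<in>?D. ennreal (inv_gamma_moment (site_shape \<mu> \<theta> x) (?e x)))"
  proof (rule prod.cong[OF refl])
    fix x assume x: "x \<in> ?D"
    show "(\<integral>\<^sup>+\<omega>. ennreal (W \<omega> x powr ?e x) \<partial>P) = ennreal (inv_gamma_moment (site_shape \<mu> \<theta> x) (?e x))"
      unfolding inv_gamma_moment_def
    proof (rule W_moment)
      show "x \<noteq> (0, 0)" using x zero by auto
      show "?e x < site_shape \<mu> \<theta> x" using x e shape[of x] by auto
    qed
  qed
  also have "\<dots> = ennreal (\<Prod>x\<in>?D. inv_gamma_moment (site_shape \<mu> \<theta> x) (?e x))"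
    using e shape by (intro prod_ennreal less_imp_le inv_gamma_moment_pos) auto
  also have "(\<Prod>x\<in>?D. inv_gamma_moment (site_shape \<mu> \<theta> x) (?e x)) =
     inv_gamma_moment \<alpha> e1 ^ card A * inv_gamma_moment \<beta> e2 ^ card B * inv_gamma_moment \<gamma> e3 ^ card C"
  proof -
    have "(\<Prod>x\<in>A. inv_gamma_moment (site_shape \<mu> \<theta> x) (?e x)) = (\<Prod>x\<in>A. inv_gamma_moment \<alpha> e1)"
      using shape by (intro prod.cong) auto
    moreover have "(\<Prod>x\<in>B. inv_gamma_moment (site_shape \<mu> \<theta> x) (?e x)) = (\<Prod>x\<in>B. inv_gamma_moment \<beta> e2)"
      using shape disj by (intro prod.cong) auto
    moreover have "(\<Prod>x\<in>C. inv_gamma_moment (site_shape \<mu> \<theta> x) (?e x)) = (\<Prod>x\<in>C. inv_gamma_moment \<gamma> e3)"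
      using shape disj by (intro prod.cong) auto
    ultimately show ?thesis unfolding split by simp
  qed
  finally show ?thesis using ab by (simp add: nn_integral_Z_bulk[OF ab g])
qed

lemma moment_two_blocks:
  assumes "finite A" "finite B" "A \<inter> B = {}" "(A \<union> B) \<inter> site_box (a, b) (a + i, b + j) = {}"
    and "(0, 0) \<notin> A \<union> B" "a \<ge> 1" "b \<ge> 1"
    and "\<And>x. x \<in> A \<Longrightarrow> site_shape \<mu> \<theta> x = \<alpha>" "\<And>x. x \<in> B \<Longrightarrow> site_shape \<mu> \<theta> x = \<beta>"
    and "e1 < \<alpha>" "e2 < \<beta>" "0 < \<alpha>" "0 < \<beta>"
  shows "(\<integral>\<^sup>+\<omega>. ennreal (prodW A \<omega> powr e1 * prodW B \<omega> powr e2 *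
       Z_square (W \<omega>) (a, b) (a + i, b + j) powr \<xi>) \<partial>P) =
     ennreal (inv_gamma_moment \<alpha> e1 ^ card A * inv_gamma_moment \<beta> e2 ^ card B) *
       (\<integral>\<^sup>+z. ennreal (z powr \<xi>) \<partial>bulk_law \<mu> i j)"
  using moment_three_blocks[of A B "{}" a b i j \<alpha> \<beta> 1 e1 e2 0 "\<lambda>z. ennreal (z powr \<xi>)"] assms
  by (simp add: ennreal_mult)

text \<open>By the Burke property this is the moment of a product of m independent weights. Negative
  \<xi> is included; the lower tail of the bulk rests on that case.\<close>

lemma burke_moment:
  assumes "\<xi> < \<theta>"
  shows "(\<integral>\<^sup>+\<omega>. ennreal ((Z_square (W \<omega>) (0, 0) (m, n) / Z_square (W \<omega>) (0, 0) (0, n)) powr \<xi>) \<partial>P) =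
    ennreal (inv_gamma_moment \<theta> \<xi> ^ m)"
proof -
  have "(\<integral>\<^sup>+\<omega>. ennreal ((Z_square (W \<omega>) (0, 0) (m, n) / Z_square (W \<omega>) (0, 0) (0, n)) powr \<xi>) \<partial>P) =
    (\<integral>\<^sup>+\<omega>. ennreal ((Z_square (W \<omega>) (0, 0) (0, n) / Z_square (W \<omega>) (0, 0) (m, n)) powr (- \<xi>)) \<partial>P)"
    using AE_W_pos
  proof (intro nn_integral_cong_AE, eventually_elim)
    case (elim \<omega>)
    then have "0 < Z_square (W \<omega>) (0, 0) (m, n)" "0 < Z_square (W \<omega>) (0, 0) (0, n)"
      by (auto intro!: Z_square_pos)
    then show ?case by (simp add: powr_minus powr_divide)
  qed
  also have "\<dots> = (\<integral>\<^sup>+\<omega>. ennreal ((\<Prod>k=1..m. inverse (W \<omega> (k, 0))) powr (- \<xi>)) \<partial>P)"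
    by (rule burke) simp
  also have "\<dots> = (\<integral>\<^sup>+\<omega>. (\<Prod>x\<in>{1..m} \<times> {0}. ennreal (W \<omega> x powr \<xi>)) \<partial>P)"
    using AE_W_pos
  proof (intro nn_integral_cong_AE, eventually_elim)
    case (elim \<omega>)
    have "(\<Prod>k=1..m. inverse (W \<omega> (k, 0))) = inverse (prodW ({1..m} \<times> {0}) \<omega>)"
      by (simp add: prod_inversef[symmetric] prod.cartesian_product[symmetric, of "\<lambda>x y. W \<omega> (x, y)", simplified] o_def)
    then have "(\<Prod>k=1..m. inverse (W \<omega> (k, 0))) powr (- \<xi>) = prodW ({1..m} \<times> {0}) \<omega> powr \<xi>"
      by (simp add: powr_minus inverse_powr)
    also have "\<dots> = (\<Prod>x\<in>{1..m} \<times> {0}. W \<omega> x powr \<xi>)"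
      by (rule prod_powr_distrib)
    finally show ?case by (simp add: prod_ennreal)
  qed
  also have "\<dots> = (\<Prod>x\<in>{1..m} \<times> {0::nat}. \<integral>\<^sup>+\<omega>. ennreal (W \<omega> x powr \<xi>) \<partial>P)"
    by (rule nn_integral_prod_W[where f="\<lambda>_ z. ennreal (z powr \<xi>)"]) auto
  also have "\<dots> = (\<Prod>x\<in>{1..m} \<times> {0::nat}. ennreal (inv_gamma_moment \<theta> \<xi>))"
    using assms by (intro prod.cong refl, subst W_moment) (auto simp: site_shape_def inv_gamma_moment_def)
  finally show ?thesis
    using inv_gamma_moment_pos[OF theta(1) assms] by (simp add: ennreal_power less_imp_le)
qed


definition hor :: "nat \<Rightarrow> nat \<Rightarrow> nat \<Rightarrow> 'a \<Rightarrow> real" where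
  "hor m n k \<omega> = prodW ({1..k} \<times> {0}) \<omega> * Z_square (W \<omega>) (k, 1) (m, n)"

definition ver :: "nat \<Rightarrow> nat \<Rightarrow> nat \<Rightarrow> 'a \<Rightarrow> real" where
  "ver m n l \<omega> = prodW ({0} \<times> {1..l}) \<omega> * Z_square (W \<omega>) (1, l) (m, n)"

abbreviation prodV :: "nat \<Rightarrow> 'a \<Rightarrow> real" where
  "prodV n \<omega> \<equiv> prodW ({0} \<times> {1..n}) \<omega>"

lemma prodW_row: "prodW ({a..c} \<times> {b}) \<omega> = (\<Prod>l=a..c. W \<omega> (l, b))"
  using prod.cartesian_product[of "\<lambda>x y. W \<omega> (x, y)" "{b}" "{a..c}"] by simp

lemma prodW_column: "prodW ({a} \<times> {b..c}) \<omega> = (\<Prod>l=b..c. W \<omega> (a, l))"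
  using prod.cartesian_product[of "\<lambda>x y. W \<omega> (x, y)" "{b..c}" "{a}"] by simp

lemma W_origin [simp]: "W \<omega> (0, 0) = 1"
  by (simp add: stationary_weight_def)

lemma Z_hor_eq_sum:
  assumes "n \<ge> 1"
  shows "Z_hor (W \<omega>) (m, n) = (\<Sum>k=1..m. hor m n k \<omega>)"
  using Z_square_exit[OF assms, of "W \<omega>" 1 m]
  by (simp add: Z_hor_rec hor_def prodW_row)

lemma Z_decomposition:
  assumes "m \<ge> 1" "n \<ge> 1"
  shows "Z_square (W \<omega>) (0, 0) (m, n) = (\<Sum>k=1..m. hor m n k \<omega>) + (\<Sum>l=1..n. ver m n l \<omega>)"
  using assms Z_square_exit[OF assms(2), of "W \<omega>" 1 m]
    Z_square_exit_vertical[OF assms(1), of "W \<omega>" 1 n]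
  by (subst Z_square_rec) (auto simp: hor_def ver_def prodW_row prodW_column)

lemma Z_square_axis: "Z_square (W \<omega>) (0, 0) (0, n) = prodV n \<omega>"
  by (simp add: Z_square_vertical prodW_column prod.atLeast_Suc_atMost)

lemma hor_moment:
  assumes "1 \<le> k" "k \<le> m" "n \<ge> 1" "0 \<le> \<xi>" "\<xi> < \<theta>"
  shows "(\<integral>\<^sup>+\<omega>. ennreal (hor m n k \<omega> powr \<xi>) \<partial>P) =
    ennreal (inv_gamma_moment \<theta> \<xi> ^ k) * (\<integral>\<^sup>+z. ennreal (z powr \<xi>) \<partial>bulk_law \<mu> (m - k) (n - 1))"
proof -
  have "({1..k} \<times> {0} \<union> {}) \<inter> site_box (k, 1) (k + (m - k), 1 + (n - 1)) = {}"
    by (auto simp: site_box_def)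
  from moment_two_blocks[OF _ _ _ this, of \<theta> 1 \<xi> 0 \<xi>] show ?thesis
    using assms theta by (simp add: site_shape_def hor_def powr_mult mem_Times_iff)
qed

lemma hor_ratio_moment:
  assumes "1 \<le> k" "k \<le> m" "n \<ge> 1" "0 \<le> \<xi>" "\<xi> < \<theta>"
  shows "(\<integral>\<^sup>+\<omega>. ennreal ((hor m n k \<omega> / prodV n \<omega>) powr \<xi>) \<partial>P) =
    ennreal (inv_gamma_moment \<theta> \<xi> ^ k * inv_gamma_moment (\<mu> - \<theta>) (- \<xi>) ^ n) *
      (\<integral>\<^sup>+z. ennreal (z powr \<xi>) \<partial>bulk_law \<mu> (m - k) (n - 1))"
proof -
  have "(hor m n k \<omega> / prodV n \<omega>) powr \<xi> = prodW ({1..k} \<times> {0}) \<omega> powr \<xi> * prodV n \<omega> powr (- \<xi>) *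
      Z_square (W \<omega>) (k, 1) (k + (m - k), 1 + (n - 1)) powr \<xi>" for \<omega>
    using assms by (simp add: hor_def powr_mult powr_divide powr_minus inverse_powr divide_inverse mult_ac)
  moreover have "({1..k} \<times> {0} \<union> {0} \<times> {1..n}) \<inter> site_box (k, 1) (k + (m - k), 1 + (n - 1)) = {}"
    "({1..k} \<times> {0}) \<inter> ({0} \<times> {1..n}) = {}"
    using assms by (auto simp: site_box_def)
  note moment_two_blocks[OF _ _ this(2,1), of \<theta> "\<mu> - \<theta>" \<xi> "- \<xi>" \<xi>]
  ultimately show ?thesis
    using assms theta by (simp add: site_shape_def mem_Times_iff)
qed

text \<open>Dividing by V_1 ... V_n cancels the axis weights V_1, ..., V_l collected by the path.
  What remains in the denominator is V_(l+1), ..., V_n, independent of the bulk factor.\<close>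

lemma ver_ratio_moment:
  assumes "1 \<le> l" "l \<le> n" "m \<ge> 1" "0 \<le> \<xi>" "\<xi> < \<theta>"
  shows "(\<integral>\<^sup>+\<omega>. ennreal ((ver m n l \<omega> / prodV n \<omega>) powr \<xi>) \<partial>P) =
    ennreal (inv_gamma_moment (\<mu> - \<theta>) (- \<xi>) ^ (n - l)) *
      (\<integral>\<^sup>+z. ennreal (z powr \<xi>) \<partial>bulk_law \<mu> (m - 1) (n - l))"
proof -
  have "(\<integral>\<^sup>+\<omega>. ennreal ((ver m n l \<omega> / prodV n \<omega>) powr \<xi>) \<partial>P) =
     (\<integral>\<^sup>+\<omega>. ennreal (prodW ({0} \<times> {Suc l..n}) \<omega> powr (- \<xi>) * prodW {} \<omega> powr 0 *
       Z_square (W \<omega>) (1, l) (1 + (m - 1), l + (n - l)) powr \<xi>) \<partial>P)"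
    using AE_W_pos
  proof (intro nn_integral_cong_AE, eventually_elim)
    case (elim \<omega>)
    then have pos: "0 < prodV l \<omega>" "0 < Z_square (W \<omega>) (1, l) (m, n)" "0 < prodW ({0} \<times> {Suc l..n}) \<omega>"
      using assms by (auto intro!: prod_pos Z_square_pos)
    have pv: "prodV n \<omega> = prodV l \<omega> * prodW ({0} \<times> {Suc l..n}) \<omega>"
      unfolding prodW_column
      using prod.ub_add_nat[of 1 l "\<lambda>j. W \<omega> (0, j)" "n - l"] assms by simp
    have "ver m n l \<omega> / prodV n \<omega> = Z_square (W \<omega>) (1, l) (m, n) / prodW ({0} \<times> {Suc l..n}) \<omega>"
      unfolding ver_def pv by (rule mult_divide_mult_cancel_left) (use pos(1) in linarith)
    then show ?case using assms pos
      by (simp add: powr_mult powr_minus inverse_powr ennreal_mult[symmetric] divide_inverse mult_ac)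
  qed
  also have "\<dots> = ennreal (inv_gamma_moment (\<mu> - \<theta>) (- \<xi>) ^ card ({0::nat} \<times> {Suc l..n}) *
      inv_gamma_moment 1 0 ^ card ({} :: site set)) *
      (\<integral>\<^sup>+z. ennreal (z powr \<xi>) \<partial>bulk_law \<mu> (m - 1) (n - l))"
    using assms theta by (intro moment_two_blocks) (auto simp: site_box_def site_shape_def)
  finally show ?thesis by simp
qed

section \<open>Upper bounds for bulk moments\<close>

lemma AE_hor_ver_nonneg: "AE \<omega> in P. (\<forall>m n k. 0 \<le> hor m n k \<omega>) \<and> (\<forall>m n l. 0 \<le> ver m n l \<omega>) \<and> (\<forall>n. 0 < prodV n \<omega>)"
  using AE_W_pos
proof eventually_elim
  case (elim \<omega>)
  then have "0 \<le> W \<omega> x" for x using less_imp_le by blast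
  then show ?case using elim unfolding hor_def ver_def
    by (auto intro!: mult_nonneg_nonneg prod_nonneg Z_square_nonneg prod_pos)
qed

text \<open>The exit at k = 1 is one term of the decomposition of the Burke ratio, whose moment is
  known exactly. The inequality lives in \<open>ennreal\<close> because finiteness of the bulk
  moment is only deduced from it.\<close>

lemma bulk_moment_bound_aux:
  assumes "0 \<le> \<xi>" "\<xi> < \<theta>"
  shows "ennreal (inv_gamma_moment \<theta> \<xi> * inv_gamma_moment (\<mu> - \<theta>) (- \<xi>) ^ Suc j) *
      (\<integral>\<^sup>+z. ennreal (z powr \<xi>) \<partial>bulk_law \<mu> i j) \<le> ennreal (inv_gamma_moment \<theta> \<xi> ^ Suc i)"
proof -
  let ?m = "Suc i" and ?n = "Suc j"
  have "(\<integral>\<^sup>+\<omega>. ennreal ((hor ?m ?n 1 \<omega> / prodV ?n \<omega>) powr \<xi>) \<partial>P) \<le>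
      (\<integral>\<^sup>+\<omega>. ennreal ((Z_square (W \<omega>) (0, 0) (?m, ?n) / Z_square (W \<omega>) (0, 0) (0, ?n)) powr \<xi>) \<partial>P)"
    using AE_hor_ver_nonneg
  proof (intro nn_integral_mono_AE, eventually_elim)
    case (elim \<omega>)
    have "hor ?m ?n 1 \<omega> \<le> (\<Sum>k=1..?m. hor ?m ?n k \<omega>)"
      using elim by (intro member_le_sum) auto
    also have "\<dots> \<le> Z_square (W \<omega>) (0, 0) (?m, ?n)"
      using elim by (subst Z_decomposition) (simp_all add: sum_nonneg del: sum.cl_ivl_Suc)
    finally show ?case
      unfolding Z_square_axis using elim assms
      by (intro ennreal_leI powr_mono2 divide_right_mono divide_nonneg_pos) (auto intro: less_imp_le)
  qed
  then show ?thesis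
    using hor_ratio_moment[of 1 ?m ?n \<xi>] burke_moment[of \<xi> ?m ?n] assms by simp
qed

end

context
  fixes \<mu> \<xi> :: real
  assumes xi: "0 \<le> \<xi>" "\<xi> < \<mu>"
begin

lemma nn_integral_bulk_moment:
  "(\<integral>\<^sup>+z. ennreal (z powr \<xi>) \<partial>bulk_law \<mu> i j) = ennreal (bulk_moment \<mu> \<xi> i j)"
proof -
  \<comment> \<open>Any parameter strictly between \<xi> and \<mu> would serve.\<close>
  define \<theta> where "\<theta> = (\<xi> + \<mu>) / 2"
  have th: "0 < \<theta>" "\<theta> < \<mu>" "\<xi> < \<theta>" using xi by (auto simp: \<theta>_def)
  obtain P :: "(site \<Rightarrow> real) measure" and U V Y where "log_gamma_model P \<mu> \<theta> U V Y"
    using log_gamma_model_exists[OF th(1,2)] by blast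
  then interpret log_gamma_model P \<mu> \<theta> U V Y .
  let ?c = "inv_gamma_moment \<theta> \<xi> * inv_gamma_moment (\<mu> - \<theta>) (- \<xi>) ^ Suc j"
  have c: "?c > 0" using th xi by (intro mult_pos_pos zero_less_power inv_gamma_moment_pos) auto
  have "ennreal ?c * (\<integral>\<^sup>+z. ennreal (z powr \<xi>) \<partial>bulk_law \<mu> i j) < top"
    by (rule order_le_less_trans[OF bulk_moment_bound_aux[OF xi(1) th(3), of j i]]) simp
  then have "(\<integral>\<^sup>+z. ennreal (z powr \<xi>) \<partial>bulk_law \<mu> i j) < top"
    unfolding ennreal_mult_less_top using c by (auto simp del: power_Suc)
  then show ?thesis by (simp add: bulk_moment_def)
qed

lemma bulk_moment_nonneg: "0 \<le> bulk_moment \<mu> \<xi> i j"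
  by (simp add: bulk_moment_def)

text \<open>One bound for every \<theta> in (\<xi>, \<mu>): the choice is free since the left-hand
  side does not depend on it. The powers i and \<open>Suc j\<close> differ because the exit at (1,
  0) uses one horizontal weight, while the denominator contains all j + 1 vertical ones.\<close>

lemma bulk_moment_bound:
  assumes "\<xi> < \<theta>" "\<theta> < \<mu>"
  shows "bulk_moment \<mu> \<xi> i j \<le> inv_gamma_moment \<theta> \<xi> ^ i / inv_gamma_moment (\<mu> - \<theta>) (- \<xi>) ^ Suc j"
proof -
  have th: "0 < \<theta>" using assms xi by simp
  obtain P :: "(site \<Rightarrow> real) measure" and U V Y where "log_gamma_model P \<mu> \<theta> U V Y"
    using log_gamma_model_exists[OF th assms(2)] by blast
  then interpret log_gamma_model P \<mu> \<theta> U V Y .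
  let ?a = "inv_gamma_moment \<theta> \<xi>" and ?b = "inv_gamma_moment (\<mu> - \<theta>) (- \<xi>)"
  have ab: "?a > 0" "?b > 0" using assms xi by (auto intro: inv_gamma_moment_pos)
  have "ennreal ((?a * ?b ^ Suc j) * bulk_moment \<mu> \<xi> i j) \<le> ennreal (?a ^ Suc i)"
    using bulk_moment_bound_aux[OF xi(1) assms(1), of j i]
    unfolding nn_integral_bulk_moment by (subst ennreal_mult'') (rule bulk_moment_nonneg)
  then have "(?a * ?b ^ Suc j) * bulk_moment \<mu> \<xi> i j \<le> ?a ^ Suc i"
    using ab by (subst (asm) ennreal_le_iff) auto
  then have "?a * (bulk_moment \<mu> \<xi> i j * ?b ^ Suc j) \<le> ?a * ?a ^ i" by (simp add: mult_ac)
  then have "bulk_moment \<mu> \<xi> i j * ?b ^ Suc j \<le> ?a ^ i" by (rule mult_left_le_imp_le) (use ab in simp)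
  then show ?thesis using ab by (subst pos_le_divide_eq) auto
qed

end

section \<open>From moments of single exits to moments and tails of sums\<close>

lemma nn_integral_sum_powr_le:
  fixes f :: "'i \<Rightarrow> 'b \<Rightarrow> real"
  assumes I: "finite I" and f[measurable]: "\<And>i. i \<in> I \<Longrightarrow> f i \<in> borel_measurable M"
    and nn: "AE \<omega> in M. \<forall>i\<in>I. 0 \<le> f i \<omega>" and "0 \<le> \<xi>"
    and c: "\<And>i. i \<in> I \<Longrightarrow> 0 \<le> c i" "\<And>i. i \<in> I \<Longrightarrow> (\<integral>\<^sup>+\<omega>. ennreal (f i \<omega> powr \<xi>) \<partial>M) \<le> ennreal (c i)"
  shows "(\<integral>\<^sup>+\<omega>. ennreal ((\<Sum>i\<in>I. f i \<omega>) powr \<xi>) \<partial>M) \<le> ennreal (real (card I) powr \<xi> * (\<Sum>i\<in>I. c i))"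
proof -
  have "(\<integral>\<^sup>+\<omega>. ennreal ((\<Sum>i\<in>I. f i \<omega>) powr \<xi>) \<partial>M) \<le>
      (\<integral>\<^sup>+\<omega>. ennreal (real (card I) powr \<xi>) * (\<Sum>i\<in>I. ennreal (f i \<omega> powr \<xi>)) \<partial>M)"
    using nn
  proof (intro nn_integral_mono_AE, eventually_elim)
    case (elim \<omega>)
    have "(\<Sum>i\<in>I. f i \<omega>) powr \<xi> \<le> real (card I) powr \<xi> * (\<Sum>i\<in>I. f i \<omega> powr \<xi>)"
      using elim assms by (intro sum_powr_le) auto
    then have "ennreal ((\<Sum>i\<in>I. f i \<omega>) powr \<xi>) \<le> ennreal (real (card I) powr \<xi> * (\<Sum>i\<in>I. f i \<omega> powr \<xi>))"
      by (rule ennreal_leI)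
    then show ?case by (simp add: ennreal_mult sum_nonneg sum_ennreal)
  qed
  also have "\<dots> = ennreal (real (card I) powr \<xi>) * (\<Sum>i\<in>I. \<integral>\<^sup>+\<omega>. ennreal (f i \<omega> powr \<xi>) \<partial>M)"
    by (simp add: nn_integral_cmult nn_integral_sum del: sum_ennreal)
  also have "\<dots> \<le> ennreal (real (card I) powr \<xi>) * (\<Sum>i\<in>I. ennreal (c i))"
    using c by (intro mult_left_mono sum_mono) auto
  also have "\<dots> = ennreal (real (card I) powr \<xi> * (\<Sum>i\<in>I. c i))"
    using c by (simp add: ennreal_mult sum_nonneg sum_ennreal)
  finally show ?thesis .
qed

lemma (in prob_space) markov_powr:
  fixes X :: "'a \<Rightarrow> real"
  assumes [measurable]: "X \<in> borel_measurable M" and "0 < \<tau>" "0 < \<eta>" "0 \<le> c"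
    and "(\<integral>\<^sup>+\<omega>. ennreal (X \<omega> powr \<eta>) \<partial>M) \<le> ennreal c"
  shows "prob {\<omega> \<in> space M. \<tau> \<le> X \<omega>} \<le> \<tau> powr (- \<eta>) * c"
proof -
  have "emeasure M {\<omega> \<in> space M. \<tau> \<le> X \<omega>} \<le> (\<integral>\<^sup>+\<omega>. ennreal (\<tau> powr (- \<eta>)) * ennreal (X \<omega> powr \<eta>) \<partial>M)"
  proof (subst nn_integral_indicator[symmetric], simp, rule nn_integral_mono)
    fix \<omega>
    have "1 \<le> \<tau> powr (- \<eta>) * X \<omega> powr \<eta>" if "\<tau> \<le> X \<omega>"
    proof -
      have "\<tau> powr \<eta> \<le> X \<omega> powr \<eta>" using that assms by (intro powr_mono2) auto
      then have "\<tau> powr (- \<eta>) * \<tau> powr \<eta> \<le> \<tau> powr (- \<eta>) * X \<omega> powr \<eta>" by (intro mult_left_mono) auto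
      then show ?thesis using assms by (simp add: powr_minus)
    qed
    then show "indicator {\<omega> \<in> space M. \<tau> \<le> X \<omega>} \<omega> \<le> ennreal (\<tau> powr (- \<eta>)) * ennreal (X \<omega> powr \<eta>)"
      by (auto simp: indicator_def ennreal_mult[symmetric])
  qed
  also have "\<dots> = ennreal (\<tau> powr (- \<eta>)) * (\<integral>\<^sup>+\<omega>. ennreal (X \<omega> powr \<eta>) \<partial>M)"
    by (rule nn_integral_cmult) simp
  also have "\<dots> \<le> ennreal (\<tau> powr (- \<eta>)) * ennreal c"
    using assms by (intro mult_left_mono) auto
  also have "\<dots> = ennreal (\<tau> powr (- \<eta>) * c)" using assms by (simp add: ennreal_mult)
  finally show ?thesis using assms by (simp add: emeasure_eq_measure)
qed

context log_gamma_model
begin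

lemma hor_measurable [measurable]: "hor m n k \<in> borel_measurable P"
  unfolding hor_def[abs_def] by measurable

lemma ver_measurable [measurable]: "ver m n k \<in> borel_measurable P"
  unfolding ver_def[abs_def] by measurable

text \<open>K and L remove the exits close to the corner; with K = L = 0 the sum is the full Burke
  ratio. Both kinds of exit are indexed by one disjoint union, so that the power of a sum is split
  only once.\<close>

lemma ratio_sum_moment:
  assumes "0 \<le> \<xi>" "\<xi> < \<theta>" "1 \<le> m" "1 \<le> n"
  defines "a \<equiv> inv_gamma_moment \<theta> \<xi>" and "b \<equiv> inv_gamma_moment (\<mu> - \<theta>) (- \<xi>)"
  shows "(\<integral>\<^sup>+\<omega>. ennreal (((\<Sum>k\<in>{K<..m}. hor m n k \<omega> / prodV n \<omega>) + (\<Sum>l\<in>{L<..n}. ver m n l \<omega> / prodV n \<omega>)) powr \<xi>) \<partial>P)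
    \<le> ennreal (real (m + n) powr \<xi> *
        ((\<Sum>k\<in>{K<..m}. a ^ k * b ^ n * bulk_moment \<mu> \<xi> (m - k) (n - 1)) +
         (\<Sum>l\<in>{L<..n}. b ^ (n - l) * bulk_moment \<mu> \<xi> (m - 1) (n - l))))"
proof -
  let ?I = "{K<..m} <+> {L<..n}"
  let ?f = "\<lambda>i \<omega>. case i of Inl k \<Rightarrow> hor m n k \<omega> / prodV n \<omega> | Inr l \<Rightarrow> ver m n l \<omega> / prodV n \<omega>"
  let ?c = "\<lambda>i. case i of Inl k \<Rightarrow> a ^ k * b ^ n * bulk_moment \<mu> \<xi> (m - k) (n - 1)
    | Inr l \<Rightarrow> b ^ (n - l) * bulk_moment \<mu> \<xi> (m - 1) (n - l)"
  have xi: "0 \<le> \<xi>" "\<xi> < \<mu>" using assms theta by auto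
  have ab: "0 < a" "0 < b" using assms theta by (auto intro!: inv_gamma_moment_pos)
  have nn: "0 \<le> ?c i" for i using ab by (auto split: sum.split intro!: mult_nonneg_nonneg simp: bulk_moment_nonneg[OF xi])
  have "(\<integral>\<^sup>+\<omega>. ennreal ((\<Sum>i\<in>?I. ?f i \<omega>) powr \<xi>) \<partial>P) \<le> ennreal (real (card ?I) powr \<xi> * (\<Sum>i\<in>?I. ?c i))"
  proof (rule nn_integral_sum_powr_le)
    show "AE \<omega> in P. \<forall>i\<in>?I. 0 \<le> ?f i \<omega>"
      using AE_hor_ver_nonneg by eventually_elim (auto intro!: divide_nonneg_pos)
    fix i assume i: "i \<in> ?I"
    show "(\<integral>\<^sup>+\<omega>. ennreal (?f i \<omega> powr \<xi>) \<partial>P) \<le> ennreal (?c i)"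
    proof (cases i)
      case (Inl k)
      then have "1 \<le> k" "k \<le> m" using i by auto
      then show ?thesis using hor_ratio_moment[of k m n \<xi>] assms ab Inl
        by (simp add: nn_integral_bulk_moment[OF xi] ennreal_mult bulk_moment_nonneg[OF xi])
    next
      case (Inr l)
      then have "1 \<le> l" "l \<le> n" using i by auto
      then show ?thesis using ver_ratio_moment[of l n m \<xi>] assms ab Inr
        by (simp add: nn_integral_bulk_moment[OF xi] ennreal_mult bulk_moment_nonneg[OF xi])
    qed
    show "?f i \<in> borel_measurable P" by (cases i) auto
  qed (use assms nn in auto)
  also have "\<dots> \<le> ennreal (real (m + n) powr \<xi> * (\<Sum>i\<in>?I. ?c i))"
    using assms nn by (intro ennreal_leI mult_right_mono powr_mono2 sum_nonneg) (auto simp: card_Plus)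
  finally show ?thesis by (simp add: sum.Plus)
qed

lemma Z_ratio_eq:
  assumes "1 \<le> m" "1 \<le> n"
  shows "Z_square (W \<omega>) (0, 0) (m, n) / Z_square (W \<omega>) (0, 0) (0, n) =
    (\<Sum>k=1..m. hor m n k \<omega> / prodV n \<omega>) + (\<Sum>l=1..n. ver m n l \<omega> / prodV n \<omega>)"
  unfolding Z_decomposition[OF assms] Z_square_axis by (simp add: sum_divide_distrib add_divide_distrib)

text \<open>The moment of the Burke ratio is known exactly, so the upper estimate of its
  decomposition becomes a lower estimate for the bulk moments on the right.\<close>

lemma moment_decomposition:
  assumes "0 \<le> \<xi>" "\<xi> < \<theta>" "1 \<le> m" "1 \<le> n"
  defines "a \<equiv> inv_gamma_moment \<theta> \<xi>" and "b \<equiv> inv_gamma_moment (\<mu> - \<theta>) (- \<xi>)"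
  shows "a ^ m \<le> real (m + n) powr \<xi> *
        ((\<Sum>k=1..m. a ^ k * b ^ n * bulk_moment \<mu> \<xi> (m - k) (n - 1)) +
         (\<Sum>l=1..n. b ^ (n - l) * bulk_moment \<mu> \<xi> (m - 1) (n - l)))" (is "_ \<le> ?R")
proof -
  have xi: "0 \<le> \<xi>" "\<xi> < \<mu>" using assms theta by auto
  have ab: "0 < a" "0 < b" using assms theta by (auto intro!: inv_gamma_moment_pos)
  have eq: "{1..k} = {0<..k}" for k :: nat by auto
  note burke = burke_moment[OF assms(2), of m n, unfolded Z_ratio_eq[OF assms(3,4)] eq]
  have "ennreal (a ^ m) \<le> ennreal ?R"
    using ratio_sum_moment[OF assms(1-4), of 0 0] unfolding burke a_def b_def eq .
  moreover have "0 \<le> ?R"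
    using ab by (auto intro!: mult_nonneg_nonneg add_nonneg_nonneg sum_nonneg simp: bulk_moment_nonneg[OF xi])
  ultimately show ?thesis by simp
qed

lemma Z_hor_moment_upper:
  assumes "0 \<le> \<xi>" "\<xi> < \<theta>" "1 \<le> n"
  shows "(\<integral>\<^sup>+\<omega>. ennreal (Z_hor (W \<omega>) (m, n) powr \<xi>) \<partial>P) \<le>
    ennreal (real m powr \<xi> * (\<Sum>k=1..m. inv_gamma_moment \<theta> \<xi> ^ k * bulk_moment \<mu> \<xi> (m - k) (n - 1)))"
proof -
  have xi: "0 \<le> \<xi>" "\<xi> < \<mu>" using assms theta by auto
  have a: "0 < inv_gamma_moment \<theta> \<xi>" using assms theta by (auto intro!: inv_gamma_moment_pos)
  have "(\<integral>\<^sup>+\<omega>. ennreal ((\<Sum>k\<in>{1..m}. hor m n k \<omega>) powr \<xi>) \<partial>P) \<le>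
    ennreal (real (card {1..m}) powr \<xi> * (\<Sum>k=1..m. inv_gamma_moment \<theta> \<xi> ^ k * bulk_moment \<mu> \<xi> (m - k) (n - 1)))"
  proof (rule nn_integral_sum_powr_le)
    show "AE \<omega> in P. \<forall>k\<in>{1..m}. 0 \<le> hor m n k \<omega>"
      using AE_hor_ver_nonneg by eventually_elim auto
    fix k assume k: "k \<in> {1..m}"
    then show "(\<integral>\<^sup>+\<omega>. ennreal (hor m n k \<omega> powr \<xi>) \<partial>P) \<le>
        ennreal (inv_gamma_moment \<theta> \<xi> ^ k * bulk_moment \<mu> \<xi> (m - k) (n - 1))"
      using hor_moment[of k m n \<xi>] assms a
      by (simp add: nn_integral_bulk_moment[OF xi] ennreal_mult bulk_moment_nonneg[OF xi])
  qed (use assms a bulk_moment_nonneg[OF xi] in auto)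
  then show ?thesis using assms by (simp add: Z_hor_eq_sum)
qed

text \<open>One exit term is kept; k is later chosen as the dominant exit.\<close>

lemma Z_hor_moment_lower:
  assumes "0 \<le> \<xi>" "\<xi> < \<theta>" "1 \<le> n" "1 \<le> k" "k \<le> m"
  shows "ennreal (inv_gamma_moment \<theta> \<xi> ^ k * bulk_moment \<mu> \<xi> (m - k) (n - 1)) \<le>
    (\<integral>\<^sup>+\<omega>. ennreal (Z_hor (W \<omega>) (m, n) powr \<xi>) \<partial>P)"
proof -
  have xi: "0 \<le> \<xi>" "\<xi> < \<mu>" using assms theta by auto
  have a: "0 < inv_gamma_moment \<theta> \<xi>" using assms theta by (auto intro!: inv_gamma_moment_pos)
  have "ennreal (inv_gamma_moment \<theta> \<xi> ^ k * bulk_moment \<mu> \<xi> (m - k) (n - 1)) =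
      (\<integral>\<^sup>+\<omega>. ennreal (hor m n k \<omega> powr \<xi>) \<partial>P)"
    using hor_moment[of k m n \<xi>] assms a
    by (simp add: nn_integral_bulk_moment[OF xi] ennreal_mult bulk_moment_nonneg[OF xi])
  also have "\<dots> \<le> (\<integral>\<^sup>+\<omega>. ennreal (Z_hor (W \<omega>) (m, n) powr \<xi>) \<partial>P)"
    using AE_hor_ver_nonneg
  proof (intro nn_integral_mono_AE, eventually_elim)
    case (elim \<omega>)
    have "hor m n k \<omega> \<le> (\<Sum>k=1..m. hor m n k \<omega>)"
      using elim assms by (intro member_le_sum) auto
    then show ?case using elim assms by (auto simp: Z_hor_eq_sum intro!: ennreal_leI powr_mono2)
  qed
  finally show ?thesis .
qed

text \<open>If paths forced through the sites of A before entering the smaller box contribute to the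
  larger partition function, independence turns this into an inequality of moments, with one factor
  per site of A.\<close>

lemma bulk_moment_ge_block:
  assumes xi: "0 \<le> \<xi>" "\<xi> < \<mu>" and A: "finite A" "\<And>x. x \<in> A \<Longrightarrow> fst x \<ge> 1 \<and> snd x \<ge> 1"
    and ab: "a \<ge> 1" "b \<ge> 1" "A \<inter> site_box (a, b) (a + i', b + j') = {}"
    and le: "\<And>\<omega>. (\<forall>x. 0 < W \<omega> x) \<Longrightarrow>
      prodW A \<omega> * Z_square (W \<omega>) (a, b) (a + i', b + j') \<le> Z_square (W \<omega>) (1, 1) (1 + i, 1 + j)"
  shows "inv_gamma_moment \<mu> \<xi> ^ card A * bulk_moment \<mu> \<xi> i' j' \<le> bulk_moment \<mu> \<xi> i j"
proof -
  note nb = nn_integral_bulk_moment[OF xi] bulk_moment_nonneg[OF xi]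
  have y: "0 < inv_gamma_moment \<mu> \<xi>" using xi theta by (auto intro!: inv_gamma_moment_pos)
  have shp: "site_shape \<mu> \<theta> x = \<mu>" "x \<noteq> (0, 0)" if "x \<in> A" for x
    using A(2)[OF that] by (auto simp: site_shape_def)
  then have zero: "(0, 0) \<notin> A" by blast
  have "ennreal (inv_gamma_moment \<mu> \<xi> ^ card A * inv_gamma_moment 1 0 ^ card ({} :: site set)) *
      (\<integral>\<^sup>+z. ennreal (z powr \<xi>) \<partial>bulk_law \<mu> i' j') =
    (\<integral>\<^sup>+\<omega>. ennreal (prodW A \<omega> powr \<xi> * prodW {} \<omega> powr 0 *
       Z_square (W \<omega>) (a, b) (a + i', b + j') powr \<xi>) \<partial>P)"
    using xi theta A(1) ab shp(1) zero by (intro moment_two_blocks[symmetric]) auto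
  also have "\<dots> \<le> (\<integral>\<^sup>+\<omega>. ennreal (Z_square (W \<omega>) (1, 1) (1 + i, 1 + j) powr \<xi>) \<partial>P)"
    using AE_W_pos
  proof (intro nn_integral_mono_AE, eventually_elim)
    case (elim \<omega>)
    then have nn: "0 \<le> W \<omega> x" for x using less_imp_le by blast
    have "(prodW A \<omega> * Z_square (W \<omega>) (a, b) (a + i', b + j')) powr \<xi> \<le>
        Z_square (W \<omega>) (1, 1) (1 + i, 1 + j) powr \<xi>"
      using xi le[OF elim(2)] by (intro powr_mono2 mult_nonneg_nonneg prod_nonneg Z_square_nonneg nn) auto
    then show ?case by (simp add: powr_mult ennreal_leI)
  qed
  also have "\<dots> = ennreal (bulk_moment \<mu> \<xi> i j)"
    by (subst nn_integral_Z_bulk[where g="\<lambda>z. ennreal (z powr \<xi>)"]) (auto simp: nb)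
  finally have "ennreal (inv_gamma_moment \<mu> \<xi> ^ card A * bulk_moment \<mu> \<xi> i' j') \<le> ennreal (bulk_moment \<mu> \<xi> i j)"
    using y by (simp add: nb ennreal_mult)
  then show ?thesis by (simp add: nb)
qed

end

text \<open>Prescribing the first k steps of a path costs one independent weight each. This permits
  comparing all exits near the corner with the single bulk moment from the corner.\<close>

lemma bulk_moment_shift:
  assumes "0 \<le> \<xi>" "\<xi> < \<mu>"
  shows "k \<le> i \<Longrightarrow> inv_gamma_moment \<mu> \<xi> ^ k * bulk_moment \<mu> \<xi> (i - k) j \<le> bulk_moment \<mu> \<xi> i j"
    and "k \<le> j \<Longrightarrow> inv_gamma_moment \<mu> \<xi> ^ k * bulk_moment \<mu> \<xi> i (j - k) \<le> bulk_moment \<mu> \<xi> i j"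
proof -
  \<comment> \<open>The midpoint is an arbitrary admissible parameter; only bulk weights are
    involved.\<close>
  have th: "0 < \<mu> / 2" "\<mu> / 2 < \<mu>" using assms by auto
  obtain P :: "(site \<Rightarrow> real) measure" and U V Y where "log_gamma_model P \<mu> (\<mu> / 2) U V Y"
    using log_gamma_model_exists[OF th] by blast
  then interpret log_gamma_model P \<mu> "\<mu> / 2" U V Y .
  have row: "prodW ({1..<1 + k} \<times> {1}) \<omega> = (\<Prod>l\<in>{1..<1+k}. W \<omega> (l, 1))"
    "prodW ({1} \<times> {1..<1 + k}) \<omega> = (\<Prod>l\<in>{1..<1+k}. W \<omega> (1, l))" for \<omega>
    using prod.cartesian_product[of "\<lambda>x y. W \<omega> (x, y)" "{1}" "{1..<1+k}"]
      prod.cartesian_product[of "\<lambda>x y. W \<omega> (x, y)" "{1..<1+k}" "{1}"] by simp_all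
  show "inv_gamma_moment \<mu> \<xi> ^ k * bulk_moment \<mu> \<xi> (i - k) j \<le> bulk_moment \<mu> \<xi> i j" if k: "k \<le> i"
  proof -
    have "inv_gamma_moment \<mu> \<xi> ^ card ({1..<1 + k} \<times> {1::nat}) * bulk_moment \<mu> \<xi> (i - k) j \<le> bulk_moment \<mu> \<xi> i j"
    proof (rule bulk_moment_ge_block[OF assms, where a="1 + k" and b=1])
      fix \<omega> assume w: "\<forall>x. 0 < W \<omega> x"
      show "prodW ({1..<1 + k} \<times> {1}) \<omega> * Z_square (W \<omega>) (1 + k, 1) (1 + k + (i - k), 1 + j) \<le>
          Z_square (W \<omega>) (1, 1) (1 + i, 1 + j)"
        unfolding row using Z_square_ge_horizontal[where w="W \<omega>" and a=1 and b=1 and j="1 + j", OF w[rule_format] k] k by simp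
    qed (auto simp: site_box_def)
    then show ?thesis by simp
  qed
  show "inv_gamma_moment \<mu> \<xi> ^ k * bulk_moment \<mu> \<xi> i (j - k) \<le> bulk_moment \<mu> \<xi> i j" if k: "k \<le> j"
  proof -
    have "inv_gamma_moment \<mu> \<xi> ^ card ({1::nat} \<times> {1..<1 + k}) * bulk_moment \<mu> \<xi> i (j - k) \<le> bulk_moment \<mu> \<xi> i j"
    proof (rule bulk_moment_ge_block[OF assms, where a=1 and b="1 + k"])
      fix \<omega> assume w: "\<forall>x. 0 < W \<omega> x"
      show "prodW ({1} \<times> {1..<1 + k}) \<omega> * Z_square (W \<omega>) (1, 1 + k) (1 + i, 1 + k + (j - k)) \<le>
          Z_square (W \<omega>) (1, 1) (1 + i, 1 + j)"
        unfolding row using Z_square_ge_vertical[where w="W \<omega>" and a=1 and b=1 and i="1 + i", OF w[rule_format] k] k by simp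
    qed (auto simp: site_box_def)
    then show ?thesis by simp
  qed
qed

section \<open>A lower tail estimate for the bulk at finite size\<close>

lemma powr_minus_one_less_imp:
  fixes x y :: real
  assumes "x powr (-1) < y powr (-1)" "0 < x" "0 < y"
  shows "y < x"
  using assms by (simp add: powr_minus)

text \<open>If B < z, R < \<tau> / z and T < \<tau>, then Z < 2 \<tau>. So a small B forces one of
  three events, each of which Markov's inequality controls, the one for Z through a negative moment.
  No independence between R and B is required.\<close>

lemma (in prob_space) lower_tail_of_product:
  fixes Z B R T :: "'a \<Rightarrow> real"
  assumes [measurable]: "Z \<in> borel_measurable M" "B \<in> borel_measurable M"
      "R \<in> borel_measurable M" "T \<in> borel_measurable M"
    and AE: "AE \<omega> in M. Z \<omega> \<le> R \<omega> * B \<omega> + T \<omega> \<and> 0 < Z \<omega> \<and> 0 \<le> R \<omega> \<and> 0 < B \<omega>"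
    and pos: "0 < \<eta>" "0 < \<tau>" "0 < z" "0 \<le> c1" "0 \<le> c2" "0 \<le> c3"
    and c: "(\<integral>\<^sup>+\<omega>. ennreal (Z \<omega> powr (- \<eta>)) \<partial>M) \<le> ennreal c1"
      "(\<integral>\<^sup>+\<omega>. ennreal (R \<omega> powr \<eta>) \<partial>M) \<le> ennreal c2"
      "(\<integral>\<^sup>+\<omega>. ennreal (T \<omega> powr \<eta>) \<partial>M) \<le> ennreal c3"
  shows "prob {\<omega> \<in> space M. B \<omega> < z} \<le>
    (2 * \<tau>) powr \<eta> * c1 + (\<tau> / z) powr (- \<eta>) * c2 + \<tau> powr (- \<eta>) * c3"
proof -
  let ?E1 = "{\<omega> \<in> space M. (2 * \<tau>) powr (-1) \<le> Z \<omega> powr (-1)}"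
    and ?E2 = "{\<omega> \<in> space M. \<tau> / z \<le> R \<omega>}" and ?E3 = "{\<omega> \<in> space M. \<tau> \<le> T \<omega>}"
  have "prob {\<omega> \<in> space M. B \<omega> < z} \<le> prob (?E1 \<union> ?E2 \<union> ?E3)"
  proof (rule finite_measure_mono_AE)
    show "AE \<omega> in M. \<omega> \<in> {\<omega> \<in> space M. B \<omega> < z} \<longrightarrow> \<omega> \<in> ?E1 \<union> ?E2 \<union> ?E3"
      using AE
    proof eventually_elim
      case (elim \<omega>)
      show ?case
      proof (intro impI, rule ccontr)
        assume B: "\<omega> \<in> {\<omega> \<in> space M. B \<omega> < z}" and "\<omega> \<notin> ?E1 \<union> ?E2 \<union> ?E3"
        then have A: "Z \<omega> powr (-1) < (2 * \<tau>) powr (-1)" "R \<omega> < \<tau> / z" "T \<omega> < \<tau>" by auto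
        have "R \<omega> * B \<omega> \<le> \<tau> / z * z" using A B elim pos by (intro mult_mono) auto
        then have "Z \<omega> < 2 * \<tau>" using elim A pos by simp
        moreover have "2 * \<tau> < Z \<omega>"
          by (rule powr_minus_one_less_imp[OF A(1)]) (use elim pos in simp_all)
        ultimately show False by simp
      qed
    qed
  qed measurable
  also have "\<dots> \<le> prob (?E1 \<union> ?E2) + prob ?E3"
    by (rule measure_Un_le) measurable
  also have "\<dots> \<le> prob ?E1 + prob ?E2 + prob ?E3"
    by (intro add_right_mono measure_Un_le) measurable
  also have "\<dots> \<le> ((2 * \<tau>) powr (-1)) powr (- \<eta>) * c1 + (\<tau> / z) powr (- \<eta>) * c2 + \<tau> powr (- \<eta>) * c3"
  proof -
    have "(\<integral>\<^sup>+\<omega>. ennreal ((Z \<omega> powr (-1)) powr \<eta>) \<partial>M) \<le> ennreal c1"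
      using c(1) by (simp only: powr_powr mult_minus_left mult_1_left)
    then show ?thesis
      using pos by (intro add_mono markov_powr c) simp_all
  qed
  also have "((2 * \<tau>) powr (-1)) powr (- \<eta>) = (2 * \<tau>) powr \<eta>" by (simp only: powr_powr) simp
  finally show ?thesis .
qed

context log_gamma_model
begin

lemma nn_integral_bulk_one: "(\<integral>\<^sup>+z. 1 \<partial>bulk_law \<mu> i j) = 1"
  using nn_integral_Z_bulk[of 1 1 "\<lambda>_. 1" i j] by (simp add: emeasure_space_1)

lemma prob_Z_bulk:
  assumes "1 \<le> a" "1 \<le> b"
  shows "prob {\<omega> \<in> space P. Z_square (W \<omega>) (a, b) (a + i, b + j) < z} = measure (bulk_law \<mu> i j) {..<z}"
proof -
  have "emeasure P {\<omega> \<in> space P. Z_square (W \<omega>) (a, b) (a + i, b + j) < z} =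
     (\<integral>\<^sup>+\<omega>. indicator {..<z} (Z_square (W \<omega>) (a, b) (a + i, b + j)) \<partial>P)"
  proof -
    have "(\<integral>\<^sup>+\<omega>. indicator {..<z} (Z_square (W \<omega>) (a, b) (a + i, b + j)) \<partial>P) =
        (\<integral>\<^sup>+\<omega>. indicator {\<omega> \<in> space P. Z_square (W \<omega>) (a, b) (a + i, b + j) < z} \<omega> \<partial>P)"
      by (intro nn_integral_cong) (simp add: indicator_def)
    also have "\<dots> = emeasure P {\<omega> \<in> space P. Z_square (W \<omega>) (a, b) (a + i, b + j) < z}"
      by (rule nn_integral_indicator) measurable
    finally show ?thesis ..
  qed
  also have "\<dots> = emeasure (bulk_law \<mu> i j) {..<z}"
    using assms by (subst nn_integral_Z_bulk) (auto simp: bulk_law_def)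
  finally show ?thesis by (simp add: measure_def)
qed

text \<open>The factor that remains when the bulk part of an exit at (k, 0) is replaced by the
  partition function from (1, 1): the weights at (1, 1), ..., (k - 1, 1), which the longer path
  collects in addition, are divided out.\<close>

definition hor_corner :: "nat \<Rightarrow> nat \<Rightarrow> 'a \<Rightarrow> real" where
  "hor_corner n k \<omega> = prodW ({1..k} \<times> {0}) \<omega> / (prodW ({1..<k} \<times> {1}) \<omega> * prodV n \<omega>)"

text \<open>The analogue for exits at (0, l), after V_1, ..., V_l have cancelled against the
  denominator.\<close>

definition ver_corner :: "nat \<Rightarrow> nat \<Rightarrow> 'a \<Rightarrow> real" where
  "ver_corner n l \<omega> = 1 / (prodW ({0} \<times> {Suc l..n}) \<omega> * prodW ({1} \<times> {1..<l}) \<omega>)"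

lemma hor_corner_measurable [measurable]: "hor_corner n k \<in> borel_measurable P"
  unfolding hor_corner_def[abs_def] by measurable

lemma ver_corner_measurable [measurable]: "ver_corner n k \<in> borel_measurable P"
  unfolding ver_corner_def[abs_def] by measurable

lemma hor_le_corner:
  assumes w: "\<And>x. 0 < W \<omega> x" and "1 \<le> k" "k \<le> Suc i"
  shows "hor (Suc i) n k \<omega> / prodV n \<omega> \<le> hor_corner n k \<omega> * Z_square (W \<omega>) (1, 1) (Suc i, n)"
proof -
  obtain k' where k': "k = 1 + k'" "k' \<le> i" using assms by (cases k) auto
  have p: "0 < prodW A \<omega>" for A using w by (intro prod_pos) auto
  have "prodW ({1..<k} \<times> {1}) \<omega> = (\<Prod>l\<in>{1..<1+k'}. W \<omega> (l, 1))"
    using prod.cartesian_product[of "\<lambda>x y. W \<omega> (x, y)" "{1}" "{1..<1+k'}"] k' by simp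
  then have "prodW ({1..<k} \<times> {1}) \<omega> * Z_square (W \<omega>) (k, 1) (Suc i, n) \<le> Z_square (W \<omega>) (1, 1) (Suc i, n)"
    using Z_square_ge_horizontal[where w="W \<omega>" and k=k' and i=i and a=1 and b=1 and j=n, OF w k'(2)] k' by simp
  then have "Z_square (W \<omega>) (k, 1) (Suc i, n) \<le> Z_square (W \<omega>) (1, 1) (Suc i, n) / prodW ({1..<k} \<times> {1}) \<omega>"
    using p by (subst pos_le_divide_eq) (auto simp: mult.commute)
  then have "prodW ({1..k} \<times> {0}) \<omega> * Z_square (W \<omega>) (k, 1) (Suc i, n) / prodV n \<omega> \<le>
      prodW ({1..k} \<times> {0}) \<omega> * (Z_square (W \<omega>) (1, 1) (Suc i, n) / prodW ({1..<k} \<times> {1}) \<omega>) / prodV n \<omega>"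
    by (rule divide_right_mono[OF mult_left_mono[OF _ less_imp_le[OF p]] less_imp_le[OF p]])
  then show ?thesis by (simp add: hor_def hor_corner_def mult_ac)
qed

lemma ver_le_corner:
  assumes w: "\<And>x. 0 < W \<omega> x" and "1 \<le> l" "l \<le> Suc j"
  shows "ver m (Suc j) l \<omega> / prodV (Suc j) \<omega> \<le> ver_corner (Suc j) l \<omega> * Z_square (W \<omega>) (1, 1) (m, Suc j)"
proof -
  obtain l' where l': "l = 1 + l'" "l' \<le> j" using assms by (cases l) auto
  have p: "0 < prodW A \<omega>" for A using w by (intro prod_pos) auto
  have "prodW ({1} \<times> {1..<l}) \<omega> = (\<Prod>k\<in>{1..<1+l'}. W \<omega> (1, k))"
    using prod.cartesian_product[of "\<lambda>x y. W \<omega> (x, y)" "{1..<1+l'}" "{1}"] l' by simp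
  then have "prodW ({1} \<times> {1..<l}) \<omega> * Z_square (W \<omega>) (1, l) (m, Suc j) \<le> Z_square (W \<omega>) (1, 1) (m, Suc j)"
    using Z_square_ge_vertical[where w="W \<omega>" and k=l' and j=j and a=1 and b=1 and i=m, OF w l'(2)] l' by simp
  then have Z: "Z_square (W \<omega>) (1, l) (m, Suc j) \<le> Z_square (W \<omega>) (1, 1) (m, Suc j) / prodW ({1} \<times> {1..<l}) \<omega>"
    using p by (subst pos_le_divide_eq) (auto simp: mult.commute)
  have pv: "prodV (Suc j) \<omega> = prodV l \<omega> * prodW ({0} \<times> {Suc l..Suc j}) \<omega>"
    unfolding prodW_column
    using prod.ub_add_nat[of 1 l "\<lambda>j. W \<omega> (0, j)" "Suc j - l"] assms by simp
  have "ver m (Suc j) l \<omega> / prodV (Suc j) \<omega> = Z_square (W \<omega>) (1, l) (m, Suc j) / prodW ({0} \<times> {Suc l..Suc j}) \<omega>"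
    unfolding ver_def pv by (rule mult_divide_mult_cancel_left) (use p[of "{0} \<times> {1..l}"] in linarith)
  also have "\<dots> \<le> (Z_square (W \<omega>) (1, 1) (m, Suc j) / prodW ({1} \<times> {1..<l}) \<omega>) / prodW ({0} \<times> {Suc l..Suc j}) \<omega>"
    by (intro divide_right_mono less_imp_le p Z)
  finally show ?thesis by (simp add: ver_corner_def mult_ac)
qed

lemma hor_corner_moment:
  assumes "0 \<le> \<eta>" "\<eta> < \<theta>" "1 \<le> k" "1 \<le> n"
  shows "(\<integral>\<^sup>+\<omega>. ennreal (hor_corner n k \<omega> powr \<eta>) \<partial>P) = ennreal (inv_gamma_moment \<theta> \<eta> ^ k *
     inv_gamma_moment \<mu> (- \<eta>) ^ (k - 1) * inv_gamma_moment (\<mu> - \<theta>) (- \<eta>) ^ n)"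
proof -
  have "(\<integral>\<^sup>+\<omega>. ennreal (hor_corner n k \<omega> powr \<eta>) \<partial>P) =
    (\<integral>\<^sup>+\<omega>. ennreal (prodW ({1..k} \<times> {0}) \<omega> powr \<eta> * prodW ({1..<k} \<times> {1}) \<omega> powr (- \<eta>) * prodV n \<omega> powr (- \<eta>)) *
       1 \<partial>P)"
    by (simp add: hor_corner_def powr_divide powr_mult powr_minus divide_inverse inverse_powr mult.assoc)
  \<comment> \<open>The bulk factor is the constant 1; its box is the single site (k, 2), chosen to
    be disjoint from all three blocks.\<close>
  also have "\<dots> = ennreal (inv_gamma_moment \<theta> \<eta> ^ card ({1..k} \<times> {0::nat}) *
     inv_gamma_moment \<mu> (- \<eta>) ^ card ({1..<k} \<times> {1::nat}) * inv_gamma_moment (\<mu> - \<theta>) (- \<eta>) ^ card ({0::nat} \<times> {1..n})) *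
     (\<integral>\<^sup>+z. 1 \<partial>bulk_law \<mu> 0 0)"
    using assms theta
    by (intro moment_three_blocks[where g="\<lambda>_. 1" and a=k and b=2]) (auto simp: site_box_def site_shape_def)
  finally show ?thesis by (simp add: nn_integral_bulk_one del: nn_integral_const)
qed

lemma ver_corner_moment:
  assumes "0 \<le> \<eta>" "\<eta> < \<theta>" "1 \<le> l" "1 \<le> n"
  shows "(\<integral>\<^sup>+\<omega>. ennreal (ver_corner n l \<omega> powr \<eta>) \<partial>P) = ennreal (
     inv_gamma_moment (\<mu> - \<theta>) (- \<eta>) ^ (n - l) * inv_gamma_moment \<mu> (- \<eta>) ^ (l - 1))"
proof -
  have "(\<integral>\<^sup>+\<omega>. ennreal (ver_corner n l \<omega> powr \<eta>) \<partial>P) =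
    (\<integral>\<^sup>+\<omega>. ennreal (prodW ({0} \<times> {Suc l..n}) \<omega> powr (- \<eta>) * prodW ({1} \<times> {1..<l}) \<omega> powr (- \<eta>) * prodW {} \<omega> powr 0) *
       1 \<partial>P)"
    by (simp add: ver_corner_def powr_divide powr_mult powr_minus divide_inverse inverse_powr)
  also have "\<dots> = ennreal (inv_gamma_moment (\<mu> - \<theta>) (- \<eta>) ^ card ({0::nat} \<times> {Suc l..n}) *
     inv_gamma_moment \<mu> (- \<eta>) ^ card ({1::nat} \<times> {1..<l}) * inv_gamma_moment 1 0 ^ card ({} :: site set)) *
     (\<integral>\<^sup>+z. 1 \<partial>bulk_law \<mu> 0 0)"
    using assms theta
    by (intro moment_three_blocks[where g="\<lambda>_. 1" and a=2 and b=1]) (auto simp: site_box_def site_shape_def)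
  finally show ?thesis by (simp add: nn_integral_bulk_one del: nn_integral_const)
qed

text \<open>Instance of \<open>lower_tail_of_product\<close>: Z is the Burke ratio, B the bulk
  partition function from (1, 1), R collects the corner factors of the exits up to K and L, and T is
  the sum of the remaining exits. R and B share the weights next to the axes, which is harmless for
  a union bound.\<close>

lemma bulk_lower_tail_aux:
  assumes "0 < \<eta>" "\<eta> < \<theta>" "0 < \<tau>" "0 < z" "K \<le> Suc i" "L \<le> Suc j"
  defines "m \<equiv> Suc i" and "n \<equiv> Suc j"
  defines "a \<equiv> inv_gamma_moment \<theta> \<eta>" and "b \<equiv> inv_gamma_moment (\<mu> - \<theta>) (- \<eta>)"
    and "y \<equiv> inv_gamma_moment \<mu> (- \<eta>)"
  shows "measure (bulk_law \<mu> i j) {..<z} \<le>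
    (2 * \<tau>) powr \<eta> * inv_gamma_moment \<theta> (- \<eta>) ^ m +
    (\<tau> / z) powr (- \<eta>) * (real (K + L) powr \<eta> *
       ((\<Sum>k=1..K. a ^ k * y ^ (k - 1) * b ^ n) + (\<Sum>l=1..L. b ^ (n - l) * y ^ (l - 1)))) +
    \<tau> powr (- \<eta>) * (real (m + n) powr \<eta> *
       ((\<Sum>k\<in>{K<..m}. a ^ k * b ^ n * bulk_moment \<mu> \<eta> (m - k) (n - 1)) +
        (\<Sum>l\<in>{L<..n}. b ^ (n - l) * bulk_moment \<mu> \<eta> (m - 1) (n - l))))"
    (is "_ \<le> (2 * \<tau>) powr \<eta> * ?c1 + _ * ?c2 + _ * ?c3")
proof -
  let ?Z = "\<lambda>\<omega>. Z_square (W \<omega>) (0, 0) (m, n) / Z_square (W \<omega>) (0, 0) (0, n)"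
  let ?B = "\<lambda>\<omega>. Z_square (W \<omega>) (1, 1) (m, n)"
  let ?R = "\<lambda>\<omega>. (\<Sum>k=1..K. hor_corner n k \<omega>) + (\<Sum>l=1..L. ver_corner n l \<omega>)"
  let ?T = "\<lambda>\<omega>. (\<Sum>k\<in>{K<..m}. hor m n k \<omega> / prodV n \<omega>) + (\<Sum>l\<in>{L<..n}. ver m n l \<omega> / prodV n \<omega>)"
  have mn: "1 \<le> m" "1 \<le> n" by (auto simp: m_def n_def)
  have xi: "0 \<le> \<eta>" "\<eta> < \<mu>" using assms theta by auto
  have aby: "0 < a" "0 < b" "0 < y" "0 < inv_gamma_moment \<theta> (- \<eta>)"
    using assms theta by (auto intro!: inv_gamma_moment_pos)
  have "AE \<omega> in P. ?Z \<omega> \<le> ?R \<omega> * ?B \<omega> + ?T \<omega> \<and> 0 < ?Z \<omega> \<and> 0 \<le> ?R \<omega> \<and> 0 < ?B \<omega>"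
    using AE_W_pos
  proof eventually_elim
    case (elim \<omega>)
    then have w: "0 < W \<omega> x" for x by blast
    have p: "0 < prodW A \<omega>" for A using w by (intro prod_pos) auto
    have s1: "{1..m} = {1..K} \<union> {K<..m}" "{1..n} = {1..L} \<union> {L<..n}" using assms by auto
    have "?Z \<omega> = (\<Sum>k=1..K. hor m n k \<omega> / prodV n \<omega>) + (\<Sum>l=1..L. ver m n l \<omega> / prodV n \<omega>) + ?T \<omega>"
      unfolding Z_ratio_eq[OF mn] s1
      by (subst (1 2) sum.union_disjoint) auto
    also have "\<dots> \<le> (\<Sum>k=1..K. hor_corner n k \<omega> * ?B \<omega>) + (\<Sum>l=1..L. ver_corner n l \<omega> * ?B \<omega>) + ?T \<omega>"
      using assms unfolding m_def n_def
      by (intro add_mono sum_mono hor_le_corner ver_le_corner w order_refl) auto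
    also have "\<dots> = ?R \<omega> * ?B \<omega> + ?T \<omega>" by (simp add: sum_distrib_right distrib_right)
    finally have "?Z \<omega> \<le> ?R \<omega> * ?B \<omega> + ?T \<omega>" .
    moreover have "0 < ?Z \<omega>" "0 < ?B \<omega>"
      using w mn by (auto intro!: divide_pos_pos Z_square_pos)
    moreover have "0 \<le> ?R \<omega>"
      unfolding hor_corner_def ver_corner_def
      by (intro add_nonneg_nonneg sum_nonneg divide_nonneg_pos mult_pos_pos less_imp_le[OF p] p) auto
    ultimately show ?case by blast
  qed
  then have "prob {\<omega> \<in> space P. ?B \<omega> < z} \<le> (2 * \<tau>) powr \<eta> * ?c1 + (\<tau> / z) powr (- \<eta>) * ?c2 + \<tau> powr (- \<eta>) * ?c3"
  proof (rule lower_tail_of_product[rotated 4])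
    show "(\<integral>\<^sup>+\<omega>. ennreal (?Z \<omega> powr (- \<eta>)) \<partial>P) \<le> ennreal ?c1"
      using burke_moment[of "- \<eta>" m n] assms(1,2) theta by simp
    let ?I = "{1..K} <+> {1..L}"
    let ?f = "\<lambda>i \<omega>. case i of Inl k \<Rightarrow> hor_corner n k \<omega> | Inr l \<Rightarrow> ver_corner n l \<omega>"
    let ?c = "\<lambda>i. case i of Inl k \<Rightarrow> a ^ k * y ^ (k - 1) * b ^ n | Inr l \<Rightarrow> b ^ (n - l) * y ^ (l - 1)"
    have "(\<integral>\<^sup>+\<omega>. ennreal ((\<Sum>i\<in>?I. ?f i \<omega>) powr \<eta>) \<partial>P) \<le> ennreal (real (card ?I) powr \<eta> * (\<Sum>i\<in>?I. ?c i))"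
    proof (rule nn_integral_sum_powr_le)
      show "AE \<omega> in P. \<forall>i\<in>?I. 0 \<le> ?f i \<omega>"
        using AE_W_pos
      proof eventually_elim
        case (elim \<omega>)
        then have p: "0 < prodW A \<omega>" for A by (intro prod_pos) auto
        show ?case unfolding hor_corner_def ver_corner_def
          by (auto split: sum.split intro!: divide_nonneg_pos mult_pos_pos mult_nonneg_nonneg less_imp_le[OF p] p)
      qed
      fix i assume i: "i \<in> ?I"
      show "(\<integral>\<^sup>+\<omega>. ennreal (?f i \<omega> powr \<eta>) \<partial>P) \<le> ennreal (?c i)"
        using i hor_corner_moment ver_corner_moment assms mn by (cases i) auto
      show "?f i \<in> borel_measurable P" by (cases i) auto
      show "0 \<le> ?c i" using aby by (cases i) auto
    qed (use xi in auto)
    then show "(\<integral>\<^sup>+\<omega>. ennreal (?R \<omega> powr \<eta>) \<partial>P) \<le> ennreal ?c2"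
      by (simp add: sum.Plus card_Plus)
    show "(\<integral>\<^sup>+\<omega>. ennreal (?T \<omega> powr \<eta>) \<partial>P) \<le> ennreal ?c3"
      using ratio_sum_moment[of \<eta> m n K L] assms mn by simp
    show "0 \<le> ?c1" using aby by simp
    show "0 \<le> ?c2" "0 \<le> ?c3" using aby
      by (auto intro!: mult_nonneg_nonneg add_nonneg_nonneg sum_nonneg simp: bulk_moment_nonneg[OF xi])
    show "0 < \<eta>" "0 < \<tau>" "0 < z" by fact+
    show "?Z \<in> borel_measurable P" "?B \<in> borel_measurable P" by measurable
    show "?R \<in> borel_measurable P" "?T \<in> borel_measurable P"
      by (intro borel_measurable_add borel_measurable_sum borel_measurable_divide; measurable)+
  qed
  then show ?thesis using prob_Z_bulk[of 1 1 i j z] by (simp add: m_def n_def)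
qed

end

section \<open>Exponential rates\<close>

text \<open>\<open>exp_rate_le X x\<close> and \<open>exp_rate_ge X x\<close> express that the exponential growth rate of \<open>X\<close> is at
  most (at least) \<open>x\<close>; they make sense for sequences that may vanish, unlike \<open>ln (X N) / N\<close>.\<close>

definition exp_rate_le :: "(nat \<Rightarrow> real) \<Rightarrow> real \<Rightarrow> bool" where
  "exp_rate_le X x \<longleftrightarrow> (\<forall>\<delta>>0. \<forall>\<^sub>F N in sequentially. X N \<le> exp (real N * (x + \<delta>)))"

definition exp_rate_ge :: "(nat \<Rightarrow> real) \<Rightarrow> real \<Rightarrow> bool" where
  "exp_rate_ge X x \<longleftrightarrow> (\<forall>\<delta>>0. \<forall>\<^sub>F N in sequentially. exp (real N * (x - \<delta>)) \<le> X N)"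

lemma exp_rate_leD: "exp_rate_le X x \<Longrightarrow> x < y \<Longrightarrow> \<forall>\<^sub>F N in sequentially. X N \<le> exp (real N * y)"
  unfolding exp_rate_le_def by (drule spec[of _ "y - x"]) auto

lemma exp_rate_geD: "exp_rate_ge X x \<Longrightarrow> y < x \<Longrightarrow> \<forall>\<^sub>F N in sequentially. exp (real N * y) \<le> X N"
  unfolding exp_rate_ge_def by (drule spec[of _ "x - y"]) auto

lemma exp_rate_le_mono:
  assumes "exp_rate_le X x" "\<forall>\<^sub>F N in sequentially. Y N \<le> X N" "x \<le> y"
  shows "exp_rate_le Y y"
  unfolding exp_rate_le_def
proof (intro allI impI)
  fix \<delta> :: real assume "\<delta> > 0"
  then show "\<forall>\<^sub>F N in sequentially. Y N \<le> exp (real N * (y + \<delta>))"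
    using exp_rate_leD[OF assms(1), of "y + \<delta>"] assms(2,3) by (auto elim: eventually_elim2)
qed

lemma exp_rate_ge_mono:
  assumes "exp_rate_ge X x" "\<forall>\<^sub>F N in sequentially. X N \<le> Y N" "y \<le> x"
  shows "exp_rate_ge Y y"
  unfolding exp_rate_ge_def
proof (intro allI impI)
  fix \<delta> :: real assume "\<delta> > 0"
  then show "\<forall>\<^sub>F N in sequentially. exp (real N * (y - \<delta>)) \<le> Y N"
    using exp_rate_geD[OF assms(1), of "y - \<delta>"] assms(2,3) by (auto elim: eventually_elim2)
qed

lemma exp_rate_ge_limit:
  assumes "\<And>\<delta>. \<delta> > 0 \<Longrightarrow> exp_rate_ge X (x - \<delta>)"
  shows "exp_rate_ge X x"
  unfolding exp_rate_ge_def
proof (intro allI impI)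
  fix \<delta> :: real assume "\<delta> > 0"
  then show "\<forall>\<^sub>F N in sequentially. exp (real N * (x - \<delta>)) \<le> X N"
    using exp_rate_geD[OF assms[of "\<delta> / 2"], of "x - \<delta>"] by auto
qed

lemma exp_rate_le_add:
  assumes "exp_rate_le X x" "exp_rate_le Y x"
  shows "exp_rate_le (\<lambda>N. X N + Y N) x"
  unfolding exp_rate_le_def
proof (intro allI impI)
  fix \<delta> :: real assume d: "\<delta> > 0"
  have "\<forall>\<^sub>F N in sequentially. 2 \<le> exp (real N * (\<delta> / 2))" using d by real_asymp
  moreover have "\<forall>\<^sub>F N in sequentially. X N \<le> exp (real N * (x + \<delta> / 2))"
    "\<forall>\<^sub>F N in sequentially. Y N \<le> exp (real N * (x + \<delta> / 2))"
    using exp_rate_leD[OF assms(1), of "x + \<delta> / 2"] exp_rate_leD[OF assms(2), of "x + \<delta> / 2"] d by auto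
  ultimately show "\<forall>\<^sub>F N in sequentially. X N + Y N \<le> exp (real N * (x + \<delta>))"
  proof eventually_elim
    case (elim N)
    have "X N + Y N \<le> 2 * exp (real N * (x + \<delta> / 2))" using elim by simp
    also have "\<dots> \<le> exp (real N * (\<delta> / 2)) * exp (real N * (x + \<delta> / 2))" using elim by (intro mult_right_mono) auto
    also have "\<dots> = exp (real N * (x + \<delta>))" by (simp add: exp_add[symmetric] algebra_simps)
    finally show ?case .
  qed
qed

lemma exp_rate_le_mult:
  assumes "exp_rate_le X x" "exp_rate_le Y y" "\<And>N. 0 \<le> Y N"
  shows "exp_rate_le (\<lambda>N. X N * Y N) (x + y)"
  unfolding exp_rate_le_def
proof (intro allI impI)
  fix \<delta> :: real assume d: "\<delta> > 0"
  then have "\<forall>\<^sub>F N in sequentially. X N \<le> exp (real N * (x + \<delta> / 2))"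
    "\<forall>\<^sub>F N in sequentially. Y N \<le> exp (real N * (y + \<delta> / 2))"
    using exp_rate_leD[OF assms(1), of "x + \<delta> / 2"] exp_rate_leD[OF assms(2), of "y + \<delta> / 2"] by auto
  then show "\<forall>\<^sub>F N in sequentially. X N * Y N \<le> exp (real N * (x + y + \<delta>))"
  proof eventually_elim
    case (elim N)
    have "X N * Y N \<le> exp (real N * (x + \<delta> / 2)) * exp (real N * (y + \<delta> / 2))"
      using elim assms(3) by (intro mult_mono) auto
    also have "\<dots> = exp (real N * (x + y + \<delta>))" by (simp add: exp_add[symmetric] algebra_simps)
    finally show ?case .
  qed
qed

lemma exp_rate_ge_mult:
  assumes "exp_rate_ge X x" "exp_rate_ge Y y"
  shows "exp_rate_ge (\<lambda>N. X N * Y N) (x + y)"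
  unfolding exp_rate_ge_def
proof (intro allI impI)
  fix \<delta> :: real assume d: "\<delta> > 0"
  then have "\<forall>\<^sub>F N in sequentially. exp (real N * (x - \<delta> / 2)) \<le> X N"
    "\<forall>\<^sub>F N in sequentially. exp (real N * (y - \<delta> / 2)) \<le> Y N"
    using exp_rate_geD[OF assms(1), of "x - \<delta> / 2"] exp_rate_geD[OF assms(2), of "y - \<delta> / 2"] by auto
  then show "\<forall>\<^sub>F N in sequentially. exp (real N * (x + y - \<delta>)) \<le> X N * Y N"
  proof eventually_elim
    case (elim N)
    have "exp (real N * (x + y - \<delta>)) = exp (real N * (x - \<delta> / 2)) * exp (real N * (y - \<delta> / 2))"
      by (simp add: exp_add[symmetric] algebra_simps)
    also have "\<dots> \<le> X N * Y N"
      using elim by (intro mult_mono) (auto intro: order_trans[OF exp_ge_zero])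
    finally show ?case .
  qed
qed

lemma exp_rate_le_exp:
  assumes "(\<lambda>N. e N / real N) \<longlonglongrightarrow> x"
  shows "exp_rate_le (\<lambda>N. exp (e N)) x"
  unfolding exp_rate_le_def
proof (intro allI impI)
  fix \<delta> :: real assume "\<delta> > 0"
  then have "\<forall>\<^sub>F N in sequentially. e N / real N < x + \<delta>" by (intro order_tendstoD[OF assms]) simp
  then show "\<forall>\<^sub>F N in sequentially. exp (e N) \<le> exp (real N * (x + \<delta>))"
    using eventually_gt_at_top[of 0] by eventually_elim (simp add: divide_simps mult.commute)
qed

lemma exp_rate_ge_exp:
  assumes "(\<lambda>N. e N / real N) \<longlonglongrightarrow> x"
  shows "exp_rate_ge (\<lambda>N. exp (e N)) x"
  unfolding exp_rate_ge_def
proof (intro allI impI)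
  fix \<delta> :: real assume "\<delta> > 0"
  then have "\<forall>\<^sub>F N in sequentially. x - \<delta> < e N / real N" by (intro order_tendstoD[OF assms]) simp
  then show "\<forall>\<^sub>F N in sequentially. exp (real N * (x - \<delta>)) \<le> exp (e N)"
    using eventually_gt_at_top[of 0] by eventually_elim (simp add: divide_simps mult.commute)
qed

lemma power_eq_exp: "0 < a \<Longrightarrow> a ^ k = exp (real k * ln a)" for a :: real
  by (simp add: exp_of_nat_mult)

lemma exp_rate_le_power:
  assumes "0 < a" "(\<lambda>N. real (m N) / real N) \<longlonglongrightarrow> s"
  shows "exp_rate_le (\<lambda>N. a ^ m N) (s * ln a)"
  unfolding power_eq_exp[OF assms(1)]
  by (rule exp_rate_le_exp) (use tendsto_mult_right[OF assms(2), of "ln a"] in simp)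

lemma exp_rate_ge_power:
  assumes "0 < a" "(\<lambda>N. real (m N) / real N) \<longlonglongrightarrow> s"
  shows "exp_rate_ge (\<lambda>N. a ^ m N) (s * ln a)"
  unfolding power_eq_exp[OF assms(1)]
  by (rule exp_rate_ge_exp) (use tendsto_mult_right[OF assms(2), of "ln a"] in simp)

lemma exp_rate_le_const: "exp_rate_le (\<lambda>N. C) 0"
  unfolding exp_rate_le_def
proof (intro allI impI)
  fix \<delta> :: real assume "\<delta> > 0"
  then show "\<forall>\<^sub>F N in sequentially. C \<le> exp (real N * (0 + \<delta>))" by real_asymp
qed

lemma exp_rate_le_poly:
  assumes "(\<lambda>N. real (m N) / real N) \<longlonglongrightarrow> s" "0 \<le> \<xi>"
  shows "exp_rate_le (\<lambda>N. real (m N) powr \<xi>) 0"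
proof -
  have 1: "exp_rate_le (\<lambda>N. real N powr \<xi>) 0"
    unfolding exp_rate_le_def
  proof (intro allI impI)
    fix \<delta> :: real assume "\<delta> > 0"
    then show "\<forall>\<^sub>F N in sequentially. real N powr \<xi> \<le> exp (real N * (0 + \<delta>))" by real_asymp
  qed
  have "exp_rate_le (\<lambda>N. ((\<bar>s\<bar> + 1) powr \<xi>) * real N powr \<xi>) (0 + 0)"
    by (rule exp_rate_le_mult[OF exp_rate_le_const 1]) simp
  moreover have "\<forall>\<^sub>F N in sequentially. real (m N) powr \<xi> \<le> ((\<bar>s\<bar> + 1) powr \<xi>) * real N powr \<xi>"
  proof -
    have "\<forall>\<^sub>F N in sequentially. real (m N) / real N < \<bar>s\<bar> + 1" by (intro order_tendstoD[OF assms(1)]) simp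
    then show ?thesis using eventually_gt_at_top[of 0]
    proof eventually_elim
      case (elim N)
      then have "real (m N) \<le> (\<bar>s\<bar> + 1) * real N" by (simp add: divide_simps)
      then have "real (m N) powr \<xi> \<le> ((\<bar>s\<bar> + 1) * real N) powr \<xi>" using assms by (intro powr_mono2) auto
      then show ?case by (simp add: powr_mult)
    qed
  qed
  ultimately show ?thesis by (rule exp_rate_le_mono) simp
qed

lemma exp_rate_le_poly1:
  assumes "(\<lambda>N. real (m N) / real N) \<longlonglongrightarrow> s"
  shows "exp_rate_le (\<lambda>N. real (m N)) 0"
proof -
  have "exp_rate_le (\<lambda>N. real (m N) powr 1) 0" by (rule exp_rate_le_poly[OF assms]) simp
  then show ?thesis by simp
qed

text \<open>If D has a smaller rate than A, then at least half of A is left for B q, and q can be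
  solved for.\<close>

lemma exp_rate_ge_solve:
  assumes A: "exp_rate_ge A \<alpha>" and B: "exp_rate_le B \<beta>" and D: "exp_rate_le D \<gamma>" and "\<gamma> < \<alpha>"
    and q: "\<And>N. 0 \<le> q N" and ineq: "\<forall>\<^sub>F N in sequentially. A N \<le> B N * q N + D N"
  shows "exp_rate_ge q (\<alpha> - \<beta>)"
  unfolding exp_rate_ge_def
proof (intro allI impI)
  fix \<delta> :: real assume d: "\<delta> > 0"
  \<comment> \<open>Three margins e are spent twice: once against the gap between \<gamma> and
    \<alpha>, once against \<delta>.\<close>
  define e where "e = min (\<delta> / 4) ((\<alpha> - \<gamma>) / 4)"
  have e: "0 < e" "e \<le> \<delta> / 4" "e \<le> (\<alpha> - \<gamma>) / 4"
    using d assms(4) unfolding e_def by (simp, linarith, linarith)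
  have "\<forall>\<^sub>F N in sequentially. exp (real N * (\<alpha> - e)) \<le> A N"
    "\<forall>\<^sub>F N in sequentially. B N \<le> exp (real N * (\<beta> + e))"
    "\<forall>\<^sub>F N in sequentially. D N \<le> exp (real N * (\<gamma> + e))"
    "\<forall>\<^sub>F N in sequentially. 2 \<le> exp (real N * e)"
    subgoal using e by (intro exp_rate_geD[OF A]) auto
    subgoal using e by (intro exp_rate_leD[OF B]) auto
    subgoal using e by (intro exp_rate_leD[OF D]) auto
    subgoal using e(1) by real_asymp
    done
  then show "\<forall>\<^sub>F N in sequentially. exp (real N * (\<alpha> - \<beta> - \<delta>)) \<le> q N"
    using ineq
  proof eventually_elim
    case (elim N)
    let ?n = "real N"
    have "2 * D N \<le> exp (?n * e) * exp (?n * (\<gamma> + e))"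
    proof -
      have "2 * D N \<le> 2 * exp (?n * (\<gamma> + e))" using elim by simp
      also have "\<dots> \<le> exp (?n * e) * exp (?n * (\<gamma> + e))" using elim by (intro mult_right_mono) auto
      finally show ?thesis .
    qed
    also have "\<dots> = exp (?n * (\<gamma> + 2 * e))" by (simp add: exp_add[symmetric] algebra_simps)
    also have "\<dots> \<le> exp (?n * (\<alpha> - e))" using e by (intro exp_mono mult_left_mono) auto
    finally have "2 * D N \<le> exp (?n * (\<alpha> - e))" .
    then have "exp (?n * (\<alpha> - e)) \<le> 2 * (B N * q N)" using elim by linarith
    also have "\<dots> \<le> 2 * (exp (?n * (\<beta> + e)) * q N)" using elim q by (intro mult_left_mono mult_right_mono) auto
    also have "\<dots> \<le> exp (?n * e) * (exp (?n * (\<beta> + e)) * q N)" using elim q by (intro mult_right_mono) auto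
    also have "\<dots> = exp (?n * (\<beta> + 2 * e)) * q N" by (simp add: exp_add[symmetric] algebra_simps)
    finally have "exp (?n * (\<alpha> - e)) / exp (?n * (\<beta> + 2 * e)) \<le> q N" by (simp add: divide_simps mult.commute)
    moreover have "exp (?n * (\<alpha> - \<beta> - \<delta>)) \<le> exp (?n * (\<alpha> - e) - ?n * (\<beta> + 2 * e))"
    proof -
      have "?n * (\<alpha> - \<beta> - \<delta>) \<le> ?n * (\<alpha> - \<beta> - 3 * e)" using e by (intro mult_left_mono) auto
      then show ?thesis by (simp add: algebra_simps)
    qed
    ultimately show ?case by (simp add: exp_diff)
  qed
qed

lemma exp_rate_tendsto:
  assumes "exp_rate_le X x" "exp_rate_ge X x"
  shows "(\<lambda>N. ln (X N) / real N) \<longlonglongrightarrow> x"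
proof (rule tendstoI)
  fix \<delta> :: real assume "\<delta> > 0"
  then have "\<forall>\<^sub>F N in sequentially. X N \<le> exp (real N * (x + \<delta> / 2))"
    "\<forall>\<^sub>F N in sequentially. exp (real N * (x - \<delta> / 2)) \<le> X N"
    by (auto intro!: exp_rate_leD[OF assms(1)] exp_rate_geD[OF assms(2)])
  then show "\<forall>\<^sub>F N in sequentially. dist (ln (X N) / real N) x < \<delta>"
    using eventually_gt_at_top[of 0]
  proof eventually_elim
    case (elim N)
    then have X: "X N > 0" using order_less_le_trans[OF exp_gt_zero] by blast
    then have "ln (X N) \<le> ln (exp (real N * (x + \<delta> / 2)))" using elim by (subst ln_le_cancel_iff) auto
    moreover have "ln (exp (real N * (x - \<delta> / 2))) \<le> ln (X N)" using elim X by (subst ln_le_cancel_iff) auto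
    ultimately have "ln (X N) / real N \<le> x + \<delta> / 2" "x - \<delta> / 2 \<le> ln (X N) / real N"
      using elim by (simp_all add: pos_divide_le_eq pos_le_divide_eq mult.commute)
    then have "\<bar>ln (X N) / real N - x\<bar> \<le> \<delta> / 2" by linarith
    then show ?case using \<open>\<delta> > 0\<close> by (simp add: dist_real_def)
  qed
qed

text \<open>Comparison with a geometric series; this is the form in which tail bounds enter
  Borel-Cantelli.\<close>

lemma exp_rate_le_summable:
  assumes "exp_rate_le X x" "x < 0" "\<And>N. 0 \<le> X N"
  shows "summable X"
proof -
  have "summable (\<lambda>N. exp (x / 2) ^ N)" using assms by (intro summable_geometric) simp
  moreover have "\<forall>\<^sub>F N in sequentially. norm (X N) \<le> exp (x / 2) ^ N"
    using exp_rate_leD[OF assms(1), of "x / 2"] assms(2,3) by (simp add: exp_of_nat_mult[symmetric])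
  ultimately show ?thesis by (rule summable_comparison_test_ev[rotated])
qed

section \<open>Terms far from the corner\<close>

text \<open>\<open>lm_hor \<xi> \<theta>\<close> is $M_\theta(\xi)$ and \<open>lm_ver \<mu> \<xi> \<theta>\<close> is $M_{\mu-\theta}(-\xi)$.\<close>

definition lm_hor :: "real \<Rightarrow> real \<Rightarrow> real" where
  "lm_hor \<xi> \<theta> = ln (inv_gamma_moment \<theta> \<xi>)"

definition lm_ver :: "real \<Rightarrow> real \<Rightarrow> real \<Rightarrow> real" where
  "lm_ver \<mu> \<xi> \<theta> = ln (inv_gamma_moment (\<mu> - \<theta>) (- \<xi>))"

lemma ln_inv_gamma_moment:
  "0 < \<nu> \<Longrightarrow> \<xi> < \<nu> \<Longrightarrow> ln (inv_gamma_moment \<nu> \<xi>) = ln_Gamma (\<nu> - \<xi>) - ln_Gamma \<nu>"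
proof -
  assume "0 < \<nu>" "\<xi> < \<nu>"
  then have p: "0 < Gamma (\<nu> - \<xi>)" "0 < Gamma \<nu>" by (auto intro: Gamma_real_pos)
  have "ln (Gamma (\<nu> - \<xi>) / Gamma \<nu>) = ln (Gamma (\<nu> - \<xi>)) - ln (Gamma \<nu>)"
    using ln_divide_pos[OF p] .
  then show ?thesis
    using \<open>0 < \<nu>\<close> \<open>\<xi> < \<nu>\<close> by (simp add: inv_gamma_moment_def ln_Gamma_real_pos)
qed

lemma DERIV_lm_hor:
  assumes "0 \<le> \<xi>" "\<xi> < \<theta>"
  shows "(lm_hor \<xi> has_real_derivative Digamma (\<theta> - \<xi>) - Digamma \<theta>) (at \<theta>)"
proof (rule has_field_derivative_transform_within_open[where S="{\<xi><..}"])
  show "((\<lambda>x. ln_Gamma (x - \<xi>) - ln_Gamma x) has_real_derivative Digamma (\<theta> - \<xi>) - Digamma \<theta>) (at \<theta>)"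
    using assms by (auto intro!: derivative_eq_intros)
qed (use assms in \<open>auto simp: lm_hor_def ln_inv_gamma_moment\<close>)

lemma DERIV_lm_ver:
  assumes "0 \<le> \<xi>" "\<theta> < \<mu>"
  shows "(lm_ver \<mu> \<xi> has_real_derivative Digamma (\<mu> - \<theta>) - Digamma (\<mu> - \<theta> + \<xi>)) (at \<theta>)"
proof (rule has_field_derivative_transform_within_open[where S="{..<\<mu>}"])
  show "((\<lambda>x. ln_Gamma (\<mu> - x + \<xi>) - ln_Gamma (\<mu> - x)) has_real_derivative
      Digamma (\<mu> - \<theta>) - Digamma (\<mu> - \<theta> + \<xi>)) (at \<theta>)"
    using assms by (auto intro!: derivative_eq_intros)
qed (use assms in \<open>auto simp: lm_ver_def ln_inv_gamma_moment\<close>)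

lemma lm_hor_antimono:
  assumes "0 \<le> \<xi>" "\<xi> < \<theta>1" "\<theta>1 \<le> \<theta>"
  shows "lm_hor \<xi> \<theta> \<le> lm_hor \<xi> \<theta>1"
proof (rule DERIV_nonpos_imp_nonincreasing[OF assms(3)])
  fix x assume "\<theta>1 \<le> x" "x \<le> \<theta>"
  then show "\<exists>y. (lm_hor \<xi> has_real_derivative y) (at x) \<and> y \<le> 0"
    using assms by (intro exI[of _ "Digamma (x - \<xi>) - Digamma x"] conjI DERIV_lm_hor)
      (auto intro: Digamma_real_mono)
qed

lemma lm_ver_antimono:
  assumes "0 \<le> \<xi>" "\<theta>2 < \<mu>" "\<theta> \<le> \<theta>2"
  shows "lm_ver \<mu> \<xi> \<theta>2 \<le> lm_ver \<mu> \<xi> \<theta>"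
proof (rule DERIV_nonpos_imp_nonincreasing[OF assms(3)])
  fix x assume "\<theta> \<le> x" "x \<le> \<theta>2"
  then show "\<exists>y. (lm_ver \<mu> \<xi> has_real_derivative y) (at x) \<and> y \<le> 0"
    using assms by (intro exI[of _ "Digamma (\<mu> - x) - Digamma (\<mu> - x + \<xi>)"] conjI DERIV_lm_ver)
      (auto intro: Digamma_real_mono)
qed

lemma power_inv_gamma_moment_hor:
  "0 < \<theta> \<Longrightarrow> \<xi> < \<theta> \<Longrightarrow> inv_gamma_moment \<theta> \<xi> ^ k = exp (real k * lm_hor \<xi> \<theta>)"
  unfolding lm_hor_def by (rule power_eq_exp) (rule inv_gamma_moment_pos)

lemma power_inv_gamma_moment_ver:
  "\<theta> < \<mu> \<Longrightarrow> 0 \<le> \<xi> \<Longrightarrow> inv_gamma_moment (\<mu> - \<theta>) (- \<xi>) ^ k = exp (real k * lm_ver \<mu> \<xi> \<theta>)"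
  unfolding lm_ver_def by (rule power_eq_exp) (rule inv_gamma_moment_pos; simp)

lemma bulk_moment_le_exp:
  assumes "0 \<le> \<xi>" "\<xi> < \<theta>" "\<theta> < \<mu>"
  shows "bulk_moment \<mu> \<xi> i j \<le> exp (real i * lm_hor \<xi> \<theta> - real (Suc j) * lm_ver \<mu> \<xi> \<theta>)"
proof -
  have "bulk_moment \<mu> \<xi> i j \<le> inv_gamma_moment \<theta> \<xi> ^ i / inv_gamma_moment (\<mu> - \<theta>) (- \<xi>) ^ Suc j"
    using assms by (intro bulk_moment_bound) auto
  also have "\<dots> = exp (real i * lm_hor \<xi> \<theta> - real (Suc j) * lm_ver \<mu> \<xi> \<theta>)"
    using assms
    by (simp add: power_inv_gamma_moment_hor[of \<theta> \<xi>] power_inv_gamma_moment_ver[of \<theta> \<mu> \<xi>] exp_diff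
        del: power_Suc of_nat_Suc)
  finally show ?thesis .
qed

text \<open>Since \<open>s G' = t H'\<close> at \<open>\<theta>\<close>, moving the parameter slightly to the left (right) strictly decreases
  the exponent of those terms which leave the horizontal (vertical) axis at distance at least \<open>\<epsilon>\<close>.\<close>

lemma exit_separation:
  fixes G H :: "real \<Rightarrow> real"
  assumes G: "(G has_real_derivative G') (at \<theta>)" "G' < 0"
    and H: "(H has_real_derivative H') (at \<theta>)" "H' < 0"
    and crit: "s * G' = t * H'" and "0 < \<epsilon>" "0 < r"
  shows "\<exists>\<theta>1. \<theta> - r < \<theta>1 \<and> \<theta>1 < \<theta> \<and> \<epsilon> * G \<theta> + (s - \<epsilon>) * G \<theta>1 + t * (H \<theta> - H \<theta>1) < s * G \<theta>"
    and "\<exists>\<theta>2. \<theta> < \<theta>2 \<and> \<theta>2 < \<theta> + r \<and> (t - \<epsilon>) * (H \<theta> - H \<theta>2) + s * G \<theta>2 < s * G \<theta>"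
proof -
  let ?f = "\<lambda>x. \<epsilon> * G \<theta> + (s - \<epsilon>) * G x + t * (H \<theta> - H x)"
  have "(?f has_real_derivative (s - \<epsilon>) * G' - t * H') (at \<theta>)"
    by (auto intro!: derivative_eq_intros G H)
  \<comment> \<open>By the stationarity of \<theta> the derivative equals - \<epsilon> G', and it is
    this excess that the macroscopic distance \<epsilon> provides.\<close>
  moreover have "0 < (s - \<epsilon>) * G' - t * H'"
    using crit mult_pos_neg[of \<epsilon> G'] assms by (simp add: left_diff_distrib)
  ultimately obtain d where d: "d > 0" "\<forall>h>0. h < d \<longrightarrow> ?f (\<theta> - h) < ?f \<theta>"
    using DERIV_pos_inc_left by blast
  have "?f (\<theta> - min d r / 2) < ?f \<theta>" using d assms by auto
  moreover have "?f \<theta> = s * G \<theta>" by (simp add: algebra_simps)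
  ultimately show "\<exists>\<theta>1. \<theta> - r < \<theta>1 \<and> \<theta>1 < \<theta> \<and> \<epsilon> * G \<theta> + (s - \<epsilon>) * G \<theta>1 + t * (H \<theta> - H \<theta>1) < s * G \<theta>"
    using d assms by (intro exI[of _ "\<theta> - min d r / 2"]) auto
  let ?k = "\<lambda>x. (t - \<epsilon>) * (H \<theta> - H x) + s * G x"
  have "(?k has_real_derivative s * G' - (t - \<epsilon>) * H') (at \<theta>)"
    by (auto intro!: derivative_eq_intros G H)
  moreover have "s * G' - (t - \<epsilon>) * H' < 0"
    using crit mult_pos_neg[of \<epsilon> H'] assms by (simp add: left_diff_distrib)
  ultimately obtain e where e: "e > 0" "\<forall>h>0. h < e \<longrightarrow> ?k (\<theta> + h) < ?k \<theta>"
    using DERIV_neg_dec_right by blast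
  have "?k (\<theta> + min e r / 2) < ?k \<theta>" using e assms by auto
  then show "\<exists>\<theta>2. \<theta> < \<theta>2 \<and> \<theta>2 < \<theta> + r \<and> (t - \<epsilon>) * (H \<theta> - H \<theta>2) + s * G \<theta>2 < s * G \<theta>"
    using e assms by (intro exI[of _ "\<theta> + min e r / 2"]) auto
qed

section \<open>Integer sequences with a linear growth rate\<close>

lemma scaled_floor_tendsto: "0 \<le> s \<Longrightarrow> (\<lambda>N. real (nat \<lfloor>real N * s\<rfloor>) / real N) \<longlonglongrightarrow> s"
proof -
  assume s: "0 \<le> s"
  have "\<forall>\<^sub>F N in sequentially. norm (real (nat \<lfloor>real N * s\<rfloor>) / real N - s) \<le> 1 / real N"
    using eventually_gt_at_top[of 0]
  proof eventually_elim
    case (elim N)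
    have "0 \<le> \<lfloor>real N * s\<rfloor>" using s by simp
    then have "real (nat \<lfloor>real N * s\<rfloor>) = of_int \<lfloor>real N * s\<rfloor>" by simp
    moreover have "of_int \<lfloor>real N * s\<rfloor> \<le> real N * s" "real N * s \<le> of_int \<lfloor>real N * s\<rfloor> + 1" by linarith+
    ultimately have "\<bar>real (nat \<lfloor>real N * s\<rfloor>) - real N * s\<bar> \<le> 1" by linarith
    moreover have "real (nat \<lfloor>real N * s\<rfloor>) / real N - s = (real (nat \<lfloor>real N * s\<rfloor>) - real N * s) / real N"
      using elim by (simp add: divide_simps)
    ultimately show ?case using elim by (simp add: divide_right_mono)
  qed
  moreover have "(\<lambda>N. 1 / real N) \<longlonglongrightarrow> 0" by real_asymp
  ultimately have "(\<lambda>N. real (nat \<lfloor>real N * s\<rfloor>) / real N - s) \<longlonglongrightarrow> 0"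
    by (rule Lim_null_comparison)
  then show ?thesis by (simp add: LIM_zero_iff)
qed

lemma ratio_Suc_tendsto:
  "(\<lambda>N. real (m N) / real N) \<longlonglongrightarrow> s \<Longrightarrow> (\<lambda>N. real (Suc (m N)) / real N) \<longlonglongrightarrow> s"
proof -
  assume "(\<lambda>N. real (m N) / real N) \<longlonglongrightarrow> s"
  moreover have "(\<lambda>N. 1 / real N) \<longlonglongrightarrow> 0" by real_asymp
  ultimately have "(\<lambda>N. real (m N) / real N + 1 / real N) \<longlonglongrightarrow> s + 0" by (rule tendsto_add)
  then show ?thesis by (simp add: add_divide_distrib add.commute)
qed

lemma ratio_add_tendsto:
  "(\<lambda>N. real (m N) / real N) \<longlonglongrightarrow> s \<Longrightarrow> (\<lambda>N. real (n N) / real N) \<longlonglongrightarrow> t \<Longrightarrow>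
    (\<lambda>N. real (m N + n N) / real N) \<longlonglongrightarrow> s + t"
  using tendsto_add[of "\<lambda>N. real (m N) / real N" s sequentially "\<lambda>N. real (n N) / real N" t]
  by (simp add: add_divide_distrib)

lemma eventually_ratio_less:
  assumes "(\<lambda>N. real (k N) / real N) \<longlonglongrightarrow> a" "(\<lambda>N. real (m N) / real N) \<longlonglongrightarrow> s" "a < s"
  shows "\<forall>\<^sub>F N in sequentially. k N < m N"
proof -
  have "\<forall>\<^sub>F N in sequentially. real (k N) / real N < (a + s) / 2"
    "\<forall>\<^sub>F N in sequentially. (a + s) / 2 < real (m N) / real N"
    using assms by (intro order_tendstoD(2)[OF assms(1)] order_tendstoD(1)[OF assms(2)]; simp)+
  then show ?thesis using eventually_gt_at_top[of 0]
  proof eventually_elim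
    case (elim N)
    then have "real (k N) / real N < real (m N) / real N" by linarith
    then show ?case using elim by (simp add: divide_less_cancel)
  qed
qed

lemma ratio_diff_tendsto:
  assumes m: "(\<lambda>N. real (m N) / real N) \<longlonglongrightarrow> s" and k: "(\<lambda>N. real (k N) / real N) \<longlonglongrightarrow> a" and "a < s"
  shows "(\<lambda>N. real (m N - k N) / real N) \<longlonglongrightarrow> s - a"
proof (rule Lim_transform_eventually[OF tendsto_diff[OF m k]])
  show "\<forall>\<^sub>F N in sequentially. real (m N) / real N - real (k N) / real N = real (m N - k N) / real N"
    using eventually_ratio_less[OF k m assms(3)] by eventually_elim (simp add: of_nat_diff diff_divide_distrib)
qed

text \<open>The right-hand side of \<open>ratio_sum_moment\<close> without its polynomial
  factor.\<close>

definition far_sum :: "real \<Rightarrow> real \<Rightarrow> real \<Rightarrow> nat \<Rightarrow> nat \<Rightarrow> nat \<Rightarrow> nat \<Rightarrow> real" where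
  "far_sum \<mu> \<xi> \<theta> K L m n =
    (\<Sum>k\<in>{K<..m}. inv_gamma_moment \<theta> \<xi> ^ k * inv_gamma_moment (\<mu> - \<theta>) (- \<xi>) ^ n * bulk_moment \<mu> \<xi> (m - k) (n - 1)) +
    (\<Sum>l\<in>{L<..n}. inv_gamma_moment (\<mu> - \<theta>) (- \<xi>) ^ (n - l) * bulk_moment \<mu> \<xi> (m - 1) (n - l))"

lemma far_sum_nonneg: "0 \<le> \<xi> \<Longrightarrow> \<xi> < \<theta> \<Longrightarrow> \<theta> < \<mu> \<Longrightarrow> 0 \<le> far_sum \<mu> \<xi> \<theta> K L m n"
  unfolding far_sum_def using inv_gamma_moment_pos[of \<theta> \<xi>] inv_gamma_moment_pos[of "\<mu> - \<theta>" "- \<xi>"]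
  by (intro add_nonneg_nonneg sum_nonneg mult_nonneg_nonneg zero_le_power bulk_moment_nonneg) auto

text \<open>The bulk moments of horizontal exits are bounded with \<theta>1 and those of vertical
  exits with \<theta>2. Since g and h decrease, the resulting exponents are monotone in the exit
  point, so that each is largest at the cut-off K or L; the number of terms gives the factors in
  front.\<close>

lemma far_sum_le:
  assumes xi: "0 \<le> \<xi>" "\<xi> < \<theta>1" and th: "\<theta>1 \<le> \<theta>" "\<theta> \<le> \<theta>2" "\<theta>2 < \<mu>"
  defines "g \<equiv> lm_hor \<xi>" and "h \<equiv> lm_ver \<mu> \<xi>"
  shows "far_sum \<mu> \<xi> \<theta> K L (Suc i) (Suc j) \<le>
    real (Suc i) * exp (real K * g \<theta> + (real (Suc i) - real K) * g \<theta>1 + real (Suc j) * (h \<theta> - h \<theta>1)) +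
    real (Suc j) * exp ((real (Suc j) - real L) * (h \<theta> - h \<theta>2) + real i * g \<theta>2 - h \<theta>2)"
proof -
  let ?a = "inv_gamma_moment \<theta> \<xi>" and ?b = "inv_gamma_moment (\<mu> - \<theta>) (- \<xi>)"
    and ?q = "bulk_moment \<mu> \<xi>" and ?X = "exp (real K * g \<theta> + (real (Suc i) - real K) * g \<theta>1 + real (Suc j) * (h \<theta> - h \<theta>1))"
    and ?Y = "exp ((real (Suc j) - real L) * (h \<theta> - h \<theta>2) + real i * g \<theta>2 - h \<theta>2)"
  have gm: "g \<theta> \<le> g \<theta>1" and hm: "h \<theta>2 \<le> h \<theta>"
    using assms by (auto simp: g_def h_def intro: lm_hor_antimono lm_ver_antimono)
  note pw = power_inv_gamma_moment_hor[of \<theta> \<xi>, folded g_def] power_inv_gamma_moment_ver[of \<theta> \<mu> \<xi>, folded h_def]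
  have "(\<Sum>k\<in>{K<..Suc i}. ?a ^ k * ?b ^ Suc j * ?q (Suc i - k) (Suc j - 1))
     \<le> real (card {K<..Suc i}) * ?X"
  proof (rule sum_bounded_above)
    fix k assume k: "k \<in> {K<..Suc i}"
    have "?a ^ k * ?b ^ Suc j * ?q (Suc i - k) (Suc j - 1)
      \<le> exp (real k * g \<theta>) * exp (real (Suc j) * h \<theta>) * exp (real (Suc i - k) * g \<theta>1 - real (Suc j) * h \<theta>1)"
      using assms bulk_moment_le_exp[of \<xi> \<theta>1 \<mu> "Suc i - k" j] by (simp add: pw mult_left_mono del: power_Suc of_nat_Suc)
    also have "\<dots> = exp (real k * g \<theta> + real (Suc i - k) * g \<theta>1 + real (Suc j) * (h \<theta> - h \<theta>1))"
      by (simp add: exp_add[symmetric] algebra_simps)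
    also have "\<dots> \<le> ?X"
    proof -
      have "(real k - real K) * g \<theta> \<le> (real k - real K) * g \<theta>1" using k gm by (intro mult_left_mono) auto
      moreover have "real (Suc i - k) = real (Suc i) - real k" using k by (simp add: of_nat_diff)
      ultimately show ?thesis by (simp only: exp_le_cancel_iff) (simp add: algebra_simps)
    qed
    finally show "?a ^ k * ?b ^ Suc j * ?q (Suc i - k) (Suc j - 1)
      \<le> ?X" .
  qed
  also have "\<dots> \<le> real (Suc i) * ?X"
    by (intro mult_right_mono) auto
  finally have hor: "(\<Sum>k\<in>{K<..Suc i}. ?a ^ k * ?b ^ Suc j * ?q (Suc i - k) (Suc j - 1))
     \<le> real (Suc i) * ?X" .
  have "(\<Sum>l\<in>{L<..Suc j}. ?b ^ (Suc j - l) * ?q (Suc i - 1) (Suc j - l))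
     \<le> real (card {L<..Suc j}) * ?Y"
  proof (rule sum_bounded_above)
    fix l assume l: "l \<in> {L<..Suc j}"
    have "?b ^ (Suc j - l) * ?q (Suc i - 1) (Suc j - l)
      \<le> exp (real (Suc j - l) * h \<theta>) * exp (real i * g \<theta>2 - real (Suc (Suc j - l)) * h \<theta>2)"
      using assms bulk_moment_le_exp[of \<xi> \<theta>2 \<mu> i "Suc j - l"] by (simp add: pw mult_left_mono del: power_Suc of_nat_Suc)
    also have "\<dots> = exp (real (Suc j - l) * (h \<theta> - h \<theta>2) + real i * g \<theta>2 - h \<theta>2)"
      by (simp add: exp_add[symmetric] algebra_simps)
    also have "\<dots> \<le> ?Y"
    proof -
      have "real (Suc j - l) * (h \<theta> - h \<theta>2) \<le> (real (Suc j) - real L) * (h \<theta> - h \<theta>2)"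
        using l hm by (intro mult_right_mono) (auto simp: of_nat_diff)
      then show ?thesis by simp
    qed
    finally show "?b ^ (Suc j - l) * ?q (Suc i - 1) (Suc j - l)
      \<le> ?Y" .
  qed
  also have "\<dots> \<le> real (Suc j) * ?Y"
    by (intro mult_right_mono) auto
  finally show ?thesis using hor unfolding far_sum_def by simp
qed

text \<open>The two quantities bounded by x are those that \<open>exit_separation\<close> pushes
  below the rate of the full Burke ratio.\<close>

lemma far_sum_exp_le:
  assumes xi: "0 \<le> \<xi>" "\<xi> < \<theta>1" and th: "\<theta>1 \<le> \<theta>" "\<theta> \<le> \<theta>2" "\<theta>2 < \<mu>"
    and i: "(\<lambda>N. real (i N) / real N) \<longlonglongrightarrow> s" and j: "(\<lambda>N. real (j N) / real N) \<longlonglongrightarrow> t"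
    and K: "(\<lambda>N. real (K N) / real N) \<longlonglongrightarrow> \<epsilon>"
    and x: "\<epsilon> * lm_hor \<xi> \<theta> + (s - \<epsilon>) * lm_hor \<xi> \<theta>1 + t * (lm_ver \<mu> \<xi> \<theta> - lm_ver \<mu> \<xi> \<theta>1) \<le> x"
      "(t - \<epsilon>) * (lm_ver \<mu> \<xi> \<theta> - lm_ver \<mu> \<xi> \<theta>2) + s * lm_hor \<xi> \<theta>2 \<le> x"
  shows "exp_rate_le (\<lambda>N. far_sum \<mu> \<xi> \<theta> (K N) (K N) (Suc (i N)) (Suc (j N))) x"
proof -
  let ?g = "lm_hor \<xi>" and ?h = "lm_ver \<mu> \<xi>"
  note Si = ratio_Suc_tendsto[OF i] and Sj = ratio_Suc_tendsto[OF j]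
  have c: "(\<lambda>N. c / real N) \<longlonglongrightarrow> 0" for c by real_asymp
  have "(\<lambda>N. real (K N) / real N * ?g \<theta> + (real (Suc (i N)) / real N - real (K N) / real N) * ?g \<theta>1
      + real (Suc (j N)) / real N * (?h \<theta> - ?h \<theta>1)) \<longlonglongrightarrow> \<epsilon> * ?g \<theta> + (s - \<epsilon>) * ?g \<theta>1 + t * (?h \<theta> - ?h \<theta>1)"
    by (intro tendsto_intros K Si Sj)
  then have "exp_rate_le (\<lambda>N. exp (real (K N) * ?g \<theta> + (real (Suc (i N)) - real (K N)) * ?g \<theta>1 + real (Suc (j N)) * (?h \<theta> - ?h \<theta>1)))
      (\<epsilon> * ?g \<theta> + (s - \<epsilon>) * ?g \<theta>1 + t * (?h \<theta> - ?h \<theta>1))"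
    
    by (intro exp_rate_le_exp)
      (simp add: add_divide_distrib diff_divide_distrib left_diff_distrib right_diff_distrib del: of_nat_Suc)
  from exp_rate_le_mult[OF exp_rate_le_poly1[OF Si] this]
  have 1: "exp_rate_le (\<lambda>N. real (Suc (i N)) * exp (real (K N) * ?g \<theta> + (real (Suc (i N)) - real (K N)) * ?g \<theta>1 + real (Suc (j N)) * (?h \<theta> - ?h \<theta>1))) x"
    by (rule exp_rate_le_mono) (use x in auto)
  have "(\<lambda>N. (real (Suc (j N)) / real N - real (K N) / real N) * (?h \<theta> - ?h \<theta>2) + real (i N) / real N * ?g \<theta>2 - ?h \<theta>2 / real N)
      \<longlonglongrightarrow> (t - \<epsilon>) * (?h \<theta> - ?h \<theta>2) + s * ?g \<theta>2 - 0"
    by (intro tendsto_intros K i Sj c)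
  then have "exp_rate_le (\<lambda>N. exp ((real (Suc (j N)) - real (K N)) * (?h \<theta> - ?h \<theta>2) + real (i N) * ?g \<theta>2 - ?h \<theta>2))
      ((t - \<epsilon>) * (?h \<theta> - ?h \<theta>2) + s * ?g \<theta>2)"
    
    by (intro exp_rate_le_exp)
      (simp add: add_divide_distrib diff_divide_distrib left_diff_distrib right_diff_distrib del: of_nat_Suc)
  from exp_rate_le_mult[OF exp_rate_le_poly1[OF Sj] this]
  have 2: "exp_rate_le (\<lambda>N. real (Suc (j N)) * exp ((real (Suc (j N)) - real (K N)) * (?h \<theta> - ?h \<theta>2) + real (i N) * ?g \<theta>2 - ?h \<theta>2)) x"
    by (rule exp_rate_le_mono) (use x in auto)
  from exp_rate_le_add[OF 1 2] show ?thesis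
    by (rule exp_rate_le_mono) (use far_sum_le[OF xi th] in auto)
qed

section \<open>Lower bound for the bulk moments\<close>

definition near_sum :: "real \<Rightarrow> real \<Rightarrow> real \<Rightarrow> nat \<Rightarrow> nat \<Rightarrow> nat \<Rightarrow> nat \<Rightarrow> real" where
  "near_sum \<mu> \<xi> \<theta> K L m n =
    (\<Sum>k=1..K. inv_gamma_moment \<theta> \<xi> ^ k * inv_gamma_moment (\<mu> - \<theta>) (- \<xi>) ^ n * bulk_moment \<mu> \<xi> (m - k) (n - 1)) +
    (\<Sum>l=1..L. inv_gamma_moment (\<mu> - \<theta>) (- \<xi>) ^ (n - l) * bulk_moment \<mu> \<xi> (m - 1) (n - l))"

text \<open>\<open>moment_decomposition\<close> cut at K and L, and freed from the underlying model
  so that every \<theta> in (\<xi>, \<mu>) can be inserted.\<close>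

lemma burke_decomposition:
  assumes "0 \<le> \<xi>" "\<xi> < \<theta>" "\<theta> < \<mu>" "1 \<le> m" "1 \<le> n" "K \<le> m" "L \<le> n"
  shows "inv_gamma_moment \<theta> \<xi> ^ m \<le>
    real (m + n) powr \<xi> * (near_sum \<mu> \<xi> \<theta> K L m n + far_sum \<mu> \<xi> \<theta> K L m n)"
proof -
  have th: "0 < \<theta>" using assms by simp
  obtain P :: "(site \<Rightarrow> real) measure" and U V Y where "log_gamma_model P \<mu> \<theta> U V Y"
    using log_gamma_model_exists[OF th assms(3)] by blast
  then interpret log_gamma_model P \<mu> \<theta> U V Y .
  have s1: "{1..m} = {1..K} \<union> {K<..m}" "{1..n} = {1..L} \<union> {L<..n}" using assms by auto
  have "(\<Sum>k\<in>{1..m}. f k) = (\<Sum>k\<in>{1..K}. f k) + (\<Sum>k\<in>{K<..m}. f k)"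
    "(\<Sum>l\<in>{1..n}. f l) = (\<Sum>l\<in>{1..L}. f l) + (\<Sum>l\<in>{L<..n}. f l)" for f :: "nat \<Rightarrow> real"
    unfolding s1 by (rule sum.union_disjoint; auto)+
  then show ?thesis
    using moment_decomposition[OF assms(1,2,4,5)] unfolding near_sum_def far_sum_def by (simp add: add_ac)
qed

lemma real_mult_le_abs: "real k * c \<le> real K * \<bar>c\<bar>" if "k \<le> K" for c :: real
proof -
  have "real k * c \<le> real k * \<bar>c\<bar>" by (intro mult_left_mono) auto
  also have "\<dots> \<le> real K * \<bar>c\<bar>" using that by (intro mult_right_mono) auto
  finally show ?thesis .
qed

text \<open>All powers with exponent at most K + L are estimated crudely through absolute values;
  only \<open>b ^ n\<close> is kept exactly. With K + L close to 2 \<epsilon> N the crude part has a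
  rate proportional to \<epsilon>. Here y is the price of one step in the bulk, for moments or for
  tails.\<close>

lemma corner_sum_le:
  fixes a b y :: real
  assumes "0 < a" "0 < b" "0 < y" "L \<le> n"
  shows "(\<Sum>k=1..K. a ^ k * y ^ (k - 1) * b ^ n) + (\<Sum>l=1..L. b ^ (n - l) * y ^ (l - 1)) \<le>
    real (K + L) * exp (real (K + L) * (\<bar>ln a\<bar> + \<bar>ln b\<bar> + \<bar>ln y\<bar>)) * exp (real n * ln b)"
proof -
  let ?X = "exp (real (K + L) * (\<bar>ln a\<bar> + \<bar>ln b\<bar> + \<bar>ln y\<bar>)) * exp (real n * ln b)"
  have bnd: "real (K + L) * (\<bar>ln a\<bar> + \<bar>ln b\<bar> + \<bar>ln y\<bar>) =
      real (K + L) * \<bar>ln a\<bar> + real (K + L) * \<bar>ln b\<bar> + real (K + L) * \<bar>ln y\<bar>" by (simp add: algebra_simps)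
  have "(\<Sum>k=1..K. a ^ k * y ^ (k - 1) * b ^ n) \<le> real (card {1..K}) * ?X"
  proof (rule sum_bounded_above)
    fix k assume k: "k \<in> {1..K}"
    have "a ^ k * y ^ (k - 1) * b ^ n = exp (real k * ln a + real (k - 1) * ln y) * exp (real n * ln b)"
      using assms by (simp add: power_eq_exp exp_add)
    also have "\<dots> \<le> ?X"
    proof (intro mult_right_mono exp_ge_zero, rule exp_mono)
      have "real k * ln a \<le> real (K + L) * \<bar>ln a\<bar>" using k by (intro real_mult_le_abs) auto
      moreover have "real (k - 1) * ln y \<le> real (K + L) * \<bar>ln y\<bar>" using k by (intro real_mult_le_abs) auto
      moreover have "0 \<le> real (K + L) * \<bar>ln b\<bar>" by simp
      ultimately show "real k * ln a + real (k - 1) * ln y \<le> real (K + L) * (\<bar>ln a\<bar> + \<bar>ln b\<bar> + \<bar>ln y\<bar>)"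
        unfolding bnd by linarith
    qed
    finally show "a ^ k * y ^ (k - 1) * b ^ n \<le> ?X" .
  qed
  moreover have "(\<Sum>l=1..L. b ^ (n - l) * y ^ (l - 1)) \<le> real (card {1..L}) * ?X"
  proof (rule sum_bounded_above)
    fix l assume l: "l \<in> {1..L}"
    then have nl: "real (n - l) = real n - real l" using assms by (simp add: of_nat_diff)
    have "b ^ (n - l) * y ^ (l - 1) = exp (real (n - l) * ln b) * exp (real (l - 1) * ln y)"
      using assms by (simp add: power_eq_exp)
    also have "\<dots> = exp (real l * (- ln b) + real (l - 1) * ln y) * exp (real n * ln b)"
      unfolding nl by (simp add: exp_add[symmetric] algebra_simps)
    also have "\<dots> \<le> ?X"
    proof (intro mult_right_mono exp_ge_zero, rule exp_mono)
      have "real l * (- ln b) \<le> real (K + L) * \<bar>- ln b\<bar>" using l by (intro real_mult_le_abs) auto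
      moreover have "real (l - 1) * ln y \<le> real (K + L) * \<bar>ln y\<bar>" using l by (intro real_mult_le_abs) auto
      moreover have "0 \<le> real (K + L) * \<bar>ln a\<bar>" by simp
      ultimately show "real l * (- ln b) + real (l - 1) * ln y \<le> real (K + L) * (\<bar>ln a\<bar> + \<bar>ln b\<bar> + \<bar>ln y\<bar>)"
        unfolding bnd abs_minus_cancel by linarith
    qed
    finally show "b ^ (n - l) * y ^ (l - 1) \<le> ?X" .
  qed
  ultimately show ?thesis by (simp add: algebra_simps)
qed

text \<open>An exit at (k, 0) enters the bulk at (k, 1), which is k - 1 steps away from (1, 1);
  \<open>bulk_moment_shift\<close> pays for these steps, and all terms become multiples of the same
  corner moment.\<close>

lemma near_sum_le:
  assumes "0 \<le> \<xi>" "\<xi> < \<theta>" "\<theta> < \<mu>" "K \<le> Suc i" "L \<le> Suc j"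
  shows "near_sum \<mu> \<xi> \<theta> K L (Suc i) (Suc j) \<le>
    real (K + L) * exp (real (K + L) * (\<bar>lm_hor \<xi> \<theta>\<bar> + \<bar>lm_ver \<mu> \<xi> \<theta>\<bar> + \<bar>lm_hor \<xi> \<mu>\<bar>)) *
      exp (real (Suc j) * lm_ver \<mu> \<xi> \<theta>) * bulk_moment \<mu> \<xi> i j"
proof -
  let ?a = "inv_gamma_moment \<theta> \<xi>" and ?b = "inv_gamma_moment (\<mu> - \<theta>) (- \<xi>)"
    and ?y = "inverse (inv_gamma_moment \<mu> \<xi>)" and ?q = "bulk_moment \<mu> \<xi> i j"
  let ?C = "(\<Sum>k=1..K. ?a ^ k * ?y ^ (k - 1) * ?b ^ Suc j) + (\<Sum>l=1..L. ?b ^ (Suc j - l) * ?y ^ (l - 1))"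
  have xi: "0 \<le> \<xi>" "\<xi> < \<mu>" using assms by auto
  have p: "0 < ?a" "0 < ?b" "0 < inv_gamma_moment \<mu> \<xi>" using assms by (auto intro!: inv_gamma_moment_pos)
  have shift1: "bulk_moment \<mu> \<xi> (i - k) j \<le> ?y ^ k * ?q" if "k \<le> i" for k
    using bulk_moment_shift(1)[OF xi that, of j] p by (simp add: power_inverse field_simps)
  have shift2: "bulk_moment \<mu> \<xi> i (j - k) \<le> ?y ^ k * ?q" if "k \<le> j" for k
    using bulk_moment_shift(2)[OF xi that, of i] p by (simp add: power_inverse field_simps)
  have "near_sum \<mu> \<xi> \<theta> K L (Suc i) (Suc j) \<le> ?C * ?q"
    unfolding near_sum_def distrib_right sum_distrib_right
  proof (intro add_mono sum_mono)
    fix k assume k: "k \<in> {1..K}"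
    then have k1: "Suc i - k = i - (k - 1)" "k - 1 \<le> i" using assms by auto
    have "?a ^ k * ?b ^ Suc j * bulk_moment \<mu> \<xi> (Suc i - k) (Suc j - 1) \<le> ?a ^ k * ?b ^ Suc j * (?y ^ (k - 1) * ?q)"
      using p shift1[OF k1(2)] unfolding k1(1) diff_Suc_1 by (intro mult_left_mono) auto
    then show "?a ^ k * ?b ^ Suc j * bulk_moment \<mu> \<xi> (Suc i - k) (Suc j - 1) \<le> ?a ^ k * ?y ^ (k - 1) * ?b ^ Suc j * ?q"
      by (simp only: mult_ac)
  next
    fix l assume l: "l \<in> {1..L}"
    then have l1: "Suc j - l = j - (l - 1)" "l - 1 \<le> j" using assms by auto
    have "?b ^ (Suc j - l) * bulk_moment \<mu> \<xi> (Suc i - 1) (Suc j - l) \<le> ?b ^ (Suc j - l) * (?y ^ (l - 1) * ?q)"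
      using p shift2[OF l1(2)] unfolding l1(1) diff_Suc_1 by (intro mult_left_mono) auto
    then show "?b ^ (Suc j - l) * bulk_moment \<mu> \<xi> (Suc i - 1) (Suc j - l) \<le> ?b ^ (Suc j - l) * ?y ^ (l - 1) * ?q"
      by (simp only: mult_ac)
  qed
  also have "\<dots> \<le> real (K + L) * exp (real (K + L) * (\<bar>lm_hor \<xi> \<theta>\<bar> + \<bar>lm_ver \<mu> \<xi> \<theta>\<bar> + \<bar>lm_hor \<xi> \<mu>\<bar>)) *
      exp (real (Suc j) * lm_ver \<mu> \<xi> \<theta>) * ?q"
    using corner_sum_le[of ?a ?b ?y L "Suc j" K] p assms(5) ln_inverse[of "inv_gamma_moment \<mu> \<xi>"]
    by (intro mult_right_mono bulk_moment_nonneg[OF xi]) (simp_all add: lm_hor_def lm_ver_def)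
  finally show ?thesis .
qed

text \<open>\<open>crit\<close> says that \<theta> is stationary for the exponent in direction (s,
  t). Then the exits beyond \<epsilon> N have a smaller rate than the Burke moment, the nearer ones
  are the corner moment up to a factor of rate 2 \<epsilon> c0 + t h(\<theta>), and the corner
  moment is solved for.\<close>

lemma bulk_moment_lower:
  assumes xi: "0 < \<xi>" "\<xi> < \<theta>" "\<theta> < \<mu>" and st: "0 < s" "0 < t"
    and crit: "s * (Digamma \<theta> - Digamma (\<theta> - \<xi>)) = t * (Digamma (\<mu> - \<theta> + \<xi>) - Digamma (\<mu> - \<theta>))"
    and i: "(\<lambda>N. real (i N) / real N) \<longlonglongrightarrow> s" and j: "(\<lambda>N. real (j N) / real N) \<longlonglongrightarrow> t"
  shows "exp_rate_ge (\<lambda>N. bulk_moment \<mu> \<xi> (i N) (j N)) (s * lm_hor \<xi> \<theta> - t * lm_ver \<mu> \<xi> \<theta>)"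
proof (rule exp_rate_ge_limit)
  fix \<delta> :: real assume d: "\<delta> > 0"
  let ?g = "lm_hor \<xi>" and ?h = "lm_ver \<mu> \<xi>"
  define c0 where "c0 = \<bar>?g \<theta>\<bar> + \<bar>?h \<theta>\<bar> + \<bar>?g \<mu>\<bar>"
  have c0: "0 \<le> c0" by (simp add: c0_def)
  \<comment> \<open>The first bound keeps the loss 2 \<epsilon> c0 of the near exits below \<delta>;
    the others keep the cut-off inside the rectangle.\<close>
  define \<epsilon> where "\<epsilon> = min (\<delta> / (2 * c0 + 1)) (min (s / 2) (t / 2))"
  have e: "0 < \<epsilon>" "\<epsilon> < s" "\<epsilon> < t" using d c0 st by (auto simp: \<epsilon>_def)
  have "\<epsilon> \<le> \<delta> / (2 * c0 + 1)" by (simp add: \<epsilon>_def)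
  then have "\<epsilon> * (2 * c0 + 1) \<le> \<delta>" using c0 by (subst (asm) pos_le_divide_eq) auto
  then have ec: "2 * \<epsilon> * c0 \<le> \<delta>" using e by (simp add: algebra_simps)
  \<comment> \<open>Radius within which the shifted parameters stay in (\<xi>, \<mu>).\<close>
  define r where "r = min (\<theta> - \<xi>) (\<mu> - \<theta>)"
  have r: "0 < r" using xi by (simp add: r_def)
  have D: "(?g has_real_derivative Digamma (\<theta> - \<xi>) - Digamma \<theta>) (at \<theta>)"
    "(?h has_real_derivative Digamma (\<mu> - \<theta>) - Digamma (\<mu> - \<theta> + \<xi>)) (at \<theta>)"
    using xi by (auto intro!: DERIV_lm_hor DERIV_lm_ver)
  have neg: "Digamma (\<theta> - \<xi>) - Digamma \<theta> < 0" "Digamma (\<mu> - \<theta>) - Digamma (\<mu> - \<theta> + \<xi>) < 0"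
    using xi Digamma_real_strict_mono[of "\<theta> - \<xi>" \<theta>] Digamma_real_strict_mono[of "\<mu> - \<theta>" "\<mu> - \<theta> + \<xi>"] by auto
  have crit': "s * (Digamma (\<theta> - \<xi>) - Digamma \<theta>) = t * (Digamma (\<mu> - \<theta>) - Digamma (\<mu> - \<theta> + \<xi>))"
    using crit by (simp add: algebra_simps)
  obtain \<theta>1 \<theta>2 where t1: "\<theta> - r < \<theta>1" "\<theta>1 < \<theta>" "\<epsilon> * ?g \<theta> + (s - \<epsilon>) * ?g \<theta>1 + t * (?h \<theta> - ?h \<theta>1) < s * ?g \<theta>"
    and t2: "\<theta> < \<theta>2" "\<theta>2 < \<theta> + r" "(t - \<epsilon>) * (?h \<theta> - ?h \<theta>2) + s * ?g \<theta>2 < s * ?g \<theta>"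
    using exit_separation[OF D(1) neg(1) D(2) neg(2) crit' e(1) r] by blast
  have t1': "\<xi> < \<theta>1" and t2': "\<theta>2 < \<mu>" using t1 t2 by (auto simp: r_def)
  define x where "x = max (\<epsilon> * ?g \<theta> + (s - \<epsilon>) * ?g \<theta>1 + t * (?h \<theta> - ?h \<theta>1)) ((t - \<epsilon>) * (?h \<theta> - ?h \<theta>2) + s * ?g \<theta>2)"
  have x: "x < s * ?g \<theta>" using t1 t2 by (simp add: x_def)
  define K where "K = (\<lambda>N. nat \<lfloor>real N * \<epsilon>\<rfloor>)"
  have K: "(\<lambda>N. real (K N) / real N) \<longlonglongrightarrow> \<epsilon>" unfolding K_def using e by (intro scaled_floor_tendsto) simp
  note Si = ratio_Suc_tendsto[OF i] and Sj = ratio_Suc_tendsto[OF j]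
  have KK: "(\<lambda>N. real (K N + K N) / real N) \<longlonglongrightarrow> \<epsilon> + \<epsilon>" by (rule ratio_add_tendsto[OF K K])
  have far: "exp_rate_le (\<lambda>N. far_sum \<mu> \<xi> \<theta> (K N) (K N) (Suc (i N)) (Suc (j N))) x"
    using xi t1 t1' t2 t2' by (intro far_sum_exp_le[OF _ _ _ _ _ i j K]) (auto simp: x_def)
  have poly: "exp_rate_le (\<lambda>N. real (Suc (i N) + Suc (j N)) powr \<xi>) 0"
    using xi by (intro exp_rate_le_poly[OF ratio_add_tendsto[OF Si Sj]]) simp
  have th: "0 < \<theta>" "\<xi> < \<theta>" using xi by auto
  have A: "exp_rate_ge (\<lambda>N. inv_gamma_moment \<theta> \<xi> ^ Suc (i N)) (s * ?g \<theta>)"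
    unfolding lm_hor_def by (intro exp_rate_ge_power[OF _ Si] inv_gamma_moment_pos th)
  let ?B = "\<lambda>N. real (K N + K N) * exp (real (K N + K N) * c0) * exp (real (Suc (j N)) * ?h \<theta>)"
  have "exp_rate_le (\<lambda>N. exp (real (K N + K N) * c0)) ((\<epsilon> + \<epsilon>) * c0)"
    by (rule exp_rate_le_exp) (use tendsto_mult_right[OF KK, of c0] in simp)
  from exp_rate_le_mult[OF exp_rate_le_poly1[OF KK] this]
  have "exp_rate_le (\<lambda>N. real (K N + K N) * exp (real (K N + K N) * c0)) (2 * \<epsilon> * c0)" by simp
  moreover have "exp_rate_le (\<lambda>N. exp (real (Suc (j N)) * ?h \<theta>)) (t * ?h \<theta>)"
    by (rule exp_rate_le_exp) (use tendsto_mult_right[OF Sj, of "?h \<theta>"] in simp)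
  ultimately have "exp_rate_le ?B (2 * \<epsilon> * c0 + t * ?h \<theta>)" by (rule exp_rate_le_mult) simp
  from exp_rate_le_mult[OF poly this]
  have B: "exp_rate_le (\<lambda>N. real (Suc (i N) + Suc (j N)) powr \<xi> * ?B N) (2 * \<epsilon> * c0 + t * ?h \<theta>)" by simp
  have fn: "0 \<le> far_sum \<mu> \<xi> \<theta> K L m n" for K L m n
    using xi by (intro far_sum_nonneg) auto
  have Dx: "exp_rate_le (\<lambda>N. real (Suc (i N) + Suc (j N)) powr \<xi> * far_sum \<mu> \<xi> \<theta> (K N) (K N) (Suc (i N)) (Suc (j N))) x"
    using exp_rate_le_mult[OF poly far fn] by simp
  have "exp_rate_ge (\<lambda>N. bulk_moment \<mu> \<xi> (i N) (j N)) (s * ?g \<theta> - (2 * \<epsilon> * c0 + t * ?h \<theta>))"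
  proof (rule exp_rate_ge_solve[OF A B Dx x])
    show "0 \<le> bulk_moment \<mu> \<xi> (i N) (j N)" for N using xi by (intro bulk_moment_nonneg) auto
    show "\<forall>\<^sub>F N in sequentially. inv_gamma_moment \<theta> \<xi> ^ Suc (i N) \<le>
       (real (Suc (i N) + Suc (j N)) powr \<xi> * ?B N) * bulk_moment \<mu> \<xi> (i N) (j N) +
       real (Suc (i N) + Suc (j N)) powr \<xi> * far_sum \<mu> \<xi> \<theta> (K N) (K N) (Suc (i N)) (Suc (j N))"
      using eventually_ratio_less[OF K i e(2)] eventually_ratio_less[OF K j e(3)]
    proof eventually_elim
      case (elim N)
      have "inv_gamma_moment \<theta> \<xi> ^ Suc (i N) \<le> real (Suc (i N) + Suc (j N)) powr \<xi> *
         (near_sum \<mu> \<xi> \<theta> (K N) (K N) (Suc (i N)) (Suc (j N)) + far_sum \<mu> \<xi> \<theta> (K N) (K N) (Suc (i N)) (Suc (j N)))"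
        using elim xi by (intro burke_decomposition) auto
      also have "\<dots> \<le> real (Suc (i N) + Suc (j N)) powr \<xi> *
         (?B N * bulk_moment \<mu> \<xi> (i N) (j N) + far_sum \<mu> \<xi> \<theta> (K N) (K N) (Suc (i N)) (Suc (j N)))"
        using elim xi near_sum_le[of \<xi> \<theta> \<mu> "K N" "i N" "K N" "j N"] unfolding c0_def
        by (intro mult_left_mono add_right_mono) auto
      finally show ?case by (simp only: distrib_left mult.assoc)
    qed
  qed
  then show "exp_rate_ge (\<lambda>N. bulk_moment \<mu> \<xi> (i N) (j N)) (s * ?g \<theta> - t * ?h \<theta> - \<delta>)"
    by (rule exp_rate_ge_mono) (use ec in auto)
qed

section \<open>The limiting logarithmic moment generating function\<close>

text \<open>Concavity of the digamma function, expressed by the monotonicity of its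
  derivative.\<close>

lemma Digamma_increment_antimono:
  assumes "0 < x" "x \<le> y" "0 \<le> \<xi>"
  shows "Digamma (y + \<xi>) - Digamma y \<le> Digamma (x + \<xi>) - Digamma (x :: real)"
proof (rule DERIV_nonpos_imp_nonincreasing[OF assms(2)])
  fix z assume z: "x \<le> z" "z \<le> y"
  have "((\<lambda>z. Digamma (z + \<xi>) - Digamma z) has_real_derivative Polygamma 1 (z + \<xi>) - Polygamma 1 z) (at z)"
    using z assms by (auto intro!: derivative_eq_intros simp: nonpos_Ints_def)
  moreover have "Polygamma 1 (z + \<xi>) - Polygamma 1 z \<le> 0"
    using Polygamma_real_strict_antimono[of z "z + \<xi>" 1] z assms by (cases "\<xi> = 0") auto
  ultimately show "\<exists>d. ((\<lambda>z. Digamma (z + \<xi>) - Digamma z) has_real_derivative d) (at z) \<and> d \<le> 0" by blast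
qed

lemma Digamma_continuous: "continuous_on {0<..} (Digamma :: real \<Rightarrow> real)"
  by (intro continuous_on_Polygamma) (auto simp: nonpos_Ints_def)

text \<open>The derivative of \<open>s * lm_hor \<xi> x - t * lm_ver \<mu> \<xi> x\<close> in \<open>x\<close>.\<close>

definition mgf_slope :: "real \<Rightarrow> real \<Rightarrow> real \<Rightarrow> real \<Rightarrow> real \<Rightarrow> real" where
  "mgf_slope \<mu> \<xi> s t x = t * (Digamma (\<mu> - x + \<xi>) - Digamma (\<mu> - x)) - s * (Digamma x - Digamma (x - \<xi>))"

text \<open>This is convexity of the exponent in the parameter, so a zero of the slope is a global
  minimum.\<close>

lemma mgf_slope_mono:
  assumes "0 \<le> \<xi>" "\<xi> < x" "x \<le> y" "y < \<mu>" "0 \<le> s" "0 \<le> t"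
  shows "mgf_slope \<mu> \<xi> s t x \<le> mgf_slope \<mu> \<xi> s t y"
proof -
  have "t * (Digamma (\<mu> - x + \<xi>) - Digamma (\<mu> - x)) \<le> t * (Digamma (\<mu> - y + \<xi>) - Digamma (\<mu> - y))"
    using assms by (intro mult_left_mono Digamma_increment_antimono) auto
  moreover have "s * (Digamma y - Digamma (y - \<xi>)) \<le> s * (Digamma x - Digamma (x - \<xi>))"
    using assms Digamma_increment_antimono[of "x - \<xi>" "y - \<xi>" \<xi>] by (intro mult_left_mono) auto
  ultimately show ?thesis by (simp add: mgf_slope_def)
qed

text \<open>As x decreases to \<xi>, the term Digamma(x - \<xi>) tends to minus infinity and makes
  the slope negative; the intermediate value theorem does the rest.\<close>

lemma mgf_slope_zero_exists:
  assumes xi: "0 < \<xi>" "\<xi> < \<theta>" "\<theta> < \<mu>" and st: "0 < s" "0 \<le> t" and pos: "0 < mgf_slope \<mu> \<xi> s t \<theta>"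
  shows "\<exists>x. \<xi> < x \<and> x < \<theta> \<and> mgf_slope \<mu> \<xi> s t x = 0"
proof -
  \<comment> \<open>B bounds the t-term of the slope on (\<xi>, \<theta>), and C bounds the part of
    the s-term other than the pole 1 / d. The distance d is then small enough for s / d to be at
    least B + s C.\<close>
  define B where "B = t * (Digamma \<mu> - Digamma (\<mu> - \<theta>))"
  define C where "C = Digamma (\<theta> + 1) - Digamma \<xi>"
  have BC: "0 \<le> B" "0 \<le> C"
    using assms Digamma_real_mono[of "\<mu> - \<theta>" \<mu>] Digamma_real_mono[of \<xi> "\<theta> + 1"] by (auto simp: B_def C_def)
  define d where "d = min ((\<theta> - \<xi>) / 2) (1 / (B / s + C + 1))"
  have BsC: "0 < B / s + C + 1" using BC st by (simp add: add_nonneg_pos)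
  have d: "0 < d" "d < \<theta> - \<xi>" "d \<le> 1 / (B / s + C + 1)" using BsC xi by (auto simp: d_def min_def)
  define x0 where "x0 = \<xi> + d"
  have x0: "\<xi> < x0" "x0 < \<theta>" using d by (auto simp: x0_def)
  have "B / s + C + 1 \<le> 1 / d" using d BsC by (simp add: field_simps)
  then have "s * (B / s + C) \<le> s * (1 / d)" using st by (intro mult_left_mono) auto
  then have sd: "B + s * C \<le> s * (1 / d)" using st by (simp add: distrib_left)
  have "t * (Digamma (\<mu> - x0 + \<xi>) - Digamma (\<mu> - x0)) \<le> B"
    unfolding B_def using x0 xi st by (intro mult_left_mono diff_mono Digamma_real_mono) auto
  moreover have "1 / d - C \<le> Digamma x0 - Digamma (x0 - \<xi>)"
  proof -
    \<comment> \<open>The recurrence isolates the pole at 0.\<close>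
    have "Digamma (d + 1) = Digamma d + 1 / d" using d by (intro Digamma_plus1) auto
    moreover have "Digamma (d + 1) \<le> Digamma (\<theta> + 1)" "Digamma \<xi> \<le> Digamma x0"
      using d x0 xi by (auto intro!: Digamma_real_mono)
    ultimately show ?thesis by (simp add: C_def x0_def)
  qed
  then have "s * (1 / d - C) \<le> s * (Digamma x0 - Digamma (x0 - \<xi>))" using st by (intro mult_left_mono) auto
  ultimately have neg: "mgf_slope \<mu> \<xi> s t x0 \<le> 0"
    using sd by (simp add: mgf_slope_def right_diff_distrib)
  have cont: "continuous_on {x0..\<theta>} (mgf_slope \<mu> \<xi> s t)"
    unfolding mgf_slope_def[abs_def] using x0 xi
    by (intro continuous_intros continuous_on_compose2[OF Digamma_continuous]) auto
  obtain x where x: "x0 \<le> x" "x \<le> \<theta>" "mgf_slope \<mu> \<xi> s t x = 0"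
    using IVT'[of "mgf_slope \<mu> \<xi> s t" x0 0 \<theta>] neg pos x0 cont by auto
  then have "x \<noteq> \<theta>" using pos by auto
  then show ?thesis using x x0 by (intro exI[of _ x]) auto
qed

lemma slope_zero_minimises:
  fixes F F' :: "real \<Rightarrow> real"
  assumes D: "\<And>y. a < y \<Longrightarrow> y < b \<Longrightarrow> (F has_real_derivative F' y) (at y)"
    and mono: "\<And>x y. a < x \<Longrightarrow> x \<le> y \<Longrightarrow> y < b \<Longrightarrow> F' x \<le> F' y"
    and c: "a < c" "c < b" "F' c = 0" and x: "a < x" "x < b"
  shows "F c \<le> F x"
proof (cases "x \<le> c")
  case True
  then show ?thesis
  proof (rule DERIV_nonpos_imp_nonincreasing)
    fix y assume "x \<le> y" "y \<le> c"
    then show "\<exists>d. (F has_real_derivative d) (at y) \<and> d \<le> 0" using D[of y] mono[of y c] c x by force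
  qed
next
  case False
  then have "c \<le> x" by simp
  then show ?thesis
  proof (rule DERIV_nonneg_imp_nondecreasing)
    fix y assume "c \<le> y" "y \<le> x"
    then show "\<exists>d. (F has_real_derivative d) (at y) \<and> 0 \<le> d" using D[of y] mono[of c y] c x by force
  qed
qed

lemma mgf_slope_zero_minimises:
  assumes xi: "0 \<le> \<xi>" "\<xi> < \<theta>" "\<theta> < \<mu>" and st: "0 \<le> s" "0 \<le> t" and zero: "mgf_slope \<mu> \<xi> s t \<theta> = 0"
    and x: "\<xi> < x" "x < \<mu>"
  shows "s * lm_hor \<xi> \<theta> - t * lm_ver \<mu> \<xi> \<theta> \<le> s * lm_hor \<xi> x - t * lm_ver \<mu> \<xi> x"
proof -
  let ?F = "\<lambda>x. s * lm_hor \<xi> x - t * lm_ver \<mu> \<xi> x"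
  have D: "(?F has_real_derivative mgf_slope \<mu> \<xi> s t y) (at y)" if "\<xi> < y" "y < \<mu>" for y
  proof -
    have "(?F has_real_derivative s * (Digamma (y - \<xi>) - Digamma y) - t * (Digamma (\<mu> - y) - Digamma (\<mu> - y + \<xi>))) (at y)"
      using that xi by (intro DERIV_diff DERIV_cmult DERIV_lm_hor DERIV_lm_ver) auto
    then show ?thesis by (simp add: mgf_slope_def algebra_simps)
  qed
  show ?thesis
    by (rule slope_zero_minimises[OF D mgf_slope_mono xi(2,3) zero x]) (use xi st in auto)
qed

lemma log_mgf_eq:
  "0 < \<nu> \<Longrightarrow> \<xi> < \<nu> \<Longrightarrow> log_mgf \<nu> \<xi> = ereal (ln (inv_gamma_moment \<nu> \<xi>))"
  by (simp add: log_mgf_def ln_inv_gamma_moment ln_Gamma_real_pos)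

text \<open>The reflection \<rho> -> \<mu> - \<rho> + \<xi> maps (\<xi>, \<mu>) onto itself and
  turns M_\<rho>(\<xi>) and M_(\<mu>-\<rho>)(-\<xi>) into - \<open>lm_ver\<close> and -
  \<open>lm_hor\<close>. The infimum thus becomes the minimum of the convex exponent, attained at
  the zero of its slope.\<close>

lemma limit_log_mgf_eq:
  assumes xi: "0 < \<xi>" "\<xi> < \<theta>" "\<theta> < \<mu>" and st: "0 \<le> s" "0 \<le> t" and zero: "mgf_slope \<mu> \<xi> s t \<theta> = 0"
  shows "limit_log_mgf \<mu> s t \<xi> = ereal (s * lm_hor \<xi> \<theta> - t * lm_ver \<mu> \<xi> \<theta>)"
proof -
  have val: "ereal t * log_mgf \<rho> \<xi> - ereal s * log_mgf (\<mu> - \<rho>) (- \<xi>) =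
      ereal (s * lm_hor \<xi> (\<mu> - \<rho> + \<xi>) - t * lm_ver \<mu> \<xi> (\<mu> - \<rho> + \<xi>))" if "\<xi> < \<rho>" "\<rho> < \<mu>" for \<rho>
    using that xi by (simp add: log_mgf_eq lm_hor_def lm_ver_def ln_inv_gamma_moment algebra_simps)
  show ?thesis
    unfolding limit_log_mgf_def
  proof (rule antisym)
    have "ereal t * log_mgf (\<mu> - \<theta> + \<xi>) \<xi> - ereal s * log_mgf (\<mu> - (\<mu> - \<theta> + \<xi>)) (- \<xi>) =
       ereal (s * lm_hor \<xi> \<theta> - t * lm_ver \<mu> \<xi> \<theta>)"
      using xi by (subst val) auto
    then show "(INF \<rho>\<in>{\<xi><..<\<mu>}. ereal t * log_mgf \<rho> \<xi> - ereal s * log_mgf (\<mu> - \<rho>) (- \<xi>)) \<le>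
       ereal (s * lm_hor \<xi> \<theta> - t * lm_ver \<mu> \<xi> \<theta>)"
      using xi by (intro INF_lower2[of "\<mu> - \<theta> + \<xi>"]) auto
    show "ereal (s * lm_hor \<xi> \<theta> - t * lm_ver \<mu> \<xi> \<theta>) \<le>
       (INF \<rho>\<in>{\<xi><..<\<mu>}. ereal t * log_mgf \<rho> \<xi> - ereal s * log_mgf (\<mu> - \<rho>) (- \<xi>))"
    proof (rule INF_greatest)
      fix \<rho> assume "\<rho> \<in> {\<xi><..<\<mu>}"
      then show "ereal (s * lm_hor \<xi> \<theta> - t * lm_ver \<mu> \<xi> \<theta>) \<le> ereal t * log_mgf \<rho> \<xi> - ereal s * log_mgf (\<mu> - \<rho>) (- \<xi>)"
        using xi st mgf_slope_zero_minimises[OF _ xi(2,3) st zero, of "\<mu> - \<rho> + \<xi>"] by (subst val) auto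
    qed
  qed
qed

section \<open>Moment generating function of the horizontal partition function\<close>

context log_gamma_model
begin

lemma Z_hor_measurable [measurable]: "(\<lambda>\<omega>. Z_hor (W \<omega>) u) \<in> borel_measurable P"
  unfolding Z_hor_rec by measurable

lemma AE_Z_hor_pos:
  assumes "1 \<le> m"
  shows "AE \<omega> in P. 0 < Z_hor (W \<omega>) (m, n)"
  using AE_W_pos by eventually_elim (use assms in \<open>auto simp: Z_hor_rec intro!: Z_square_pos\<close>)

definition hor_mgf :: "real \<Rightarrow> nat \<Rightarrow> nat \<Rightarrow> real" where
  "hor_mgf \<xi> m n = enn2real (\<integral>\<^sup>+\<omega>. ennreal (Z_hor (W \<omega>) (m, n) powr \<xi>) \<partial>P)"

text \<open>On the axis the Burke ratio has denominator 1 and is itself the horizontal partition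
  function; negative \<xi> is again included.\<close>

lemma Z_hor_axis_moment:
  assumes "\<xi> < \<theta>" "1 \<le> m"
  shows "(\<integral>\<^sup>+\<omega>. ennreal (Z_hor (W \<omega>) (m, 0) powr \<xi>) \<partial>P) = ennreal (inv_gamma_moment \<theta> \<xi> ^ m)"
proof -
  have "(\<integral>\<^sup>+\<omega>. ennreal (Z_hor (W \<omega>) (m, 0) powr \<xi>) \<partial>P) =
    (\<integral>\<^sup>+\<omega>. ennreal ((Z_square (W \<omega>) (0, 0) (m, 0) / Z_square (W \<omega>) (0, 0) (0, 0)) powr \<xi>) \<partial>P)"
    using assms(2) by (simp add: Z_hor_rec Z_square_horizontal prod.atLeast_Suc_atMost)
  also have "\<dots> = ennreal (inv_gamma_moment \<theta> \<xi> ^ m)" by (rule burke_moment[OF assms(1)])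
  finally show ?thesis .
qed

lemma nn_integral_hor_mgf:
  assumes "0 \<le> \<xi>" "\<xi> < \<theta>" "1 \<le> m"
  shows "(\<integral>\<^sup>+\<omega>. ennreal (Z_hor (W \<omega>) (m, n) powr \<xi>) \<partial>P) = ennreal (hor_mgf \<xi> m n)"
proof -
  have "(\<integral>\<^sup>+\<omega>. ennreal (Z_hor (W \<omega>) (m, n) powr \<xi>) \<partial>P) < \<top>"
  proof (cases "n = 0")
    case True
    then show ?thesis using Z_hor_axis_moment[OF assms(2,3)] by simp
  next
    case False
    then have "1 \<le> n" by simp
    from Z_hor_moment_upper[OF assms(1,2) this, of m] show ?thesis
      by (rule order_le_less_trans) simp
  qed
  then show ?thesis by (simp add: hor_mgf_def)
qed

text \<open>With m >= 1 a horizontal first step is possible and the partition function is almost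
  surely positive, so the default value of \<open>ln\<close> at 0 does not interfere.\<close>

lemma expectation_exp_ln_Z_hor:
  assumes "0 \<le> \<xi>" "\<xi> < \<theta>" "1 \<le> m"
  shows "integrable P (\<lambda>\<omega>. exp (\<xi> * ln (Z_hor (W \<omega>) (m, n))))"
    and "expectation (\<lambda>\<omega>. exp (\<xi> * ln (Z_hor (W \<omega>) (m, n)))) = hor_mgf \<xi> m n"
proof -
  have "(\<integral>\<^sup>+\<omega>. ennreal (exp (\<xi> * ln (Z_hor (W \<omega>) (m, n)))) \<partial>P) =
      (\<integral>\<^sup>+\<omega>. ennreal (Z_hor (W \<omega>) (m, n) powr \<xi>) \<partial>P)"
    using AE_Z_hor_pos[OF assms(3), of n]
    by (intro nn_integral_cong_AE, eventually_elim) (auto simp: powr_def)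
  then have nn: "(\<integral>\<^sup>+\<omega>. ennreal (exp (\<xi> * ln (Z_hor (W \<omega>) (m, n)))) \<partial>P) = ennreal (hor_mgf \<xi> m n)"
    using nn_integral_hor_mgf[OF assms] by simp
  then show int: "integrable P (\<lambda>\<omega>. exp (\<xi> * ln (Z_hor (W \<omega>) (m, n))))"
    by (intro integrableI_nonneg) auto
  show "expectation (\<lambda>\<omega>. exp (\<xi> * ln (Z_hor (W \<omega>) (m, n)))) = hor_mgf \<xi> m n"
    by (subst integral_eq_nn_integral) (auto simp: nn hor_mgf_def)
qed

lemma hor_mgf_axis: "\<xi> < \<theta> \<Longrightarrow> 1 \<le> m \<Longrightarrow> hor_mgf \<xi> m 0 = inv_gamma_moment \<theta> \<xi> ^ m"
  using inv_gamma_moment_pos[OF theta(1), of \<xi>] by (simp add: hor_mgf_def Z_hor_axis_moment)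

lemma hor_mgf_lower:
  assumes "0 \<le> \<xi>" "\<xi> < \<theta>" "1 \<le> k" "k \<le> m"
  shows "inv_gamma_moment \<theta> \<xi> ^ k * bulk_moment \<mu> \<xi> (m - k) j \<le> hor_mgf \<xi> m (Suc j)"
proof -
  have "ennreal (inv_gamma_moment \<theta> \<xi> ^ k * bulk_moment \<mu> \<xi> (m - k) j) \<le> ennreal (hor_mgf \<xi> m (Suc j))"
    using Z_hor_moment_lower[of \<xi> "Suc j" k m] nn_integral_hor_mgf[of \<xi> m "Suc j"] assms by simp
  then show ?thesis by (subst (asm) ennreal_le_iff) (auto simp: hor_mgf_def)
qed

text \<open>The bulk factor is bounded with \<theta>'. Because \<open>lm_hor\<close> decreases and
  \<theta>' <= \<theta>, the axis weights may be charged at \<theta>' too, and then every exit point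
  has the same exponent.\<close>

lemma hor_mgf_upper:
  assumes "0 \<le> \<xi>" "\<xi> < \<theta>'" "\<theta>' \<le> \<theta>" "1 \<le> m"
  shows "hor_mgf \<xi> m (Suc j) \<le> real m powr \<xi> *
    (real m * exp (real m * lm_hor \<xi> \<theta>' - real (Suc j) * lm_ver \<mu> \<xi> \<theta>'))" (is "_ \<le> ?R")
proof -
  have th: "\<xi> < \<theta>" "\<xi> < \<mu>" using assms theta by auto
  have "(\<Sum>k=1..m. inv_gamma_moment \<theta> \<xi> ^ k * bulk_moment \<mu> \<xi> (m - k) j) \<le>
      real (card {1..m}) * exp (real m * lm_hor \<xi> \<theta>' - real (Suc j) * lm_ver \<mu> \<xi> \<theta>')"
  proof (rule sum_bounded_above)
    fix k assume k: "k \<in> {1..m}"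
    have "inv_gamma_moment \<theta> \<xi> ^ k * bulk_moment \<mu> \<xi> (m - k) j \<le>
        exp (real k * lm_hor \<xi> \<theta>) * exp (real (m - k) * lm_hor \<xi> \<theta>' - real (Suc j) * lm_ver \<mu> \<xi> \<theta>')"
      using assms th theta bulk_moment_le_exp[of \<xi> \<theta>' \<mu> "m - k" j]
      by (simp add: power_inv_gamma_moment_hor[of \<theta> \<xi>] mult_left_mono del: of_nat_Suc)
    also have "\<dots> \<le> exp (real k * lm_hor \<xi> \<theta>') * exp (real (m - k) * lm_hor \<xi> \<theta>' - real (Suc j) * lm_ver \<mu> \<xi> \<theta>')"
      using assms by (intro mult_right_mono exp_mono mult_left_mono lm_hor_antimono) auto
    also have "\<dots> = exp (real m * lm_hor \<xi> \<theta>' - real (Suc j) * lm_ver \<mu> \<xi> \<theta>')"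
      using k by (simp add: exp_add[symmetric] of_nat_diff algebra_simps)
    finally show "inv_gamma_moment \<theta> \<xi> ^ k * bulk_moment \<mu> \<xi> (m - k) j \<le>
        exp (real m * lm_hor \<xi> \<theta>' - real (Suc j) * lm_ver \<mu> \<xi> \<theta>')" .
  qed
  then have "real m powr \<xi> * (\<Sum>k=1..m. inv_gamma_moment \<theta> \<xi> ^ k * bulk_moment \<mu> \<xi> (m - k) j) \<le> ?R"
    by (intro mult_left_mono) auto
  then have "ennreal (real m powr \<xi> * (\<Sum>k=1..m. inv_gamma_moment \<theta> \<xi> ^ k * bulk_moment \<mu> \<xi> (m - k) j)) \<le> ennreal ?R"
    by (rule ennreal_leI)
  moreover have "ennreal (hor_mgf \<xi> m (Suc j)) \<le>
      ennreal (real m powr \<xi> * (\<Sum>k=1..m. inv_gamma_moment \<theta> \<xi> ^ k * bulk_moment \<mu> \<xi> (m - k) j))"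
    using Z_hor_moment_upper[of \<xi> "Suc j" m] nn_integral_hor_mgf[of \<xi> m "Suc j"] assms th by simp
  ultimately have "ennreal (hor_mgf \<xi> m (Suc j)) \<le> ennreal ?R" by (rule order_trans[rotated])
  then show ?thesis by (subst (asm) ennreal_le_iff) auto
qed

lemma hor_mgf_exp_le:
  assumes "0 \<le> \<xi>" "\<xi> < \<theta>'" "\<theta>' \<le> \<theta>" "0 < s"
    and m: "(\<lambda>N. real (m N) / real N) \<longlonglongrightarrow> s" and j: "(\<lambda>N. real (j N) / real N) \<longlonglongrightarrow> t"
  shows "exp_rate_le (\<lambda>N. hor_mgf \<xi> (m N) (Suc (j N))) (s * lm_hor \<xi> \<theta>' - t * lm_ver \<mu> \<xi> \<theta>')"
proof -
  have "(\<lambda>N. real (m N) / real N * lm_hor \<xi> \<theta>' - real (Suc (j N)) / real N * lm_ver \<mu> \<xi> \<theta>') \<longlonglongrightarrow>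
      s * lm_hor \<xi> \<theta>' - t * lm_ver \<mu> \<xi> \<theta>'"
    by (intro tendsto_intros m ratio_Suc_tendsto j)
  then have "exp_rate_le (\<lambda>N. exp (real (m N) * lm_hor \<xi> \<theta>' - real (Suc (j N)) * lm_ver \<mu> \<xi> \<theta>'))
      (s * lm_hor \<xi> \<theta>' - t * lm_ver \<mu> \<xi> \<theta>')"
    by (intro exp_rate_le_exp) (simp add: diff_divide_distrib del: of_nat_Suc)
  from exp_rate_le_mult[OF exp_rate_le_poly[OF m assms(1)] exp_rate_le_mult[OF exp_rate_le_poly1[OF m] this]]
  have "exp_rate_le (\<lambda>N. real (m N) powr \<xi> * (real (m N) * exp (real (m N) * lm_hor \<xi> \<theta>' - real (Suc (j N)) * lm_ver \<mu> \<xi> \<theta>')))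
      (s * lm_hor \<xi> \<theta>' - t * lm_ver \<mu> \<xi> \<theta>')"
    by simp
  moreover have "\<forall>\<^sub>F N in sequentially. 0 < m N"
    by (rule eventually_ratio_less[OF _ m assms(4), of "\<lambda>_. 0", simplified])
  then have "\<forall>\<^sub>F N in sequentially. hor_mgf \<xi> (m N) (Suc (j N)) \<le>
     real (m N) powr \<xi> * (real (m N) * exp (real (m N) * lm_hor \<xi> \<theta>' - real (Suc (j N)) * lm_ver \<mu> \<xi> \<theta>'))"
    by eventually_elim (use assms in \<open>intro hor_mgf_upper; simp\<close>)
  ultimately show ?thesis by (rule exp_rate_le_mono) simp
qed

text \<open>Only the exit near a N is kept. Up to there the axis weights contribute at the parameter
  of the model; the remaining rectangle has direction (s - a, t), for which \<theta>' is stationary,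
  so \<open>bulk_moment_lower\<close> applies.\<close>

lemma hor_mgf_exp_ge:
  assumes "0 < \<xi>" "\<xi> < \<theta>" "\<xi> < \<theta>'" "\<theta>' < \<mu>" "0 \<le> a" "a < s" "0 < t"
    and slope: "mgf_slope \<mu> \<xi> (s - a) t \<theta>' = 0"
    and m: "(\<lambda>N. real (m N) / real N) \<longlonglongrightarrow> s" and j: "(\<lambda>N. real (j N) / real N) \<longlonglongrightarrow> t"
  shows "exp_rate_ge (\<lambda>N. hor_mgf \<xi> (m N) (Suc (j N)))
    (a * lm_hor \<xi> \<theta> + ((s - a) * lm_hor \<xi> \<theta>' - t * lm_ver \<mu> \<xi> \<theta>'))"
proof -
  \<comment> \<open>The successor keeps the exit point at least 1, also for a = 0.\<close>
  define k where "k = (\<lambda>N. Suc (nat \<lfloor>real N * a\<rfloor>))"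
  have k: "(\<lambda>N. real (k N) / real N) \<longlonglongrightarrow> a"
    unfolding k_def by (intro ratio_Suc_tendsto scaled_floor_tendsto assms)
  have le: "\<forall>\<^sub>F N in sequentially. k N < m N" by (rule eventually_ratio_less[OF k m assms(6)])
  note mk = ratio_diff_tendsto[OF m k assms(6)]
  have "exp_rate_ge (\<lambda>N. bulk_moment \<mu> \<xi> (m N - k N) (j N)) ((s - a) * lm_hor \<xi> \<theta>' - t * lm_ver \<mu> \<xi> \<theta>')"
    using slope assms by (intro bulk_moment_lower mk j) (auto simp: mgf_slope_def)
  moreover have "exp_rate_ge (\<lambda>N. inv_gamma_moment \<theta> \<xi> ^ k N) (a * lm_hor \<xi> \<theta>)"
    unfolding lm_hor_def using assms theta by (intro exp_rate_ge_power k inv_gamma_moment_pos) auto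
  ultimately have "exp_rate_ge (\<lambda>N. inv_gamma_moment \<theta> \<xi> ^ k N * bulk_moment \<mu> \<xi> (m N - k N) (j N))
      (a * lm_hor \<xi> \<theta> + ((s - a) * lm_hor \<xi> \<theta>' - t * lm_ver \<mu> \<xi> \<theta>'))"
    by (intro exp_rate_ge_mult)
  moreover have "\<forall>\<^sub>F N in sequentially. inv_gamma_moment \<theta> \<xi> ^ k N * bulk_moment \<mu> \<xi> (m N - k N) (j N) \<le> hor_mgf \<xi> (m N) (Suc (j N))"
    using le
  proof eventually_elim
    case (elim N)
    have "1 \<le> k N" by (simp add: k_def)
    then show ?case using elim assms by (intro hor_mgf_lower) auto
  qed
  ultimately show ?thesis by (rule exp_rate_ge_mono) simp
qed

text \<open>Upper and lower rate are matched in each case. If the slope at \<theta> is at most 0,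
  then \<theta> is the best admissible \<theta>' <= \<theta>, and a suitable exit point attains its
  value. Otherwise the unconstrained minimiser lies left of \<theta> and is admissible, and exits
  right at the corner attain it.\<close>

lemma hor_mgf_limit_pos:
  assumes xi: "0 < \<xi>" "\<xi> < \<theta>" and st: "0 < s" "0 < t"
    and m: "(\<lambda>N. real (m N) / real N) \<longlonglongrightarrow> s" and j: "(\<lambda>N. real (j N) / real N) \<longlonglongrightarrow> t"
  shows "(\<lambda>N. ereal (ln (hor_mgf \<xi> (m N) (Suc (j N))) / real N)) \<longlonglongrightarrow>
    (if s * (Digamma \<theta> - Digamma (\<theta> - \<xi>)) \<ge> t * (Digamma (\<mu> - \<theta> + \<xi>) - Digamma (\<mu> - \<theta>))
     then ereal s * log_mgf \<theta> \<xi> - ereal t * log_mgf (\<mu> - \<theta>) (- \<xi>)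
     else limit_log_mgf \<mu> s t \<xi>)"
proof (cases "s * (Digamma \<theta> - Digamma (\<theta> - \<xi>)) \<ge> t * (Digamma (\<mu> - \<theta> + \<xi>) - Digamma (\<mu> - \<theta>))")
  case True
  let ?d = "Digamma \<theta> - Digamma (\<theta> - \<xi>)" and ?e = "Digamma (\<mu> - \<theta> + \<xi>) - Digamma (\<mu> - \<theta>)"
  have d: "0 < ?d" "0 < ?e"
    using xi theta Digamma_real_strict_mono[of "\<theta> - \<xi>" \<theta>] Digamma_real_strict_mono[of "\<mu> - \<theta>" "\<mu> - \<theta> + \<xi>"] by auto
  \<comment> \<open>Solves (s - a) d = t e, which makes \<theta> stationary for (s - a, t); the case
    assumption is a >= 0.\<close>
  define a where "a = s - t * ?e / ?d"
  have a: "0 \<le> a" "a < s" "(s - a) * ?d = t * ?e"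
    using True d st by (auto simp: a_def divide_simps)
  have "exp_rate_ge (\<lambda>N. hor_mgf \<xi> (m N) (Suc (j N)))
      (a * lm_hor \<xi> \<theta> + ((s - a) * lm_hor \<xi> \<theta> - t * lm_ver \<mu> \<xi> \<theta>))"
    using xi theta a st by (intro hor_mgf_exp_ge m j) (auto simp: mgf_slope_def)
  then have "exp_rate_ge (\<lambda>N. hor_mgf \<xi> (m N) (Suc (j N))) (s * lm_hor \<xi> \<theta> - t * lm_ver \<mu> \<xi> \<theta>)"
    by (simp add: algebra_simps)
  moreover have "exp_rate_le (\<lambda>N. hor_mgf \<xi> (m N) (Suc (j N))) (s * lm_hor \<xi> \<theta> - t * lm_ver \<mu> \<xi> \<theta>)"
    using xi st by (intro hor_mgf_exp_le m j) auto
  ultimately have "(\<lambda>N. ln (hor_mgf \<xi> (m N) (Suc (j N))) / real N) \<longlonglongrightarrow> s * lm_hor \<xi> \<theta> - t * lm_ver \<mu> \<xi> \<theta>"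
    by (intro exp_rate_tendsto)
  moreover have "ereal s * log_mgf \<theta> \<xi> - ereal t * log_mgf (\<mu> - \<theta>) (- \<xi>) = ereal (s * lm_hor \<xi> \<theta> - t * lm_ver \<mu> \<xi> \<theta>)"
    using xi theta by (simp add: log_mgf_eq lm_hor_def lm_ver_def)
  ultimately show ?thesis using True by simp
next
  case False
  then have "0 < mgf_slope \<mu> \<xi> s t \<theta>" by (simp add: mgf_slope_def)
  then obtain x where x: "\<xi> < x" "x < \<theta>" "mgf_slope \<mu> \<xi> s t x = 0"
    using mgf_slope_zero_exists[of \<xi> \<theta> \<mu> s t] xi theta st by auto
  have "exp_rate_ge (\<lambda>N. hor_mgf \<xi> (m N) (Suc (j N)))
      (0 * lm_hor \<xi> \<theta> + ((s - 0) * lm_hor \<xi> x - t * lm_ver \<mu> \<xi> x))"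
    using xi theta st x by (intro hor_mgf_exp_ge m j) auto
  then have "exp_rate_ge (\<lambda>N. hor_mgf \<xi> (m N) (Suc (j N))) (s * lm_hor \<xi> x - t * lm_ver \<mu> \<xi> x)" by simp
  moreover have "exp_rate_le (\<lambda>N. hor_mgf \<xi> (m N) (Suc (j N))) (s * lm_hor \<xi> x - t * lm_ver \<mu> \<xi> x)"
    using xi st x by (intro hor_mgf_exp_le m j) auto
  ultimately have "(\<lambda>N. ln (hor_mgf \<xi> (m N) (Suc (j N))) / real N) \<longlonglongrightarrow> s * lm_hor \<xi> x - t * lm_ver \<mu> \<xi> x"
    by (intro exp_rate_tendsto)
  moreover have "limit_log_mgf \<mu> s t \<xi> = ereal (s * lm_hor \<xi> x - t * lm_ver \<mu> \<xi> x)"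
    using xi theta st x by (intro limit_log_mgf_eq) auto
  ultimately show ?thesis using False by simp
qed

end

section \<open>Lower tail of the bulk partition function\<close>

lemma trigamma_pos: "0 < x \<Longrightarrow> 0 < Polygamma 1 (x :: real)"
  by (rule Polygamma_real_odd_pos) (auto elim!: nonpos_Ints_cases)

text \<open>Difference quotients of \<open>ln_Gamma\<close> at \<nu>. This is how exponents of
  moments turn into the constants of the law of large numbers.\<close>

lemma lm_hor_scaled:
  assumes "0 < \<nu>"
  shows "((\<lambda>\<eta>. lm_hor \<eta> \<nu> / \<eta>) \<longlongrightarrow> - Digamma \<nu>) (at_right 0)"
    and "((\<lambda>\<eta>. lm_hor (- \<eta>) \<nu> / \<eta>) \<longlongrightarrow> Digamma \<nu>) (at_right 0)"
proof -
  have "((\<lambda>\<eta>. ln_Gamma (\<nu> - \<eta>) - ln_Gamma \<nu>) has_real_derivative - Digamma \<nu>) (at 0)"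
    using assms by (auto intro!: derivative_eq_intros)
  then have "(\<lambda>\<eta>. (ln_Gamma (\<nu> - \<eta>) - ln_Gamma \<nu>) / \<eta>) \<midarrow>0\<rightarrow> - Digamma \<nu>"
    by (simp add: has_field_derivative_iff)
  then have 1: "((\<lambda>\<eta>. (ln_Gamma (\<nu> - \<eta>) - ln_Gamma \<nu>) / \<eta>) \<longlongrightarrow> - Digamma \<nu>) (at_right 0)"
    by (rule filterlim_mono) (auto simp: at_le)
  show "((\<lambda>\<eta>. lm_hor \<eta> \<nu> / \<eta>) \<longlongrightarrow> - Digamma \<nu>) (at_right 0)"
    by (rule Lim_transform_eventually[OF 1])
      (use eventually_at_right_less[of 0] eventually_at_right_real[OF assms] in
        \<open>eventually_elim, simp add: lm_hor_def ln_inv_gamma_moment\<close>)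
  have "((\<lambda>\<eta>. ln_Gamma (\<nu> + \<eta>) - ln_Gamma \<nu>) has_real_derivative Digamma \<nu>) (at 0)"
    using assms by (auto intro!: derivative_eq_intros)
  then have "(\<lambda>\<eta>. (ln_Gamma (\<nu> + \<eta>) - ln_Gamma \<nu>) / \<eta>) \<midarrow>0\<rightarrow> Digamma \<nu>"
    by (simp add: has_field_derivative_iff)
  then have 2: "((\<lambda>\<eta>. (ln_Gamma (\<nu> + \<eta>) - ln_Gamma \<nu>) / \<eta>) \<longlongrightarrow> Digamma \<nu>) (at_right 0)"
    by (rule filterlim_mono) (auto simp: at_le)
  show "((\<lambda>\<eta>. lm_hor (- \<eta>) \<nu> / \<eta>) \<longlongrightarrow> Digamma \<nu>) (at_right 0)"
    by (rule Lim_transform_eventually[OF 2])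
      (use eventually_at_right_less[of 0] eventually_at_right_real[OF assms] in
        \<open>eventually_elim, use assms in \<open>simp add: lm_hor_def ln_inv_gamma_moment\<close>\<close>)
qed

lemma lm_ver_eq: "lm_ver \<mu> \<xi> \<theta> = lm_hor (- \<xi>) (\<mu> - \<theta>)"
  by (simp add: lm_ver_def lm_hor_def)

lemma lm_ver_scaled:
  "\<theta> < \<mu> \<Longrightarrow> ((\<lambda>\<eta>. lm_ver \<mu> \<eta> \<theta> / \<eta>) \<longlongrightarrow> Digamma (\<mu> - \<theta>)) (at_right 0)"
  unfolding lm_ver_eq by (rule lm_hor_scaled) simp

lemma obtain_small:
  fixes r :: real
  assumes "0 < r" "eventually Q (at_right 0)"
  obtains \<eta> where "0 < \<eta>" "\<eta> < r" "Q \<eta>"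
proof -
  have "\<forall>\<^sub>F \<eta> in at_right 0. 0 < \<eta> \<and> \<eta> < r \<and> Q \<eta>"
    using eventually_at_right_real[OF assms(1)] assms(2) by eventually_elim auto
  then have "\<exists>\<eta>. 0 < \<eta> \<and> \<eta> < r \<and> Q \<eta>"
    by (rule eventually_happens'[rotated]) simp
  then show ?thesis using that by blast
qed

text \<open>\<open>bulk_lower_tail_aux\<close> with \<open>\<tau> = exp x\<close>,
  \<open>z = exp w\<close> and equal cut-offs, every term written as an exponential so that rates
  can be read off.\<close>

lemma bulk_lower_tail_le:
  assumes eta: "0 < \<eta>" "\<eta> < \<theta>" "\<theta> < \<mu>" and KL: "K \<le> Suc i" "K \<le> Suc j"
  shows "measure (bulk_law \<mu> i j) {..<exp w} \<le>
    2 powr \<eta> * exp (\<eta> * x + real (Suc i) * lm_hor (- \<eta>) \<theta>) +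
    real (K + K) powr \<eta> * (real (K + K) * exp (\<eta> * (w - x) +
        real (K + K) * (\<bar>lm_hor \<eta> \<theta>\<bar> + \<bar>lm_ver \<mu> \<eta> \<theta>\<bar> + \<bar>lm_hor (- \<eta>) \<mu>\<bar>) + real (Suc j) * lm_ver \<mu> \<eta> \<theta>)) +
    exp (- (\<eta> * x)) * (real (Suc i + Suc j) powr \<eta> * far_sum \<mu> \<eta> \<theta> K K (Suc i) (Suc j))"
proof -
  have th: "0 < \<theta>" using eta by simp
  obtain P :: "(site \<Rightarrow> real) measure" and U V Y where "log_gamma_model P \<mu> \<theta> U V Y"
    using log_gamma_model_exists[OF th eta(3)] by blast
  then interpret log_gamma_model P \<mu> \<theta> U V Y .
  let ?a = "inv_gamma_moment \<theta> \<eta>" and ?b = "inv_gamma_moment (\<mu> - \<theta>) (- \<eta>)" and ?y = "inv_gamma_moment \<mu> (- \<eta>)"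
  have p: "0 < ?a" "0 < ?b" "0 < ?y" "0 < inv_gamma_moment \<theta> (- \<eta>)"
    using eta th by (auto intro!: inv_gamma_moment_pos)
  let ?C = "(\<Sum>k=1..K. ?a ^ k * ?y ^ (k - 1) * ?b ^ Suc j) + (\<Sum>l=1..K. ?b ^ (Suc j - l) * ?y ^ (l - 1))"
  let ?S = "exp (real (K + K) * (\<bar>lm_hor \<eta> \<theta>\<bar> + \<bar>lm_ver \<mu> \<eta> \<theta>\<bar> + \<bar>lm_hor (- \<eta>) \<mu>\<bar>))"
  have T: "measure (bulk_law \<mu> i j) {..<exp w} \<le>
     (2 * exp x) powr \<eta> * inv_gamma_moment \<theta> (- \<eta>) ^ Suc i +
     (exp x / exp w) powr (- \<eta>) * (real (K + K) powr \<eta> * ?C) +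
     exp x powr (- \<eta>) * (real (Suc i + Suc j) powr \<eta> * far_sum \<mu> \<eta> \<theta> K K (Suc i) (Suc j))"
    unfolding far_sum_def using eta KL by (intro bulk_lower_tail_aux) auto
  have 1: "(2 * exp x) powr \<eta> * inv_gamma_moment \<theta> (- \<eta>) ^ Suc i =
      2 powr \<eta> * exp (\<eta> * x + real (Suc i) * lm_hor (- \<eta>) \<theta>)"
    unfolding power_eq_exp[OF p(4)] lm_hor_def by (simp add: powr_mult exp_powr_real exp_add mult_ac)
  have 3: "exp x powr (- \<eta>) = exp (- (\<eta> * x))" by (simp add: exp_powr_real mult.commute)
  have e2: "(exp x / exp w) powr (- \<eta>) = exp (\<eta> * (w - x))"
    by (simp add: exp_diff[symmetric] exp_powr_real algebra_simps)
  have "?C \<le> real (K + K) * ?S * exp (real (Suc j) * lm_ver \<mu> \<eta> \<theta>)"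
    using corner_sum_le[OF p(1-3) KL(2), of K] by (simp add: lm_hor_def lm_ver_def)
  then have "(exp x / exp w) powr (- \<eta>) * (real (K + K) powr \<eta> * ?C) \<le>
      exp (\<eta> * (w - x)) * (real (K + K) powr \<eta> * (real (K + K) * ?S * exp (real (Suc j) * lm_ver \<mu> \<eta> \<theta>)))"
    unfolding e2 by (intro mult_left_mono) auto
  also have "\<dots> = real (K + K) powr \<eta> * (real (K + K) * (exp (\<eta> * (w - x)) * ?S * exp (real (Suc j) * lm_ver \<mu> \<eta> \<theta>)))"
    by (simp only: mult_ac)
  finally show ?thesis using T unfolding 1 3 exp_add by linarith
qed

text \<open>The order of choices matters: \<epsilon>, the shifted parameters and the threshold x are
  fixed by strict inequalities between digamma values, and only then is the order \<eta> of the
  moment made so small that the scaled exponents inherit these inequalities.\<close>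

lemma bulk_lower_tail:
  assumes th: "0 < \<theta>" "\<theta> < \<mu>" and st: "0 < s" "0 < t"
    and crit: "s * Polygamma 1 \<theta> = t * Polygamma 1 (\<mu> - \<theta>)"
    and i: "(\<lambda>N. real (i N) / real N) \<longlonglongrightarrow> s" and j: "(\<lambda>N. real (j N) / real N) \<longlonglongrightarrow> t" and d: "0 < \<delta>"
  shows "\<exists>c<0. exp_rate_le (\<lambda>N. measure (bulk_law \<mu> (i N) (j N))
      {..<exp (real N * (- s * Digamma \<theta> - t * Digamma (\<mu> - \<theta>) - \<delta>))}) c"
proof -
  let ?G = "\<lambda>x. - Digamma x" and ?H = "\<lambda>x. Digamma (\<mu> - x)"
  define w where "w = - s * Digamma \<theta> - t * Digamma (\<mu> - \<theta>) - \<delta>"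
  define c0 where "c0 = \<bar>?G \<theta>\<bar> + \<bar>?H \<theta>\<bar> + \<bar>Digamma \<mu>\<bar>"
  have c0: "0 \<le> c0" by (simp add: c0_def)
  \<comment> \<open>Chosen so that the near exits use up at most half of \<delta>.\<close>
  define \<epsilon> where "\<epsilon> = min (\<delta> / (4 * c0 + 1)) (min (s / 2) (t / 2))"
  have e: "0 < \<epsilon>" "\<epsilon> < s" "\<epsilon> < t" using d c0 st by (auto simp: \<epsilon>_def)
  have "\<epsilon> \<le> \<delta> / (4 * c0 + 1)" by (simp add: \<epsilon>_def)
  then have "\<epsilon> * (4 * c0 + 1) \<le> \<delta>" using c0 by (subst (asm) pos_le_divide_eq) auto
  then have ec: "2 * \<epsilon> * c0 \<le> \<delta> / 2" using e by (simp add: algebra_simps)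
  define r where "r = min \<theta> (\<mu> - \<theta>)"
  have r: "0 < r" using th by (simp add: r_def)
  have D: "(?G has_real_derivative - Polygamma 1 \<theta>) (at \<theta>)"
    "(?H has_real_derivative - Polygamma 1 (\<mu> - \<theta>)) (at \<theta>)"
    using th by (auto intro!: derivative_eq_intros elim!: nonpos_Ints_cases)
  have neg: "- Polygamma 1 \<theta> < 0" "- Polygamma 1 (\<mu> - \<theta>) < 0"
    using th trigamma_pos[of \<theta>] trigamma_pos[of "\<mu> - \<theta>"] by auto
  have crit': "s * (- Polygamma 1 \<theta>) = t * (- Polygamma 1 (\<mu> - \<theta>))" using crit by simp
  obtain \<theta>1 \<theta>2 where t1: "\<theta> - r < \<theta>1" "\<theta>1 < \<theta>" "\<epsilon> * ?G \<theta> + (s - \<epsilon>) * ?G \<theta>1 + t * (?H \<theta> - ?H \<theta>1) < s * ?G \<theta>"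
    and t2: "\<theta> < \<theta>2" "\<theta>2 < \<theta> + r" "(t - \<epsilon>) * (?H \<theta> - ?H \<theta>2) + s * ?G \<theta>2 < s * ?G \<theta>"
    using exit_separation[OF D(1) neg(1) D(2) neg(2) crit' e(1) r] by blast
  have t1': "0 < \<theta>1" and t2': "\<theta>2 < \<mu>" using t1 t2 by (auto simp: r_def)
  define E1 where "E1 = \<epsilon> * ?G \<theta> + (s - \<epsilon>) * ?G \<theta>1 + t * (?H \<theta> - ?H \<theta>1)"
  define E2 where "E2 = (t - \<epsilon>) * (?H \<theta> - ?H \<theta>2) + s * ?G \<theta>2"
  \<comment> \<open>The threshold x lies strictly between M and the rate s G(\<theta>) of the Burke
    ratio: above the far exits E1 and E2, and less than \<delta> / 2 below that rate.\<close>
  define M where "M = max (s * ?G \<theta> - \<delta> / 2) (max E1 E2)"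
  define x where "x = (s * ?G \<theta> + M) / 2"
  have "M < s * ?G \<theta>" "s * ?G \<theta> - \<delta> / 2 \<le> M" "E1 \<le> M" "E2 \<le> M"
    using t1(3) t2(3) d unfolding M_def E1_def[symmetric] E2_def[symmetric] by auto
  then have x: "x < s * ?G \<theta>" "s * ?G \<theta> - \<delta> / 2 < x" "E1 < x" "E2 < x"
    unfolding x_def by (simp_all add: field_simps)
  \<comment> \<open>A and B are the rates of the first two terms of
    \<open>bulk_lower_tail_le\<close>, C and D those of the far exits on the two axes, all divided
    by \<eta>. Their limits at \<eta> = 0 satisfy the required strict inequalities.\<close>
  define A where "A = (\<lambda>\<eta>. x + s * (lm_hor (- \<eta>) \<theta> / \<eta>))"
  define B where "B = (\<lambda>\<eta>. w - x + 2 * \<epsilon> * (\<bar>lm_hor \<eta> \<theta> / \<eta>\<bar> + \<bar>lm_ver \<mu> \<eta> \<theta> / \<eta>\<bar> + \<bar>lm_hor (- \<eta>) \<mu> / \<eta>\<bar>)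
      + t * (lm_ver \<mu> \<eta> \<theta> / \<eta>))"
  define C where "C = (\<lambda>\<eta>. \<epsilon> * (lm_hor \<eta> \<theta> / \<eta>) + (s - \<epsilon>) * (lm_hor \<eta> \<theta>1 / \<eta>) +
      t * (lm_ver \<mu> \<eta> \<theta> / \<eta> - lm_ver \<mu> \<eta> \<theta>1 / \<eta>))"
  define D where "D = (\<lambda>\<eta>. (t - \<epsilon>) * (lm_ver \<mu> \<eta> \<theta> / \<eta> - lm_ver \<mu> \<eta> \<theta>2 / \<eta>) + s * (lm_hor \<eta> \<theta>2 / \<eta>))"
  have "(A \<longlongrightarrow> x + s * Digamma \<theta>) (at_right 0)"
    unfolding A_def using th by (intro tendsto_intros lm_hor_scaled)
  moreover have "x + s * Digamma \<theta> < 0" using x by simp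
  ultimately have evA: "\<forall>\<^sub>F \<eta> in at_right 0. A \<eta> < 0" by (rule order_tendstoD(2))
  have "(B \<longlongrightarrow> w - x + 2 * \<epsilon> * c0 + t * ?H \<theta>) (at_right 0)"
    unfolding B_def c0_def using th by (intro tendsto_intros lm_hor_scaled lm_ver_scaled) auto
  moreover have "w - x + 2 * \<epsilon> * c0 + t * ?H \<theta> < 0" using x ec by (simp add: w_def)
  ultimately have evB: "\<forall>\<^sub>F \<eta> in at_right 0. B \<eta> < 0" by (rule order_tendstoD(2))
  have "(C \<longlongrightarrow> E1) (at_right 0)"
    unfolding C_def E1_def using th t1 t1' by (intro tendsto_intros lm_hor_scaled lm_ver_scaled) auto
  then have evC: "\<forall>\<^sub>F \<eta> in at_right 0. C \<eta> < x" by (rule order_tendstoD(2)) (rule x)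
  have "(D \<longlongrightarrow> E2) (at_right 0)"
    unfolding D_def E2_def using th t2 t2' by (intro tendsto_intros lm_hor_scaled lm_ver_scaled) auto
  then have evD: "\<forall>\<^sub>F \<eta> in at_right 0. D \<eta> < x" by (rule order_tendstoD(2)) (rule x)
  from evA evB evC evD have "\<forall>\<^sub>F \<eta> in at_right 0. A \<eta> < 0 \<and> B \<eta> < 0 \<and> C \<eta> < x \<and> D \<eta> < x"
    by eventually_elim simp
  then obtain \<eta> where eta: "0 < \<eta>" "\<eta> < \<theta>1" and ABCD: "A \<eta> < 0 \<and> B \<eta> < 0 \<and> C \<eta> < x \<and> D \<eta> < x"
    by (rule obtain_small[OF t1'])
  define y where "y = max (C \<eta>) (D \<eta>)"
  have y: "y < x" using ABCD by (simp add: y_def)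
  \<comment> \<open>The largest of the three rates; the far exits are weighted by
    \<open>exp (- \<eta> x)\<close> per unit of N, whence y - x.\<close>
  define c where "c = \<eta> * max (A \<eta>) (max (B \<eta>) (y - x))"
  have c: "c < 0" using ABCD y eta by (auto simp: c_def mult_less_0_iff)
  have cA: "\<eta> * A \<eta> \<le> c" and cB: "\<eta> * B \<eta> \<le> c" and cC: "\<eta> * (y - x) \<le> c"
    using eta by (auto simp: c_def)
  define K where "K = (\<lambda>N. nat \<lfloor>real N * \<epsilon>\<rfloor>)"
  have K: "(\<lambda>N. real (K N) / real N) \<longlonglongrightarrow> \<epsilon>" unfolding K_def using e by (intro scaled_floor_tendsto) simp
  note Si = ratio_Suc_tendsto[OF i] and Sj = ratio_Suc_tendsto[OF j]
  have KK: "(\<lambda>N. real (K N + K N) / real N) \<longlonglongrightarrow> \<epsilon> + \<epsilon>" by (rule ratio_add_tendsto[OF K K])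
  let ?m = "\<bar>lm_hor \<eta> \<theta>\<bar> + \<bar>lm_ver \<mu> \<eta> \<theta>\<bar> + \<bar>lm_hor (- \<eta>) \<mu>\<bar>"
  have linear: "(\<lambda>N. (real N * z + u N) / real N) \<longlonglongrightarrow> z + v" if "(\<lambda>N. u N / real N) \<longlonglongrightarrow> v" for z u v
  proof (rule Lim_transform_eventually[OF tendsto_add[OF tendsto_const that]])
    show "\<forall>\<^sub>F N in sequentially. z + u N / real N = (real N * z + u N) / real N"
      using eventually_gt_at_top[of 0] by eventually_elim (simp add: field_simps)
  qed
  have "(\<lambda>N. (real N * (\<eta> * x) + real (Suc (i N)) * lm_hor (- \<eta>) \<theta>) / real N) \<longlonglongrightarrow> \<eta> * x + s * lm_hor (- \<eta>) \<theta>"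
    using tendsto_mult_right[OF Si, of "lm_hor (- \<eta>) \<theta>"] by (intro linear) simp
  from exp_rate_le_mult[OF exp_rate_le_const exp_rate_le_exp[OF this], of "2 powr \<eta>"]
  have "exp_rate_le (\<lambda>N. 2 powr \<eta> * exp (real N * (\<eta> * x) + real (Suc (i N)) * lm_hor (- \<eta>) \<theta>)) (\<eta> * x + s * lm_hor (- \<eta>) \<theta>)"
    by simp
  then have T1: "exp_rate_le (\<lambda>N. 2 powr \<eta> * exp (real N * (\<eta> * x) + real (Suc (i N)) * lm_hor (- \<eta>) \<theta>)) c"
    by (rule exp_rate_le_mono) (use cA eta in \<open>auto simp: A_def distrib_left\<close>)
  have "(\<lambda>N. (real N * (\<eta> * (w - x)) + (real (K N + K N) * ?m + real (Suc (j N)) * lm_ver \<mu> \<eta> \<theta>)) / real N)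
      \<longlonglongrightarrow> \<eta> * (w - x) + ((\<epsilon> + \<epsilon>) * ?m + t * lm_ver \<mu> \<eta> \<theta>)"
    using tendsto_add[OF tendsto_mult_right[OF KK, of ?m] tendsto_mult_right[OF Sj, of "lm_ver \<mu> \<eta> \<theta>"]]
    by (intro linear) (simp add: add_divide_distrib del: of_nat_Suc of_nat_add)
  from exp_rate_le_mult[OF exp_rate_le_poly[OF KK less_imp_le[OF eta(1)]] exp_rate_le_mult[OF exp_rate_le_poly1[OF KK] exp_rate_le_exp[OF this]]]
  have "exp_rate_le (\<lambda>N. real (K N + K N) powr \<eta> * (real (K N + K N) *
      exp (real N * (\<eta> * (w - x)) + (real (K N + K N) * ?m + real (Suc (j N)) * lm_ver \<mu> \<eta> \<theta>))))
      (\<eta> * (w - x) + ((\<epsilon> + \<epsilon>) * ?m + t * lm_ver \<mu> \<eta> \<theta>))" by simp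
  then have T2: "exp_rate_le (\<lambda>N. real (K N + K N) powr \<eta> * (real (K N + K N) *
      exp (real N * (\<eta> * (w - x)) + (real (K N + K N) * ?m + real (Suc (j N)) * lm_ver \<mu> \<eta> \<theta>)))) c"
  proof (rule exp_rate_le_mono)
    have "\<eta> * B \<eta> = \<eta> * (w - x) + ((\<epsilon> + \<epsilon>) * ?m + t * lm_ver \<mu> \<eta> \<theta>)"
      using eta by (simp add: B_def abs_divide field_simps)
    then show "\<eta> * (w - x) + ((\<epsilon> + \<epsilon>) * ?m + t * lm_ver \<mu> \<eta> \<theta>) \<le> c" using cB by simp
  qed simp
  have far: "exp_rate_le (\<lambda>N. far_sum \<mu> \<eta> \<theta> (K N) (K N) (Suc (i N)) (Suc (j N))) (\<eta> * y)"
  proof (rule far_sum_exp_le[OF _ _ _ _ _ i j K])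
    have "\<eta> * C \<eta> = \<epsilon> * lm_hor \<eta> \<theta> + (s - \<epsilon>) * lm_hor \<eta> \<theta>1 + t * (lm_ver \<mu> \<eta> \<theta> - lm_ver \<mu> \<eta> \<theta>1)"
      using eta by (simp add: C_def field_simps)
    then show "\<epsilon> * lm_hor \<eta> \<theta> + (s - \<epsilon>) * lm_hor \<eta> \<theta>1 + t * (lm_ver \<mu> \<eta> \<theta> - lm_ver \<mu> \<eta> \<theta>1) \<le> \<eta> * y"
      using mult_left_mono[of "C \<eta>" y \<eta>] eta by (simp add: y_def)
    have "\<eta> * D \<eta> = (t - \<epsilon>) * (lm_ver \<mu> \<eta> \<theta> - lm_ver \<mu> \<eta> \<theta>2) + s * lm_hor \<eta> \<theta>2"
      using eta by (simp add: D_def field_simps)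
    then show "(t - \<epsilon>) * (lm_ver \<mu> \<eta> \<theta> - lm_ver \<mu> \<eta> \<theta>2) + s * lm_hor \<eta> \<theta>2 \<le> \<eta> * y"
      using mult_left_mono[of "D \<eta>" y \<eta>] eta by (simp add: y_def)
  qed (use eta t1 t2 t2' in auto)
  have fn: "0 \<le> far_sum \<mu> \<eta> \<theta> (K N) (K N) (Suc (i N)) (Suc (j N))" for N
    using eta t1 th by (intro far_sum_nonneg) auto
  have "(\<lambda>N. (real N * (- (\<eta> * x)) + 0) / real N) \<longlonglongrightarrow> - (\<eta> * x) + 0" by (rule linear) simp
  then have "exp_rate_le (\<lambda>N. exp (- (real N * (\<eta> * x)))) (- (\<eta> * x))" using exp_rate_le_exp by fastforce
  from exp_rate_le_mult[OF this exp_rate_le_mult[OF exp_rate_le_poly[OF ratio_add_tendsto[OF Si Sj] less_imp_le[OF eta(1)]] far fn]] fn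
  have "exp_rate_le (\<lambda>N. exp (- (real N * (\<eta> * x))) * (real (Suc (i N) + Suc (j N)) powr \<eta> *
      far_sum \<mu> \<eta> \<theta> (K N) (K N) (Suc (i N)) (Suc (j N)))) (- (\<eta> * x) + \<eta> * y)" by simp
  then have T3: "exp_rate_le (\<lambda>N. exp (- (real N * (\<eta> * x))) * (real (Suc (i N) + Suc (j N)) powr \<eta> *
      far_sum \<mu> \<eta> \<theta> (K N) (K N) (Suc (i N)) (Suc (j N)))) c"
    by (rule exp_rate_le_mono) (use cC in \<open>auto simp: algebra_simps\<close>)
  have "exp_rate_le (\<lambda>N. measure (bulk_law \<mu> (i N) (j N)) {..<exp (real N * w)}) c"
  proof (rule exp_rate_le_mono[OF exp_rate_le_add[OF exp_rate_le_add[OF T1 T2] T3] _ order_refl])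
    show "\<forall>\<^sub>F N in sequentially. measure (bulk_law \<mu> (i N) (j N)) {..<exp (real N * w)} \<le>
       2 powr \<eta> * exp (real N * (\<eta> * x) + real (Suc (i N)) * lm_hor (- \<eta>) \<theta>) +
       real (K N + K N) powr \<eta> * (real (K N + K N) *
         exp (real N * (\<eta> * (w - x)) + (real (K N + K N) * ?m + real (Suc (j N)) * lm_ver \<mu> \<eta> \<theta>))) +
       exp (- (real N * (\<eta> * x))) * (real (Suc (i N) + Suc (j N)) powr \<eta> *
         far_sum \<mu> \<eta> \<theta> (K N) (K N) (Suc (i N)) (Suc (j N)))"
      using eventually_ratio_less[OF K i e(2)] eventually_ratio_less[OF K j e(3)]
    proof eventually_elim
      case (elim N)
      have r: "\<eta> * (real N * x) = real N * (\<eta> * x)" "\<eta> * (real N * w - real N * x) = real N * (\<eta> * (w - x))"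
        by (simp_all add: algebra_simps)
      show ?case
        using bulk_lower_tail_le[of \<eta> \<theta> \<mu> "K N" "i N" "j N" "real N * w" "real N * x"] elim eta t1 th
        unfolding r by (simp add: add.assoc)
    qed
  qed
  then show ?thesis using c unfolding w_def by blast
qed

section \<open>The law of large numbers\<close>

text \<open>The derivative of \<open>- s * Digamma x - t * Digamma (\<mu> - x)\<close> in \<open>x\<close>.\<close>

definition lln_slope :: "real \<Rightarrow> real \<Rightarrow> real \<Rightarrow> real \<Rightarrow> real" where
  "lln_slope \<mu> s t x = t * Polygamma 1 (\<mu> - x) - s * Polygamma 1 x"

lemma trigamma_antimono: "0 < x \<Longrightarrow> x \<le> y \<Longrightarrow> Polygamma 1 y \<le> Polygamma 1 (x :: real)"
  using Polygamma_real_strict_antimono[of x y 1] by (cases "x = y") auto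

lemma lln_slope_mono:
  assumes "0 < x" "x \<le> y" "y < \<mu>" "0 \<le> s" "0 \<le> t"
  shows "lln_slope \<mu> s t x \<le> lln_slope \<mu> s t y"
  unfolding lln_slope_def using assms by (intro diff_mono mult_left_mono trigamma_antimono) auto

text \<open>Near 0 the trigamma function is at least 1 / x^2, which makes the slope negative there;
  then the intermediate value theorem applies.\<close>

lemma lln_slope_zero_exists:
  assumes th: "0 < \<theta>" "\<theta> < \<mu>" and st: "0 < s" "0 \<le> t" and pos: "0 < lln_slope \<mu> s t \<theta>"
  shows "\<exists>x. 0 < x \<and> x < \<theta> \<and> lln_slope \<mu> s t x = 0"
proof -
  \<comment> \<open>It suffices to find x0 < \<theta> with trigamma value at least B. As 1 / x0 >= B
    + 1 >= 1, the square of 1 / x0 is at least B.\<close>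
  define B where "B = t * Polygamma 1 (\<mu> - \<theta>) / s"
  have B: "0 \<le> B" using th st trigamma_pos[of "\<mu> - \<theta>"] by (simp add: B_def)
  define x0 where "x0 = min (\<theta> / 2) (1 / (B + 1))"
  have x0: "0 < x0" "x0 < \<theta>" "x0 \<le> 1 / (B + 1)" using B th by (auto simp: x0_def)
  have "B + 1 \<le> 1 / x0" using x0 B by (simp add: field_simps)
  moreover have "1 / x0 \<le> (1 / x0) ^ 2" using calculation B by (intro self_le_power) auto
  ultimately have "B \<le> 1 / x0 ^ 2" by (simp add: power_divide)
  also have "\<dots> \<le> Polygamma 1 x0"
  proof -
    have "Polygamma 1 (x0 + 1) = Polygamma 1 x0 - 1 / x0 ^ 2"
      using Polygamma_plus1[of x0 1] x0 by (simp add: eval_nat_numeral)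
    then show ?thesis using trigamma_pos[of "x0 + 1"] x0 by simp
  qed
  finally have "t * Polygamma 1 (\<mu> - \<theta>) \<le> s * Polygamma 1 x0"
    using st by (simp add: B_def divide_simps mult.commute)
  moreover have "t * Polygamma 1 (\<mu> - x0) \<le> t * Polygamma 1 (\<mu> - \<theta>)"
    using x0 th st by (intro mult_left_mono trigamma_antimono) auto
  ultimately have neg: "lln_slope \<mu> s t x0 \<le> 0" by (simp add: lln_slope_def)
  have tri: "continuous_on {0<..} (Polygamma 1 :: real \<Rightarrow> real)"
    by (intro continuous_on_Polygamma) (auto simp: nonpos_Ints_def)
  have "continuous_on {x0..\<theta>} (lln_slope \<mu> s t)"
    unfolding lln_slope_def[abs_def] using x0 th
    by (intro continuous_intros continuous_on_compose2[OF tri]) auto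
  then obtain x where x: "x0 \<le> x" "x \<le> \<theta>" "lln_slope \<mu> s t x = 0"
    using IVT'[of "lln_slope \<mu> s t" x0 0 \<theta>] neg pos x0 by auto
  then have "x \<noteq> \<theta>" using pos by auto
  then show ?thesis using x x0 by (intro exI[of _ x]) auto
qed

text \<open>The exponent is convex because trigamma decreases, so the infimum is attained where the
  slope vanishes.\<close>

lemma free_energy_eq:
  assumes th: "0 < \<theta>" "\<theta> < \<mu>" and st: "0 \<le> s" "0 \<le> t" and zero: "lln_slope \<mu> s t \<theta> = 0"
  shows "free_energy \<mu> s t = - s * Digamma \<theta> - t * Digamma (\<mu> - \<theta>)"
  unfolding free_energy_def
proof (rule cInf_eq_minimum)
  let ?F = "\<lambda>x. - s * Digamma x - t * Digamma (\<mu> - x)"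
  show "?F \<theta> \<in> ?F ` {0<..<\<mu>}" using th by auto
  fix v assume "v \<in> ?F ` {0<..<\<mu>}"
  then obtain x where x: "0 < x" "x < \<mu>" and v: "v = ?F x" by auto
  have D: "(?F has_real_derivative lln_slope \<mu> s t y) (at y)" if "0 < y" "y < \<mu>" for y
    using that by (auto intro!: derivative_eq_intros elim!: nonpos_Ints_cases simp: lln_slope_def)
  have "?F \<theta> \<le> ?F x"
    by (rule slope_zero_minimises[OF D lln_slope_mono th zero x]) (use st in auto)
  then show "?F \<theta> \<le> v" by (simp add: v)
qed

text \<open>A negative exponential rate makes the probabilities summable, and Borel-Cantelli
  applies.\<close>

lemma (in prob_space) AE_eventually_not:
  assumes [measurable]: "\<And>N. Measurable.pred M (Q N)"
    and c: "\<exists>c<0. exp_rate_le (\<lambda>N. prob {\<omega> \<in> space M. Q N \<omega>}) c"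
  shows "AE \<omega> in M. \<forall>\<^sub>F N in sequentially. \<not> Q N \<omega>"
proof -
  have "AE \<omega> in M. \<forall>\<^sub>F N in sequentially. \<omega> \<in> space M - {\<omega> \<in> space M. Q N \<omega>}"
  proof (rule borel_cantelli_AE1)
    show "summable (\<lambda>N. prob {\<omega> \<in> space M. Q N \<omega>})"
      using c exp_rate_le_summable[of "\<lambda>N. prob {\<omega> \<in> space M. Q N \<omega>}"] by auto
  qed (simp_all add: emeasure_eq_measure)
  then show ?thesis by eventually_elim (auto elim: eventually_mono)
qed

text \<open>The exceptional null set must not depend on \<delta>, so the deviations are taken along
  the countable sequence 1 / (k + 1).\<close>

lemma (in prob_space) AE_ln_limit:
  fixes X :: "nat \<Rightarrow> 'a \<Rightarrow> real"
  assumes [measurable]: "\<And>N. X N \<in> borel_measurable M"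
    and upper: "\<And>\<delta>. 0 < \<delta> \<Longrightarrow> \<exists>c<0. exp_rate_le (\<lambda>N. prob {\<omega> \<in> space M. exp (real N * (p + \<delta>)) \<le> X N \<omega>}) c"
    and lower: "\<And>\<delta>. 0 < \<delta> \<Longrightarrow> \<exists>c<0. exp_rate_le (\<lambda>N. prob {\<omega> \<in> space M. X N \<omega> < exp (real N * (p - \<delta>))}) c"
  shows "AE \<omega> in M. (\<lambda>N. ln (X N \<omega>) / real N) \<longlonglongrightarrow> p"
proof -
  define d where "d = (\<lambda>k. 1 / real (Suc k))"
  have d: "0 < d k" for k by (simp add: d_def)
  have "AE \<omega> in M. \<forall>k. (\<forall>\<^sub>F N in sequentially. \<not> exp (real N * (p + d k)) \<le> X N \<omega>) \<and>
     (\<forall>\<^sub>F N in sequentially. \<not> X N \<omega> < exp (real N * (p - d k)))"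
    unfolding AE_all_countable
    using AE_eventually_not[OF _ upper[OF d]] AE_eventually_not[OF _ lower[OF d]] by auto
  then show ?thesis
  proof eventually_elim
    case (elim \<omega>)
    have "(\<forall>\<^sub>F N in sequentially. X N \<omega> \<le> exp (real N * (p + \<delta>))) \<and>
        (\<forall>\<^sub>F N in sequentially. exp (real N * (p - \<delta>)) \<le> X N \<omega>)" if pos: "0 < \<delta>" for \<delta>
    proof -
      obtain k where "d k < \<delta>" using reals_Archimedean[OF pos] by (auto simp: d_def inverse_eq_divide)
      then have le: "exp (real N * (p + d k)) \<le> exp (real N * (p + \<delta>))" "exp (real N * (p - \<delta>)) \<le> exp (real N * (p - d k))" for N
        by (auto intro!: mult_left_mono)
      have ev: "\<forall>\<^sub>F N in sequentially. \<not> exp (real N * (p + d k)) \<le> X N \<omega>"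
        "\<forall>\<^sub>F N in sequentially. \<not> X N \<omega> < exp (real N * (p - d k))"
        using elim by blast+
      from ev(1) have "\<forall>\<^sub>F N in sequentially. X N \<omega> \<le> exp (real N * (p + \<delta>))"
        by (rule eventually_mono) (meson le(1) not_le less_imp_le order_trans)
      moreover from ev(2) have "\<forall>\<^sub>F N in sequentially. exp (real N * (p - \<delta>)) \<le> X N \<omega>"
        by (rule eventually_mono) (meson le(2) not_less order_trans)
      ultimately show ?thesis ..
    qed
    then have "exp_rate_le (\<lambda>N. X N \<omega>) p" "exp_rate_ge (\<lambda>N. X N \<omega>) p"
      by (auto simp: exp_rate_le_def exp_rate_ge_def)
    then show ?case by (rule exp_rate_tendsto)
  qed
qed

section \<open>Exponential tails of the horizontal partition function\<close>

context log_gamma_model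
begin

lemma hor_mgf_nonneg: "0 \<le> hor_mgf \<xi> m n"
  by (simp add: hor_mgf_def)

text \<open>Markov's inequality for the moment of order \<eta>: the resulting rate is v - \<eta> w <
  0.\<close>

lemma hor_upper_tail_mgf:
  assumes "0 < \<eta>" "\<eta> < \<theta>" "v < \<eta> * w" and m: "\<forall>\<^sub>F N in sequentially. 1 \<le> m N"
    and mgf: "exp_rate_le (\<lambda>N. hor_mgf \<eta> (m N) (n N)) v"
  shows "\<exists>c<0. exp_rate_le (\<lambda>N. prob {\<omega> \<in> space P. exp (real N * w) \<le> Z_hor (W \<omega>) (m N, n N)}) c"
proof (intro exI conjI)
  have "(\<lambda>N. - real N * (\<eta> * w) / real N) \<longlonglongrightarrow> - (\<eta> * w)"
    by (rule tendsto_eventually) (use eventually_gt_at_top[of 0] in \<open>eventually_elim, simp\<close>)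
  then have "exp_rate_le (\<lambda>N. exp (- real N * (\<eta> * w))) (- (\<eta> * w))" by (rule exp_rate_le_exp)
  from exp_rate_le_mult[OF this mgf hor_mgf_nonneg]
  have "exp_rate_le (\<lambda>N. exp (- real N * (\<eta> * w)) * hor_mgf \<eta> (m N) (n N)) (v - \<eta> * w)"
    by (rule exp_rate_le_mono) simp_all
  then show "exp_rate_le (\<lambda>N. prob {\<omega> \<in> space P. exp (real N * w) \<le> Z_hor (W \<omega>) (m N, n N)}) (v - \<eta> * w)"
  proof (rule exp_rate_le_mono[OF _ _ order_refl])
    show "\<forall>\<^sub>F N in sequentially. prob {\<omega> \<in> space P. exp (real N * w) \<le> Z_hor (W \<omega>) (m N, n N)} \<le>
        exp (- real N * (\<eta> * w)) * hor_mgf \<eta> (m N) (n N)"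
      using m
    proof eventually_elim
      case (elim N)
      have "prob {\<omega> \<in> space P. exp (real N * w) \<le> Z_hor (W \<omega>) (m N, n N)} \<le>
          exp (real N * w) powr (- \<eta>) * hor_mgf \<eta> (m N) (n N)"
        using assms elim by (intro markov_powr) (auto simp: nn_integral_hor_mgf hor_mgf_nonneg)
      then show ?case by (simp add: exp_powr_real mult_ac)
    qed
  qed
  show "v - \<eta> * w < 0" using assms by simp
qed

text \<open>Divided by \<eta>, the exponent of the moment bound at \<theta>' tends to the constant
  of the law of large numbers at \<theta>'; any positive \<delta> therefore leaves room for some
  small \<eta>.\<close>

lemma hor_upper_tail:
  assumes "0 < \<theta>'" "\<theta>' \<le> \<theta>" "0 < s" "0 < \<delta>"
    and m: "(\<lambda>N. real (m N) / real N) \<longlonglongrightarrow> s" and j: "(\<lambda>N. real (j N) / real N) \<longlonglongrightarrow> t"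
  shows "\<exists>c<0. exp_rate_le (\<lambda>N. prob {\<omega> \<in> space P.
    exp (real N * (- s * Digamma \<theta>' - t * Digamma (\<mu> - \<theta>') + \<delta>)) \<le> Z_hor (W \<omega>) (m N, Suc (j N))}) c"
proof -
  let ?w = "- s * Digamma \<theta>' - t * Digamma (\<mu> - \<theta>') + \<delta>"
  have "((\<lambda>\<eta>. s * (lm_hor \<eta> \<theta>' / \<eta>) - t * (lm_ver \<mu> \<eta> \<theta>' / \<eta>)) \<longlongrightarrow> s * (- Digamma \<theta>') - t * Digamma (\<mu> - \<theta>')) (at_right 0)"
    using assms theta by (intro tendsto_intros lm_hor_scaled lm_ver_scaled) auto
  then have "\<forall>\<^sub>F \<eta> in at_right 0. s * (lm_hor \<eta> \<theta>' / \<eta>) - t * (lm_ver \<mu> \<eta> \<theta>' / \<eta>) < ?w"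
    by (rule order_tendstoD(2)) (use assms in simp)
  then obtain \<eta> where eta: "0 < \<eta>" "\<eta> < \<theta>'" "s * (lm_hor \<eta> \<theta>' / \<eta>) - t * (lm_ver \<mu> \<eta> \<theta>' / \<eta>) < ?w"
    by (rule obtain_small[OF assms(1)])
  have "\<eta> * (s * (lm_hor \<eta> \<theta>' / \<eta>) - t * (lm_ver \<mu> \<eta> \<theta>' / \<eta>)) < \<eta> * ?w"
    using eta by (intro mult_strict_left_mono)
  moreover have "\<eta> * (s * (lm_hor \<eta> \<theta>' / \<eta>) - t * (lm_ver \<mu> \<eta> \<theta>' / \<eta>)) = s * lm_hor \<eta> \<theta>' - t * lm_ver \<mu> \<eta> \<theta>'"
    using eta by (simp add: field_simps)
  ultimately have v: "s * lm_hor \<eta> \<theta>' - t * lm_ver \<mu> \<eta> \<theta>' < \<eta> * ?w" by simp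
  have ev: "\<forall>\<^sub>F N in sequentially. 1 \<le> m N"
    using eventually_ratio_less[OF _ m assms(3), of "\<lambda>_. 0"] by (simp add: Suc_le_eq)
  show ?thesis
    using eta assms by (intro hor_upper_tail_mgf[OF _ _ v ev hor_mgf_exp_le[OF _ _ _ _ m j]]) auto
qed

lemma axis_upper_tail:
  assumes "0 < s" "0 < \<delta>" and m: "(\<lambda>N. real (m N) / real N) \<longlonglongrightarrow> s"
  shows "\<exists>c<0. exp_rate_le (\<lambda>N. prob {\<omega> \<in> space P.
    exp (real N * (- s * Digamma \<theta> + \<delta>)) \<le> Z_hor (W \<omega>) (m N, 0)}) c"
proof -
  let ?w = "- s * Digamma \<theta> + \<delta>"
  have "((\<lambda>\<eta>. s * (lm_hor \<eta> \<theta> / \<eta>)) \<longlongrightarrow> s * (- Digamma \<theta>)) (at_right 0)"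
    using theta by (intro tendsto_intros lm_hor_scaled)
  then have "\<forall>\<^sub>F \<eta> in at_right 0. s * (lm_hor \<eta> \<theta> / \<eta>) < ?w"
    by (rule order_tendstoD(2)) (use assms in simp)
  then obtain \<eta> where eta: "0 < \<eta>" "\<eta> < \<theta>" "s * (lm_hor \<eta> \<theta> / \<eta>) < ?w"
    by (rule obtain_small[OF theta(1)])
  then have "\<eta> * (s * (lm_hor \<eta> \<theta> / \<eta>)) < \<eta> * ?w" by (intro mult_strict_left_mono)
  then have v: "s * lm_hor \<eta> \<theta> < \<eta> * ?w" using eta by simp
  have ev: "\<forall>\<^sub>F N in sequentially. 1 \<le> m N"
    using eventually_ratio_less[OF _ m assms(1), of "\<lambda>_. 0"] by (simp add: Suc_le_eq)
  have "exp_rate_le (\<lambda>N. inv_gamma_moment \<theta> \<eta> ^ m N) (s * lm_hor \<eta> \<theta>)"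
    unfolding lm_hor_def using eta theta by (intro exp_rate_le_power[OF _ m] inv_gamma_moment_pos)
  then have "exp_rate_le (\<lambda>N. hor_mgf \<eta> (m N) 0) (s * lm_hor \<eta> \<theta>)"
    by (rule exp_rate_le_mono) (use ev eta in \<open>auto elim!: eventually_mono simp: hor_mgf_axis\<close>)
  then show ?thesis using eta by (intro hor_upper_tail_mgf[OF _ _ v ev]) auto
qed

text \<open>Negative moments of a product of independent weights. The limit a may be 0, since the
  exit point may be only one step from the origin; hence the separate condition that m is eventually
  positive.\<close>

lemma axis_lower_tail:
  assumes "0 < \<delta>" and m: "(\<lambda>N. real (m N) / real N) \<longlonglongrightarrow> a" and ev: "\<forall>\<^sub>F N in sequentially. 1 \<le> m N"
  shows "\<exists>c<0. exp_rate_le (\<lambda>N. prob {\<omega> \<in> space P.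
    Z_hor (W \<omega>) (m N, 0) < exp (real N * (- a * Digamma \<theta> - \<delta>))}) c"
proof -
  let ?w = "- a * Digamma \<theta> - \<delta>"
  have "((\<lambda>\<eta>. ?w + a * (lm_hor (- \<eta>) \<theta> / \<eta>)) \<longlongrightarrow> ?w + a * Digamma \<theta>) (at_right 0)"
    using theta by (intro tendsto_intros lm_hor_scaled)
  then have "\<forall>\<^sub>F \<eta> in at_right 0. ?w + a * (lm_hor (- \<eta>) \<theta> / \<eta>) < 0"
    by (rule order_tendstoD(2)) (use assms in simp)
  then obtain \<eta> where eta: "0 < \<eta>" "\<eta> < \<theta>" "?w + a * (lm_hor (- \<eta>) \<theta> / \<eta>) < 0"
    by (rule obtain_small[OF theta(1)])
  define c where "c = \<eta> * (?w + a * (lm_hor (- \<eta>) \<theta> / \<eta>))"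
  have "c < 0" unfolding c_def using eta by (intro mult_pos_neg)
  moreover have "c = \<eta> * ?w + a * lm_hor (- \<eta>) \<theta>" using eta by (simp add: c_def distrib_left)
  ultimately have c: "c < 0" "c = \<eta> * ?w + a * lm_hor (- \<eta>) \<theta>" .
  have p: "0 < inv_gamma_moment \<theta> (- \<eta>)" using eta theta by (intro inv_gamma_moment_pos) auto
  have "exp_rate_le (\<lambda>N. inv_gamma_moment \<theta> (- \<eta>) ^ m N) (a * lm_hor (- \<eta>) \<theta>)"
    unfolding lm_hor_def using p by (intro exp_rate_le_power[OF _ m])
  moreover have "(\<lambda>N. real N * (\<eta> * ?w) / real N) \<longlonglongrightarrow> \<eta> * ?w"
    by (rule tendsto_eventually) (use eventually_gt_at_top[of 0] in \<open>eventually_elim, simp\<close>)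
  ultimately have "exp_rate_le (\<lambda>N. exp (real N * (\<eta> * ?w)) * inv_gamma_moment \<theta> (- \<eta>) ^ m N) c"
    unfolding c(2) using p by (intro exp_rate_le_mult exp_rate_le_exp) auto
  then have "exp_rate_le (\<lambda>N. prob {\<omega> \<in> space P. Z_hor (W \<omega>) (m N, 0) < exp (real N * ?w)}) c"
  proof (rule exp_rate_le_mono[OF _ _ order_refl])
    show "\<forall>\<^sub>F N in sequentially. prob {\<omega> \<in> space P. Z_hor (W \<omega>) (m N, 0) < exp (real N * ?w)} \<le>
        exp (real N * (\<eta> * ?w)) * inv_gamma_moment \<theta> (- \<eta>) ^ m N"
      using ev
    proof eventually_elim
      case (elim N)
      \<comment> \<open>A lower tail of Z is an upper tail of 1 / Z, to which Markov's inequality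
        applies.\<close>
      have "prob {\<omega> \<in> space P. Z_hor (W \<omega>) (m N, 0) < exp (real N * ?w)} \<le>
          prob {\<omega> \<in> space P. exp (- (real N * ?w)) \<le> Z_hor (W \<omega>) (m N, 0) powr (-1)}"
      proof (rule finite_measure_mono_AE)
        show "AE \<omega> in P. \<omega> \<in> {\<omega> \<in> space P. Z_hor (W \<omega>) (m N, 0) < exp (real N * ?w)} \<longrightarrow>
            \<omega> \<in> {\<omega> \<in> space P. exp (- (real N * ?w)) \<le> Z_hor (W \<omega>) (m N, 0) powr (-1)}"
          using AE_Z_hor_pos[OF elim, of 0]
        proof eventually_elim
          case (elim \<omega>)
          have "exp (- (real N * ?w)) \<le> inverse (Z_hor (W \<omega>) (m N, 0))"
            if "Z_hor (W \<omega>) (m N, 0) < exp (real N * ?w)"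
            unfolding exp_minus using that elim by (intro le_imp_inverse_le) auto
          then show ?case using elim by (auto simp: powr_minus)
        qed
      qed measurable
      also have "\<dots> \<le> exp (- (real N * ?w)) powr (- \<eta>) * inv_gamma_moment \<theta> (- \<eta>) ^ m N"
      proof (rule markov_powr)
        have "(\<integral>\<^sup>+\<omega>. ennreal ((Z_hor (W \<omega>) (m N, 0) powr (-1)) powr \<eta>) \<partial>P) =
            (\<integral>\<^sup>+\<omega>. ennreal (Z_hor (W \<omega>) (m N, 0) powr (- \<eta>)) \<partial>P)"
          by (simp only: powr_powr mult_minus_left mult_1_left)
        also have "\<dots> = ennreal (inv_gamma_moment \<theta> (- \<eta>) ^ m N)"
          using eta theta elim by (intro Z_hor_axis_moment) auto
        finally show "(\<integral>\<^sup>+\<omega>. ennreal ((Z_hor (W \<omega>) (m N, 0) powr (-1)) powr \<eta>) \<partial>P) \<le> ennreal (inv_gamma_moment \<theta> (- \<eta>) ^ m N)"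
          by simp
      qed (use eta p in auto)
      also have "exp (- (real N * ?w)) powr (- \<eta>) = exp (real N * (\<eta> * ?w))"
        by (simp only: exp_powr_real) (simp add: mult_ac)
      finally show ?case .
    qed
  qed
  then show ?thesis using c by blast
qed

text \<open>The exit near a N contributes an axis product times a bulk partition function. If
  neither factor falls short by \<delta> / 2 in the exponent, their product does not fall short by
  \<delta>; a union bound combines the two tails.\<close>

lemma hor_lower_tail:
  assumes th: "0 < \<theta>'" "\<theta>' < \<mu>" and a: "0 \<le> a" "a < s" and t: "0 < t"
    and slope: "lln_slope \<mu> (s - a) t \<theta>' = 0" and d: "0 < \<delta>"
    and m: "(\<lambda>N. real (m N) / real N) \<longlonglongrightarrow> s" and j: "(\<lambda>N. real (j N) / real N) \<longlonglongrightarrow> t"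
  shows "\<exists>c<0. exp_rate_le (\<lambda>N. prob {\<omega> \<in> space P. Z_hor (W \<omega>) (m N, Suc (j N)) <
     exp (real N * (- a * Digamma \<theta> + (- (s - a) * Digamma \<theta>' - t * Digamma (\<mu> - \<theta>')) - \<delta>))}) c"
proof -
  let ?w1 = "- a * Digamma \<theta> - \<delta> / 2" and ?w2 = "- (s - a) * Digamma \<theta>' - t * Digamma (\<mu> - \<theta>') - \<delta> / 2"
  define k where "k = (\<lambda>N. Suc (nat \<lfloor>real N * a\<rfloor>))"
  have k1: "1 \<le> k N" for N by (simp add: k_def)
  have k: "(\<lambda>N. real (k N) / real N) \<longlonglongrightarrow> a"
    unfolding k_def by (intro ratio_Suc_tendsto scaled_floor_tendsto a)
  have le: "\<forall>\<^sub>F N in sequentially. k N < m N" by (rule eventually_ratio_less[OF k m a(2)])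
  note mk = ratio_diff_tendsto[OF m k a(2)]
  obtain c1 where c1: "c1 < 0" "exp_rate_le (\<lambda>N. prob {\<omega> \<in> space P. Z_hor (W \<omega>) (k N, 0) < exp (real N * ?w1)}) c1"
    using axis_lower_tail[OF _ k, of "\<delta> / 2"] d k1 by auto
  obtain c2 where c2: "c2 < 0" "exp_rate_le (\<lambda>N. measure (bulk_law \<mu> (m N - k N) (j N)) {..<exp (real N * ?w2)}) c2"
    using bulk_lower_tail[OF th _ t _ mk j, of "\<delta> / 2"] a d slope by (auto simp: lln_slope_def)
  have "exp_rate_le (\<lambda>N. prob {\<omega> \<in> space P. Z_hor (W \<omega>) (k N, 0) < exp (real N * ?w1)} +
      measure (bulk_law \<mu> (m N - k N) (j N)) {..<exp (real N * ?w2)}) (max c1 c2)"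
    by (intro exp_rate_le_add exp_rate_le_mono[OF c1(2)] exp_rate_le_mono[OF c2(2)]) auto
  then have "exp_rate_le (\<lambda>N. prob {\<omega> \<in> space P. Z_hor (W \<omega>) (m N, Suc (j N)) < exp (real N * (?w1 + ?w2))}) (max c1 c2)"
  proof (rule exp_rate_le_mono[OF _ _ order_refl])
    show "\<forall>\<^sub>F N in sequentially. prob {\<omega> \<in> space P. Z_hor (W \<omega>) (m N, Suc (j N)) < exp (real N * (?w1 + ?w2))} \<le>
       prob {\<omega> \<in> space P. Z_hor (W \<omega>) (k N, 0) < exp (real N * ?w1)} +
       measure (bulk_law \<mu> (m N - k N) (j N)) {..<exp (real N * ?w2)}"
      using le
    proof eventually_elim
      case (elim N)
      let ?A = "{\<omega> \<in> space P. Z_hor (W \<omega>) (k N, 0) < exp (real N * ?w1)}"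
        and ?B = "{\<omega> \<in> space P. Z_square (W \<omega>) (k N, 1) (k N + (m N - k N), 1 + j N) < exp (real N * ?w2)}"
      have "prob {\<omega> \<in> space P. Z_hor (W \<omega>) (m N, Suc (j N)) < exp (real N * (?w1 + ?w2))} \<le> prob (?A \<union> ?B)"
      proof (rule finite_measure_mono_AE)
        show "AE \<omega> in P. \<omega> \<in> {\<omega> \<in> space P. Z_hor (W \<omega>) (m N, Suc (j N)) < exp (real N * (?w1 + ?w2))} \<longrightarrow> \<omega> \<in> ?A \<union> ?B"
          using AE_hor_ver_nonneg
        proof eventually_elim
          case (elim \<omega>)
          \<comment> \<open>The axis product is itself a horizontal partition function of height 0,
            so \<open>axis_lower_tail\<close> covers it.\<close>
          have ax: "Z_hor (W \<omega>) (k N, 0) = prodW ({1..k N} \<times> {0}) \<omega>"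
            using k1[of N] by (simp add: Z_hor_rec Z_square_horizontal prodW_row)
          have "hor (m N) (Suc (j N)) (k N) \<omega> \<le> Z_hor (W \<omega>) (m N, Suc (j N))"
            using elim k1[of N] \<open>k N < m N\<close> by (subst Z_hor_eq_sum) (auto intro!: member_le_sum)
          then have "Z_hor (W \<omega>) (k N, 0) * Z_square (W \<omega>) (k N, 1) (m N, Suc (j N)) \<le> Z_hor (W \<omega>) (m N, Suc (j N))"
            by (simp add: hor_def ax)
          moreover have "exp (real N * (?w1 + ?w2)) \<le> Z_hor (W \<omega>) (k N, 0) * Z_square (W \<omega>) (k N, 1) (m N, Suc (j N))"
            if "exp (real N * ?w1) \<le> Z_hor (W \<omega>) (k N, 0)"
              "exp (real N * ?w2) \<le> Z_square (W \<omega>) (k N, 1) (m N, Suc (j N))"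
            unfolding distrib_left exp_add using that by (intro mult_mono) (auto intro: order_trans[OF exp_ge_zero])
          moreover have km: "k N + (m N - k N) = m N" "1 + j N = Suc (j N)" using \<open>k N < m N\<close> by auto
          ultimately show ?case unfolding km mem_Collect_eq Un_iff by linarith
        qed
      qed measurable
      also have "\<dots> \<le> prob ?A + prob ?B" by (rule measure_Un_le) measurable
      also have "prob ?B = measure (bulk_law \<mu> (m N - k N) (j N)) {..<exp (real N * ?w2)}"
        using k1[of N] by (intro prob_Z_bulk) auto
      finally show ?case .
    qed
  qed
  moreover have w: "?w1 + ?w2 = - a * Digamma \<theta> + (- (s - a) * Digamma \<theta>' - t * Digamma (\<mu> - \<theta>')) - \<delta>" by simp
  moreover have "max c1 c2 < 0" using c1 c2 by simp
  ultimately show ?thesis unfolding w by (intro exI[of _ "max c1 c2"] conjI)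
qed

text \<open>Same dichotomy as for the moments, with trigamma values in place of digamma
  increments.\<close>

lemma hor_lln_pos:
  assumes st: "0 < s" "0 < t"
    and m: "(\<lambda>N. real (m N) / real N) \<longlonglongrightarrow> s" and j: "(\<lambda>N. real (j N) / real N) \<longlonglongrightarrow> t"
  shows "AE \<omega> in P. (\<lambda>N. ln (Z_hor (W \<omega>) (m N, Suc (j N))) / real N) \<longlonglongrightarrow>
    (if s * Polygamma 1 \<theta> \<ge> t * Polygamma 1 (\<mu> - \<theta>)
     then - s * Digamma \<theta> - t * Digamma (\<mu> - \<theta>) else free_energy \<mu> s t)"
proof (cases "s * Polygamma 1 \<theta> \<ge> t * Polygamma 1 (\<mu> - \<theta>)")
  case True
  have pos: "0 < Polygamma 1 \<theta>" "0 < Polygamma 1 (\<mu> - \<theta>)" using theta trigamma_pos[of \<theta>] trigamma_pos[of "\<mu> - \<theta>"] by auto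
  \<comment> \<open>The exit point for which \<theta> is stationary in direction (s - a, t).\<close>
  define a where "a = s - t * Polygamma 1 (\<mu> - \<theta>) / Polygamma 1 \<theta>"
  have a: "0 \<le> a" "a < s" "lln_slope \<mu> (s - a) t \<theta> = 0"
    using True pos st by (auto simp: a_def lln_slope_def divide_simps)
  have eq: "- a * Digamma \<theta> + (- (s - a) * Digamma \<theta> - t * Digamma (\<mu> - \<theta>)) = - s * Digamma \<theta> - t * Digamma (\<mu> - \<theta>)"
    by (simp add: algebra_simps)
  have "AE \<omega> in P. (\<lambda>N. ln (Z_hor (W \<omega>) (m N, Suc (j N))) / real N) \<longlonglongrightarrow> - s * Digamma \<theta> - t * Digamma (\<mu> - \<theta>)"
    using hor_upper_tail[OF theta(1) order_refl st(1) _ m j] hor_lower_tail[OF theta a(1,2) st(2) a(3) _ m j, unfolded eq]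
    by (intro AE_ln_limit) auto
  then show ?thesis using True by simp
next
  case False
  then have "0 < lln_slope \<mu> s t \<theta>" by (simp add: lln_slope_def)
  then obtain x where x: "0 < x" "x < \<theta>" "lln_slope \<mu> s t x = 0"
    using lln_slope_zero_exists[of \<theta> \<mu> s t] theta st by auto
  have "AE \<omega> in P. (\<lambda>N. ln (Z_hor (W \<omega>) (m N, Suc (j N))) / real N) \<longlonglongrightarrow> - s * Digamma x - t * Digamma (\<mu> - x)"
    using hor_upper_tail[OF x(1) less_imp_le[OF x(2)] st(1) _ m j] hor_lower_tail[OF x(1) _ order_refl st _ _ m j] x theta
    by (intro AE_ln_limit) auto
  moreover have "free_energy \<mu> s t = - s * Digamma x - t * Digamma (\<mu> - x)"
    using x theta st by (intro free_energy_eq) auto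
  ultimately show ?thesis using False by simp
qed

lemma axis_lln:
  assumes "0 < s" and m: "(\<lambda>N. real (m N) / real N) \<longlonglongrightarrow> s"
  shows "AE \<omega> in P. (\<lambda>N. ln (Z_hor (W \<omega>) (m N, 0)) / real N) \<longlonglongrightarrow> - s * Digamma \<theta>"
proof -
  have "\<forall>\<^sub>F N in sequentially. 1 \<le> m N"
    using eventually_ratio_less[OF _ m assms(1), of "\<lambda>_. 0"] by (simp add: Suc_le_eq)
  then show ?thesis
    using axis_upper_tail[OF assms(1) _ m] axis_lower_tail[OF _ m] by (intro AE_ln_limit) auto
qed

end

section \<open>Positive heights as successors, and the boundary cases\<close>

lemma ratio_pred_tendsto:
  assumes n: "(\<lambda>N. real (n N) / real N) \<longlonglongrightarrow> t" and "0 < t"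
  shows "\<forall>\<^sub>F N in sequentially. n N = Suc (n N - 1)" "(\<lambda>N. real (n N - 1) / real N) \<longlonglongrightarrow> t"
proof -
  have "\<forall>\<^sub>F N in sequentially. 0 < n N"
    using eventually_ratio_less[OF _ n assms(2), of "\<lambda>_. 0"] by simp
  then show ev: "\<forall>\<^sub>F N in sequentially. n N = Suc (n N - 1)" by eventually_elim simp
  have "(\<lambda>N. 1 / real N) \<longlonglongrightarrow> 0" by real_asymp
  from tendsto_diff[OF n this] have "(\<lambda>N. real (n N) / real N - 1 / real N) \<longlonglongrightarrow> t" by simp
  then show "(\<lambda>N. real (n N - 1) / real N) \<longlonglongrightarrow> t"
  proof (rule Lim_transform_eventually)
    show "\<forall>\<^sub>F N in sequentially. real (n N) / real N - 1 / real N = real (n N - 1) / real N"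
      using ev by eventually_elim (metis diff_divide_distrib of_nat_Suc add_diff_cancel_left')
  qed
qed

text \<open>For s = 0 no path can start with a horizontal step, so the partition function is 0 and
  has no logarithm: s is taken positive. The integrability clause ensures that the expectation is a
  true moment and not the default value 0 of a divergent integral; it holds eventually, once the
  integer part of n s is positive.\<close>

theorem theorem2p14:
  fixes P :: "'a measure"
    and U V :: "nat \<Rightarrow> 'a \<Rightarrow> real"
    and Y :: "nat \<Rightarrow> nat \<Rightarrow> 'a \<Rightarrow> real"
    and \<mu> \<theta> \<xi> s t :: real
  defines "Z \<equiv> \<lambda>(n::nat) \<omega>.
      Z_hor (stationary_weight U V Y \<omega>) (nat \<lfloor>real n * s\<rfloor>, nat \<lfloor>real n * t\<rfloor>)"
  assumes "stationary_log_gamma P \<mu> \<theta> U V Y"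
    and "0 < \<theta>" "\<theta> < \<mu>"
    and "0 \<le> \<xi>" "\<xi> < \<theta>"
    and "0 < s" "0 \<le> t"
  shows "(AE \<omega> in P. (\<lambda>n. ln (Z n \<omega>) / real n) \<longlonglongrightarrow>
            (if s * Polygamma 1 \<theta> \<ge> t * Polygamma 1 (\<mu> - \<theta>)
             then - s * Digamma \<theta> - t * Digamma (\<mu> - \<theta>)
             else free_energy \<mu> s t)) \<and>
         (\<forall>\<^sub>F n in sequentially. integrable P (\<lambda>\<omega>. exp (\<xi> * ln (Z n \<omega>)))) \<and>
         (\<lambda>n. ereal (ln (prob_space.expectation P (\<lambda>\<omega>. exp (\<xi> * ln (Z n \<omega>)))) / real n))
           \<longlonglongrightarrow>
            (if s * (Digamma \<theta> - Digamma (\<theta> - \<xi>)) \<ge> t * (Digamma (\<mu> - \<theta> + \<xi>) - Digamma (\<mu> - \<theta>))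
             then ereal s * log_mgf \<theta> \<xi> - ereal t * log_mgf (\<mu> - \<theta>) (- \<xi>)
             else limit_log_mgf \<mu> s t \<xi>)"
proof -
  have "prob_space P" using assms(2) by (simp add: stationary_log_gamma_def)
  then interpret log_gamma_model P \<mu> \<theta> U V Y
    using assms(2-4) by (simp add: log_gamma_model_def log_gamma_model_axioms_def)
  define m where "m = (\<lambda>N::nat. nat \<lfloor>real N * s\<rfloor>)"
  define n where "n = (\<lambda>N::nat. nat \<lfloor>real N * t\<rfloor>)"
  have m: "(\<lambda>N. real (m N) / real N) \<longlonglongrightarrow> s" and n: "(\<lambda>N. real (n N) / real N) \<longlonglongrightarrow> t"
    unfolding m_def n_def using assms by (intro scaled_floor_tendsto; simp)+
  have Z: "Z = (\<lambda>N \<omega>. Z_hor (W \<omega>) (m N, n N))" by (simp add: Z_def m_def n_def)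
  have m1: "\<forall>\<^sub>F N in sequentially. 1 \<le> m N"
    using eventually_ratio_less[OF _ m assms(7), of "\<lambda>_. 0"] by (simp add: Suc_le_eq)
  have n0: "n N = 0" if "t = 0" for N using that by (simp add: n_def)
  let ?A = "if s * Polygamma 1 \<theta> \<ge> t * Polygamma 1 (\<mu> - \<theta>)
     then - s * Digamma \<theta> - t * Digamma (\<mu> - \<theta>) else free_energy \<mu> s t"
  let ?B = "if s * (Digamma \<theta> - Digamma (\<theta> - \<xi>)) \<ge> t * (Digamma (\<mu> - \<theta> + \<xi>) - Digamma (\<mu> - \<theta>))
     then ereal s * log_mgf \<theta> \<xi> - ereal t * log_mgf (\<mu> - \<theta>) (- \<xi>) else limit_log_mgf \<mu> s t \<xi>"
  have a: "AE \<omega> in P. (\<lambda>N. ln (Z N \<omega>) / real N) \<longlonglongrightarrow> ?A"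
  \<comment> \<open>For t = 0 all heights are 0 and only the path along the axis remains; the first
    branch of the limit applies because its condition reads 0 <= s \<Psi>_1(\<theta>).\<close>
  proof (cases "t = 0")
    case True
    have "0 \<le> s * Polygamma 1 \<theta>" using assms trigamma_pos[of \<theta>] by simp
    then show ?thesis using axis_lln[OF assms(7) m] True by (simp add: Z n0)
  next
    case False
    then have t: "0 < t" using assms by simp
    note pred = ratio_pred_tendsto[OF n t]
    show ?thesis using hor_lln_pos[OF assms(7) t m pred(2)]
    proof eventually_elim
      case (elim \<omega>)
      then show ?case
      proof (rule Lim_transform_eventually)
        show "\<forall>\<^sub>F N in sequentially. ln (Z_hor (W \<omega>) (m N, Suc (n N - 1))) / real N = ln (Z N \<omega>) / real N"
          using pred(1) by eventually_elim (simp add: Z)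
      qed
    qed
  qed
  have b: "\<forall>\<^sub>F N in sequentially. integrable P (\<lambda>\<omega>. exp (\<xi> * ln (Z N \<omega>)))"
    using m1 by eventually_elim (simp add: Z expectation_exp_ln_Z_hor(1)[OF assms(5,6)])
  have lim: "(\<lambda>N. ereal (ln (hor_mgf \<xi> (m N) (n N)) / real N)) \<longlonglongrightarrow> ?B"
  proof (cases "t = 0")
    case True
    have "(\<lambda>N. real (m N) / real N * lm_hor \<xi> \<theta>) \<longlonglongrightarrow> s * lm_hor \<xi> \<theta>" by (intro tendsto_intros m)
    then have "(\<lambda>N. ln (hor_mgf \<xi> (m N) (n N)) / real N) \<longlonglongrightarrow> s * lm_hor \<xi> \<theta>"
    proof (rule Lim_transform_eventually)
      show "\<forall>\<^sub>F N in sequentially. real (m N) / real N * lm_hor \<xi> \<theta> = ln (hor_mgf \<xi> (m N) (n N)) / real N"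
        using m1 by eventually_elim
          (use assms in \<open>simp add: n0[OF True] hor_mgf_axis power_inv_gamma_moment_hor\<close>)
    qed
    moreover have "0 \<le> s * (Digamma \<theta> - Digamma (\<theta> - \<xi>))"
      using assms Digamma_real_mono[of "\<theta> - \<xi>" \<theta>] by simp
    moreover have "ereal s * log_mgf \<theta> \<xi> - ereal t * log_mgf (\<mu> - \<theta>) (- \<xi>) = ereal (s * lm_hor \<xi> \<theta>)"
      using True assms by (simp add: log_mgf_eq lm_hor_def)
    ultimately show ?thesis using True by simp
  next
    case False
    then have t: "0 < t" using assms by simp
    note pred = ratio_pred_tendsto[OF n t]
    have "(\<lambda>N. ereal (ln (hor_mgf \<xi> (m N) (Suc (n N - 1))) / real N)) \<longlonglongrightarrow> ?B"
    \<comment> \<open>At \<xi> = 0 the slope vanishes identically, so the stationarity argument has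
      nothing to work with; the moment is simply 1.\<close>
    proof (cases "\<xi> = 0")
      case True
      have "(\<lambda>N. ereal (ln (hor_mgf \<xi> (m N) (Suc (n N - 1))) / real N)) \<longlonglongrightarrow> 0"
      proof (rule Lim_transform_eventually[OF tendsto_const])
        show "\<forall>\<^sub>F N in sequentially. 0 = ereal (ln (hor_mgf \<xi> (m N) (Suc (n N - 1))) / real N)"
          using m1
        proof eventually_elim
          case (elim N)
          have "hor_mgf \<xi> (m N) (Suc (n N - 1)) = 1"
            using expectation_exp_ln_Z_hor(2)[OF assms(5,6) elim, of "Suc (n N - 1)"] True
            by (simp add: prob_space)
          then show ?case by simp
        qed
      qed
      \<comment> \<open>Both sides of the case condition are 0, so the first branch is taken, and M
        vanishes at 0.\<close>
      moreover have "?B = 0" using True assms by (simp add: log_mgf_def)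
      ultimately show ?thesis by simp
    next
      case False
      then show ?thesis using assms t by (intro hor_mgf_limit_pos m pred) auto
    qed
    then show ?thesis
    proof (rule Lim_transform_eventually)
      show "\<forall>\<^sub>F N in sequentially. ereal (ln (hor_mgf \<xi> (m N) (Suc (n N - 1))) / real N) =
          ereal (ln (hor_mgf \<xi> (m N) (n N)) / real N)"
        using pred(1) by eventually_elim simp
    qed
  qed
  have c: "(\<lambda>N. ereal (ln (expectation (\<lambda>\<omega>. exp (\<xi> * ln (Z N \<omega>)))) / real N)) \<longlonglongrightarrow> ?B"
  proof (rule Lim_transform_eventually[OF lim])
    show "\<forall>\<^sub>F N in sequentially. ereal (ln (hor_mgf \<xi> (m N) (n N)) / real N) =
        ereal (ln (expectation (\<lambda>\<omega>. exp (\<xi> * ln (Z N \<omega>)))) / real N)"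
      using m1 by eventually_elim (simp add: Z expectation_exp_ln_Z_hor(2)[OF assms(5,6)])
  qed
  show ?thesis using a b c by blast
qed

end
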